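(* Let $\mathcal{D}$ be a $\mathbf{k}$-linear triangulated category with a Serre functor such that every admissible subcategory of $\mathcal{D}$ is generated by an exceptional sequence (that is, equals $\langle E_1,\dots,E_r\rangle$ for some exceptional sequence $(E_1,\dots,E_r)$). Then there is a bijection $$\chi:\{\text{equivalence classes of full exceptional sequences in }\mathcal{D}\}\longrightarrow\{\text{finest SODs of }\mathcal{D}\},\qquad (E_1,\dots,E_n)\longmapsto(\langle E_1\rangle,\dots,\langle E_n\rangle),$$ which is compatible with mutations in the sense that $\chi\,\mathrm{L}_i=\rho_i\,\chi$ and $\chi\,\mathrm{R}_i=\check\rho_i\,\chi$.
   Context: $\mathbf{k}$ is a fixed algebraically closed field. $\Phi_n=\{1<2<\dots<n\}$. For a set $\mathcal{S}$ of objects (or a family of subcategories) of $\mathcal{D}$, $\langle\mathcal{S}\rangle$ is the full triangulated subcategory of $\mathcal{D}$ generated by $\mathcal{S}$, closed under extensions, direct summands and shifts. For a full triangulated subcategory $\mathcal{B}\subset\mathcal{D}$: $\mathcal{B}^\perp=\{X\mid \mathrm{Hom}(B,X)=0\ \forall B\in\mathcal{B}\}$ and ${}^\perp\mathcal{B}=\{X\mid \mathrm{Hom}(X,B)=0\ \forall B\in\mathcal{B}\}$. A full triangulated subcategory is right (left) admissible if its inclusion has a right (left) adjoint, and admissible if both. Serre functor: $\mathcal{D}$ has finite-dimensional Hom spaces and there is an autoequivalence $\mathbb{S}$ with natural isomorphisms $\mathrm{Hom}(X,Y)\cong\mathrm{Hom}(Y,\mathbb{S}X)^*$. SOD: a semi-orthogonal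 decomposition (SOD) of $\mathcal{D}$ is a sequence $(\Pi_i;i\in\Phi_n)$ of nonzero full triangulated subcategories with $\mathrm{Hom}(\Pi_j,\Pi_i)=0$ for $i<j$ and $\mathcal{D}=\langle\Pi_i\mid i\in\Phi_n\rangle$. $(\Pi_i;i\in\Phi_n)$ is finer than $(P_j;j\in\Phi_m)$ if there is a surjective non-decreasing map $r:\Phi_n\to\Phi_m$ with $P_j=\langle\Pi_i\mid r(i)=j\rangle$ for all $j$. Minimal elements for this partial order are called finest SODs. Mutations of SODs ($1\le i\le n-1$): $\rho_i$ (right mutation) replaces the pair $(\Pi_i,\Pi_{i+1})$ in positions $i,i+1$ by $(\Pi_i^\perp\cap\langle\Pi_i,\Pi_{i+1}\rangle,\ \Pi_i)$; $\check\rho_i$ (left mutation) replaces it by $(\Pi_{i+1},\ {}^\perp\Pi_{i+1}\cap\langle\Pi_i,\Pi_{i+1}\rangle)$; other terms are unchanged. Exceptional sequences: $E$ is exceptional if $\mathrm{Hom}(E,E)=\mathbf{k}$ and $\mathrm{Hom}(E,E[l])=0$ for $l\ne0$. $(E_1,\dots,E_n)$ is an exceptional sequence if each $E_i$ is exceptional and $\mathrm{Hom}(E_j,E_i[l])=0$ for all $i<j$ and $l\in\mathbb{Z}$; it is full if $\langle E_1,\dots,E_n\rangle=\mathcal{D}$. Two exceptional sequences $(E_i;i\in\Phi_n)$, $(F_i;i\in\Phi_n)$ are equivalent if $\langle E_i\rangle=\langle F_i\rangle$ for all $i$. Mutations of exceptional sequences ($1\le i\le n-1$): for an exceptional pair $(E,F)$,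 $L_EF$ is defined by the triangle $L_EF\to\bigoplus_l\mathrm{Hom}(E,F[l])\otimes E[-l]\to F\to L_EF[1]$ (evaluation map), and $R_FE$ by the triangle $E\to\bigoplus_l\mathrm{Hom}(E,F[l])^*\otimes F[l]\to R_FE\to E[1]$ (coevaluation map). $\mathrm{L}_i$ replaces $(E_i,E_{i+1})$ in a sequence by $(L_{E_i}E_{i+1},E_i)$ and $\mathrm{R}_i$ replaces it by $(E_{i+1},R_{E_{i+1}}E_i)$.
   Formalization: The terms of an SOD are required to be closed under direct summands; otherwise "finer" is not reflexive and the claim fails, e.g. in D^b(vect) the complexes of even Euler characteristic form a one-term finest SOD not of the form ⟨E⟩. *)

theory Defs
  imports "HOL-Computational_Algebra.Polynomial" "HOL-Library.FuncSet" "HOL.Hull"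
begin

text \<open>
  All Hom-spaces of a k-linear category are given as subspaces of one ambient vector space
  (think of their direct sum), so that the library's linear algebra and finite sums apply
  directly. Distinct Hom-spaces meet only in zero, i.e. a nonzero morphism determines its source
  and target. Every k-linear category with a set of objects is isomorphic to one of this form.
  The shift is a strict action of the integers by k-linear functors: \<open>sh D l X\<close> is $X[l]$ and
  \<open>shm D l f\<close> is $f[l]$. The predicate \<open>dist D X Y Z f g h\<close> says that
  $X \to Y \to Z \to X[1]$ is a distinguished triangle.
\<close>

record ('o, 'm, 'k) tri_cat =
  Ob :: "'o set"
  Hom :: "'o \<Rightarrow> 'o \<Rightarrow> 'm set"
  Id :: "'o \<Rightarrow> 'm"
  cmp :: "'m \<Rightarrow> 'm \<Rightarrow> 'm"  (infixl \<open>\<cdot>\<index>\<close> 70)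
  scl :: "'k \<Rightarrow> 'm \<Rightarrow> 'm"
  sh :: "int \<Rightarrow> 'o \<Rightarrow> 'o"
  shm :: "int \<Rightarrow> 'm \<Rightarrow> 'm"
  dist :: "'o \<Rightarrow> 'o \<Rightarrow> 'o \<Rightarrow> 'm \<Rightarrow> 'm \<Rightarrow> 'm \<Rightarrow> bool"

locale klinear_category =
  fixes D :: "('o, 'm::ab_group_add, 'k::field) tri_cat" (structure)
  assumes vector_space_scl: "vector_space (scl D)"
    and subspace_Hom: "\<lbrakk>X \<in> Ob D; Y \<in> Ob D\<rbrakk> \<Longrightarrow> module.subspace (scl D) (Hom D X Y)"
    and Hom_disjoint:
      "\<lbrakk>X \<in> Ob D; Y \<in> Ob D; X' \<in> Ob D; Y' \<in> Ob D; f \<in> Hom D X Y; f \<in> Hom D X' Y'; f \<noteq> 0\<rbrakk>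
        \<Longrightarrow> X = X' \<and> Y = Y'"
    and Id_in_Hom: "X \<in> Ob D \<Longrightarrow> Id D X \<in> Hom D X X"
    and cmp_in_Hom:
      "\<lbrakk>X \<in> Ob D; Y \<in> Ob D; Z \<in> Ob D; f \<in> Hom D X Y; g \<in> Hom D Y Z\<rbrakk> \<Longrightarrow> g \<cdot> f \<in> Hom D X Z"
    and cmp_Id_left: "\<lbrakk>X \<in> Ob D; Y \<in> Ob D; f \<in> Hom D X Y\<rbrakk> \<Longrightarrow> Id D Y \<cdot> f = f"
    and cmp_Id_right: "\<lbrakk>X \<in> Ob D; Y \<in> Ob D; f \<in> Hom D X Y\<rbrakk> \<Longrightarrow> f \<cdot> Id D X = f"
    and cmp_assoc:
      "\<lbrakk>W \<in> Ob D; X \<in> Ob D; Y \<in> Ob D; Z \<in> Ob D; f \<in> Hom D W X; g \<in> Hom D X Y; h \<in> Hom D Y Z\<rbrakk>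
        \<Longrightarrow> h \<cdot> (g \<cdot> f) = (h \<cdot> g) \<cdot> f"
    and cmp_add_left:
      "\<lbrakk>X \<in> Ob D; Y \<in> Ob D; Z \<in> Ob D; f \<in> Hom D X Y; g \<in> Hom D Y Z; g' \<in> Hom D Y Z\<rbrakk>
        \<Longrightarrow> (g + g') \<cdot> f = g \<cdot> f + g' \<cdot> f"
    and cmp_add_right:
      "\<lbrakk>X \<in> Ob D; Y \<in> Ob D; Z \<in> Ob D; f \<in> Hom D X Y; f' \<in> Hom D X Y; g \<in> Hom D Y Z\<rbrakk>
        \<Longrightarrow> g \<cdot> (f + f') = g \<cdot> f + g \<cdot> f'"
    and cmp_scl_left:
      "\<lbrakk>X \<in> Ob D; Y \<in> Ob D; Z \<in> Ob D; f \<in> Hom D X Y; g \<in> Hom D Y Z\<rbrakk>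
        \<Longrightarrow> scl D c g \<cdot> f = scl D c (g \<cdot> f)"
    and cmp_scl_right:
      "\<lbrakk>X \<in> Ob D; Y \<in> Ob D; Z \<in> Ob D; f \<in> Hom D X Y; g \<in> Hom D Y Z\<rbrakk>
        \<Longrightarrow> g \<cdot> scl D c f = scl D c (g \<cdot> f)"

definition iso_mor :: "('o, 'm::ab_group_add, 'k::field) tri_cat \<Rightarrow> 'o \<Rightarrow> 'o \<Rightarrow> 'm \<Rightarrow> bool" where
  "iso_mor D X Y f \<longleftrightarrow> f \<in> Hom D X Y \<and>
     (\<exists>g \<in> Hom D Y X. g \<cdot>\<^bsub>D\<^esub> f = Id D X \<and> f \<cdot>\<^bsub>D\<^esub> g = Id D Y)"

definition isomorphic :: "('o, 'm::ab_group_add, 'k::field) tri_cat \<Rightarrow> 'o \<Rightarrow> 'o \<Rightarrow> bool" where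
  "isomorphic D X Y \<longleftrightarrow> X \<in> Ob D \<and> Y \<in> Ob D \<and> (\<exists>f. iso_mor D X Y f)"

definition zero_object :: "('o, 'm::ab_group_add, 'k::field) tri_cat \<Rightarrow> 'o \<Rightarrow> bool" where
  "zero_object D Z \<longleftrightarrow> Z \<in> Ob D \<and> (\<forall>X \<in> Ob D. Hom D X Z = {0} \<and> Hom D Z X = {0})"

definition direct_sum ::
  "('o, 'm::ab_group_add, 'k::field) tri_cat \<Rightarrow> 'i set \<Rightarrow> ('i \<Rightarrow> 'o) \<Rightarrow> 'o \<Rightarrow>
     ('i \<Rightarrow> 'm) \<Rightarrow> ('i \<Rightarrow> 'm) \<Rightarrow> bool" where
  "direct_sum D I X P \<iota> \<pi> \<longleftrightarrow> finite I \<and> P \<in> Ob D \<and>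
     (\<forall>i \<in> I. X i \<in> Ob D \<and> \<iota> i \<in> Hom D (X i) P \<and> \<pi> i \<in> Hom D P (X i)) \<and>
     (\<forall>i \<in> I. \<forall>j \<in> I. \<pi> i \<cdot>\<^bsub>D\<^esub> \<iota> j = (if i = j then Id D (X i) else 0)) \<and>
     (\<Sum>i \<in> I. \<iota> i \<cdot>\<^bsub>D\<^esub> \<pi> i) = Id D P"

definition direct_summand :: "('o, 'm::ab_group_add, 'k::field) tri_cat \<Rightarrow> 'o \<Rightarrow> 'o \<Rightarrow> bool" where
  "direct_summand D Y X \<longleftrightarrow>
     (\<exists>Y' \<iota> \<pi>. direct_sum D (UNIV :: bool set) (\<lambda>b. if b then Y else Y') X \<iota> \<pi>)"

locale klinear_triangulated_category = klinear_category +
  \<comment> \<open>additivity; the empty sum is a zero object\<close>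
  assumes direct_sums:
      "(\<And>i. i < n \<Longrightarrow> A i \<in> Ob D) \<Longrightarrow> \<exists>P \<iota> \<pi>. direct_sum D {..<n::nat} A P \<iota> \<pi>"
  \<comment> \<open>the shift\<close>
    and sh_in_Ob: "X \<in> Ob D \<Longrightarrow> sh D l X \<in> Ob D"
    and shm_in_Hom:
      "\<lbrakk>X \<in> Ob D; Y \<in> Ob D; f \<in> Hom D X Y\<rbrakk> \<Longrightarrow> shm D l f \<in> Hom D (sh D l X) (sh D l Y)"
    and shm_Id: "X \<in> Ob D \<Longrightarrow> shm D l (Id D X) = Id D (sh D l X)"
    and shm_cmp:
      "\<lbrakk>X \<in> Ob D; Y \<in> Ob D; Z \<in> Ob D; f \<in> Hom D X Y; g \<in> Hom D Y Z\<rbrakk>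
        \<Longrightarrow> shm D l (g \<cdot> f) = shm D l g \<cdot> shm D l f"
    and shm_add:
      "\<lbrakk>X \<in> Ob D; Y \<in> Ob D; f \<in> Hom D X Y; g \<in> Hom D X Y\<rbrakk>
        \<Longrightarrow> shm D l (f + g) = shm D l f + shm D l g"
    and shm_scl:
      "\<lbrakk>X \<in> Ob D; Y \<in> Ob D; f \<in> Hom D X Y\<rbrakk> \<Longrightarrow> shm D l (scl D r f) = scl D r (shm D l f)"
    and sh_0: "X \<in> Ob D \<Longrightarrow> sh D 0 X = X"
    and shm_0: "\<lbrakk>X \<in> Ob D; Y \<in> Ob D; f \<in> Hom D X Y\<rbrakk> \<Longrightarrow> shm D 0 f = f"
    and sh_sh: "X \<in> Ob D \<Longrightarrow> sh D l (sh D m X) = sh D (l + m) X"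
    and shm_shm:
      "\<lbrakk>X \<in> Ob D; Y \<in> Ob D; f \<in> Hom D X Y\<rbrakk> \<Longrightarrow> shm D l (shm D m f) = shm D (l + m) f"
  \<comment> \<open>the distinguished triangles: typing and closure under isomorphism\<close>
    and dist_typed:
      "dist D X Y Z f g h \<Longrightarrow> X \<in> Ob D \<and> Y \<in> Ob D \<and> Z \<in> Ob D \<and>
         f \<in> Hom D X Y \<and> g \<in> Hom D Y Z \<and> h \<in> Hom D Z (sh D 1 X)"
    and dist_iso:
      "\<lbrakk>dist D X Y Z f g h; X' \<in> Ob D; Y' \<in> Ob D; Z' \<in> Ob D;
        f' \<in> Hom D X' Y'; g' \<in> Hom D Y' Z'; h' \<in> Hom D Z' (sh D 1 X');
        iso_mor D X X' a; iso_mor D Y Y' b; iso_mor D Z Z' c;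
        b \<cdot> f = f' \<cdot> a; c \<cdot> g = g' \<cdot> b; shm D 1 a \<cdot> h = h' \<cdot> c\<rbrakk>
        \<Longrightarrow> dist D X' Y' Z' f' g' h'"
  \<comment> \<open>TR1\<close>
    and TR1_Id: "\<lbrakk>X \<in> Ob D; zero_object D Z\<rbrakk> \<Longrightarrow> dist D X X Z (Id D X) 0 0"
    and TR1_cone: "\<lbrakk>X \<in> Ob D; Y \<in> Ob D; f \<in> Hom D X Y\<rbrakk> \<Longrightarrow> \<exists>Z g h. dist D X Y Z f g h"
  \<comment> \<open>TR2\<close>
    and TR2:
      "\<lbrakk>X \<in> Ob D; Y \<in> Ob D; Z \<in> Ob D; f \<in> Hom D X Y; g \<in> Hom D Y Z; h \<in> Hom D Z (sh D 1 X)\<rbrakk>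
        \<Longrightarrow> dist D X Y Z f g h \<longleftrightarrow> dist D Y Z (sh D 1 X) g h (- shm D 1 f)"
  \<comment> \<open>TR3\<close>
    and TR3:
      "\<lbrakk>dist D X Y Z f g h; dist D X' Y' Z' f' g' h';
        a \<in> Hom D X X'; b \<in> Hom D Y Y'; b \<cdot> f = f' \<cdot> a\<rbrakk>
        \<Longrightarrow> \<exists>c \<in> Hom D Z Z'. c \<cdot> g = g' \<cdot> b \<and> shm D 1 a \<cdot> h = h' \<cdot> c"
  \<comment> \<open>TR4, the octahedral axiom\<close>
    and TR4:
      "\<lbrakk>dist D X Y Q\<^sub>1 f p\<^sub>1 d\<^sub>1; dist D X Z Q\<^sub>2 (g \<cdot> f) p\<^sub>2 d\<^sub>2; dist D Y Z Q\<^sub>3 g p\<^sub>3 d\<^sub>3\<rbrakk>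
        \<Longrightarrow> \<exists>a b. dist D Q\<^sub>1 Q\<^sub>2 Q\<^sub>3 a b (shm D 1 p\<^sub>1 \<cdot> d\<^sub>3) \<and>
              a \<cdot> p\<^sub>1 = p\<^sub>2 \<cdot> g \<and> d\<^sub>2 \<cdot> a = d\<^sub>1 \<and> b \<cdot> p\<^sub>2 = p\<^sub>3 \<and> d\<^sub>3 \<cdot> b = shm D 1 f \<cdot> d\<^sub>2"

definition linear_functor ::
  "('o, 'm::ab_group_add, 'k::field) tri_cat \<Rightarrow> ('o \<Rightarrow> 'o) \<Rightarrow> ('m \<Rightarrow> 'm) \<Rightarrow> bool" where
  "linear_functor D F\<^sub>o F\<^sub>m \<longleftrightarrow>
     (\<forall>X \<in> Ob D. F\<^sub>o X \<in> Ob D \<and> F\<^sub>m (Id D X) = Id D (F\<^sub>o X)) \<and>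
     (\<forall>X \<in> Ob D. \<forall>Y \<in> Ob D. \<forall>f \<in> Hom D X Y. F\<^sub>m f \<in> Hom D (F\<^sub>o X) (F\<^sub>o Y) \<and>
        (\<forall>f' \<in> Hom D X Y. F\<^sub>m (f + f') = F\<^sub>m f + F\<^sub>m f') \<and>
        (\<forall>c. F\<^sub>m (scl D c f) = scl D c (F\<^sub>m f))) \<and>
     (\<forall>X \<in> Ob D. \<forall>Y \<in> Ob D. \<forall>Z \<in> Ob D. \<forall>f \<in> Hom D X Y. \<forall>g \<in> Hom D Y Z.
        F\<^sub>m (g \<cdot>\<^bsub>D\<^esub> f) = F\<^sub>m g \<cdot>\<^bsub>D\<^esub> F\<^sub>m f)"

definition natural_iso ::
  "('o, 'm::ab_group_add, 'k::field) tri_cat \<Rightarrow> ('o \<Rightarrow> 'o) \<Rightarrow> ('m \<Rightarrow> 'm) \<Rightarrow>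
     ('o \<Rightarrow> 'o) \<Rightarrow> ('m \<Rightarrow> 'm) \<Rightarrow> ('o \<Rightarrow> 'm) \<Rightarrow> bool" where
  "natural_iso D F\<^sub>o F\<^sub>m G\<^sub>o G\<^sub>m \<alpha> \<longleftrightarrow>
     (\<forall>X \<in> Ob D. iso_mor D (F\<^sub>o X) (G\<^sub>o X) (\<alpha> X)) \<and>
     (\<forall>X \<in> Ob D. \<forall>Y \<in> Ob D. \<forall>f \<in> Hom D X Y. \<alpha> Y \<cdot>\<^bsub>D\<^esub> F\<^sub>m f = G\<^sub>m f \<cdot>\<^bsub>D\<^esub> \<alpha> X)"

definition autoequivalence ::
  "('o, 'm::ab_group_add, 'k::field) tri_cat \<Rightarrow> ('o \<Rightarrow> 'o) \<Rightarrow> ('m \<Rightarrow> 'm) \<Rightarrow> bool" where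
  "autoequivalence D F\<^sub>o F\<^sub>m \<longleftrightarrow> linear_functor D F\<^sub>o F\<^sub>m \<and>
     (\<exists>G\<^sub>o G\<^sub>m \<alpha> \<beta>. linear_functor D G\<^sub>o G\<^sub>m \<and>
        natural_iso D (G\<^sub>o \<circ> F\<^sub>o) (G\<^sub>m \<circ> F\<^sub>m) id id \<alpha> \<and>
        natural_iso D (F\<^sub>o \<circ> G\<^sub>o) (F\<^sub>m \<circ> G\<^sub>m) id id \<beta>)"

definition finite_dim_Homs :: "('o, 'm::ab_group_add, 'k::field) tri_cat \<Rightarrow> bool" where
  "finite_dim_Homs D \<longleftrightarrow> (\<forall>X \<in> Ob D. \<forall>Y \<in> Ob D.
     \<exists>B. finite B \<and> B \<subseteq> Hom D X Y \<and> module.span (scl D) B = Hom D X Y)"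

definition dual :: "('o, 'm::ab_group_add, 'k::field) tri_cat \<Rightarrow> 'm set \<Rightarrow> ('m \<Rightarrow> 'k) set" where
  "dual D V = {\<phi> \<in> extensional V.
     (\<forall>f \<in> V. \<forall>g \<in> V. \<phi> (f + g) = \<phi> f + \<phi> g) \<and> (\<forall>c. \<forall>f \<in> V. \<phi> (scl D c f) = c * \<phi> f)}"

text \<open>
  In the following definition \<open>\<eta> X Y\<close> is the isomorphism $Hom(X,Y) \cong Hom(Y,SX)^*$. The last
  clause is naturality in both variables.
\<close>

definition serre_functor ::
  "('o, 'm::ab_group_add, 'k::field) tri_cat \<Rightarrow> ('o \<Rightarrow> 'o) \<Rightarrow> ('m \<Rightarrow> 'm) \<Rightarrow> bool" where
  "serre_functor D S\<^sub>o S\<^sub>m \<longleftrightarrow> autoequivalence D S\<^sub>o S\<^sub>m \<and>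
     (\<exists>\<eta>. (\<forall>X \<in> Ob D. \<forall>Y \<in> Ob D.
            bij_betw (\<eta> X Y) (Hom D X Y) (dual D (Hom D Y (S\<^sub>o X))) \<and>
            (\<forall>f \<in> Hom D X Y. \<forall>\<phi> \<in> Hom D Y (S\<^sub>o X).
               (\<forall>f' \<in> Hom D X Y. \<eta> X Y (f + f') \<phi> = \<eta> X Y f \<phi> + \<eta> X Y f' \<phi>) \<and>
               (\<forall>c. \<eta> X Y (scl D c f) \<phi> = c * \<eta> X Y f \<phi>))) \<and>
          (\<forall>X \<in> Ob D. \<forall>X' \<in> Ob D. \<forall>Y \<in> Ob D. \<forall>Y' \<in> Ob D.
             \<forall>h \<in> Hom D X' X. \<forall>f \<in> Hom D X Y. \<forall>g \<in> Hom D Y Y'. \<forall>\<phi> \<in> Hom D Y' (S\<^sub>o X').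
               \<eta> X' Y' (g \<cdot>\<^bsub>D\<^esub> f \<cdot>\<^bsub>D\<^esub> h) \<phi> = \<eta> X Y f (S\<^sub>m h \<cdot>\<^bsub>D\<^esub> \<phi> \<cdot>\<^bsub>D\<^esub> g)))"

definition has_serre_functor :: "('o, 'm::ab_group_add, 'k::field) tri_cat \<Rightarrow> bool" where
  "has_serre_functor D \<longleftrightarrow> finite_dim_Homs D \<and> (\<exists>S\<^sub>o S\<^sub>m. serre_functor D S\<^sub>o S\<^sub>m)"

text \<open>
  Full subcategories are given by their sets of objects and are understood to be strict, i.e.
  closed under isomorphism.
\<close>

definition triangulated_subcategory ::
  "('o, 'm::ab_group_add, 'k::field) tri_cat \<Rightarrow> 'o set \<Rightarrow> bool" where
  "triangulated_subcategory D B \<longleftrightarrow> B \<subseteq> Ob D \<and> B \<noteq> {} \<and>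
     (\<forall>X Y. X \<in> B \<and> isomorphic D X Y \<longrightarrow> Y \<in> B) \<and>
     (\<forall>X l. X \<in> B \<longrightarrow> sh D l X \<in> B) \<and>
     (\<forall>X Y Z f g h. dist D X Y Z f g h \<and> X \<in> B \<and> Z \<in> B \<longrightarrow> Y \<in> B)"

definition thick_subcategory ::
  "('o, 'm::ab_group_add, 'k::field) tri_cat \<Rightarrow> 'o set \<Rightarrow> bool" where
  "thick_subcategory D B \<longleftrightarrow> triangulated_subcategory D B \<and>
     (\<forall>X Y. X \<in> B \<and> direct_summand D Y X \<longrightarrow> Y \<in> B)"

definition gen :: "('o, 'm::ab_group_add, 'k::field) tri_cat \<Rightarrow> 'o set \<Rightarrow> 'o set" where
  "gen D S = thick_subcategory D hull S"

definition right_perp :: "('o, 'm::ab_group_add, 'k::field) tri_cat \<Rightarrow> 'o set \<Rightarrow> 'o set" where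
  "right_perp D B = {X \<in> Ob D. \<forall>b \<in> B. Hom D b X = {0}}"

definition left_perp :: "('o, 'm::ab_group_add, 'k::field) tri_cat \<Rightarrow> 'o set \<Rightarrow> 'o set" where
  "left_perp D B = {X \<in> Ob D. \<forall>b \<in> B. Hom D X b = {0}}"

definition right_admissible ::
  "('o, 'm::ab_group_add, 'k::field) tri_cat \<Rightarrow> 'o set \<Rightarrow> bool" where
  "right_admissible D B \<longleftrightarrow> triangulated_subcategory D B \<and>
     (\<exists>R\<^sub>o R\<^sub>m \<phi>. linear_functor D R\<^sub>o R\<^sub>m \<and> (\<forall>X \<in> Ob D. R\<^sub>o X \<in> B) \<and>
        (\<forall>b \<in> B. \<forall>X \<in> Ob D. bij_betw (\<phi> b X) (Hom D b X) (Hom D b (R\<^sub>o X))) \<and>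
        (\<forall>b \<in> B. \<forall>b' \<in> B. \<forall>X \<in> Ob D. \<forall>X' \<in> Ob D.
           \<forall>h \<in> Hom D b' b. \<forall>f \<in> Hom D b X. \<forall>g \<in> Hom D X X'.
             \<phi> b' X' (g \<cdot>\<^bsub>D\<^esub> f \<cdot>\<^bsub>D\<^esub> h) = R\<^sub>m g \<cdot>\<^bsub>D\<^esub> \<phi> b X f \<cdot>\<^bsub>D\<^esub> h))"

definition left_admissible ::
  "('o, 'm::ab_group_add, 'k::field) tri_cat \<Rightarrow> 'o set \<Rightarrow> bool" where
  "left_admissible D B \<longleftrightarrow> triangulated_subcategory D B \<and>
     (\<exists>L\<^sub>o L\<^sub>m \<phi>. linear_functor D L\<^sub>o L\<^sub>m \<and> (\<forall>X \<in> Ob D. L\<^sub>o X \<in> B) \<and>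
        (\<forall>X \<in> Ob D. \<forall>b \<in> B. bij_betw (\<phi> X b) (Hom D (L\<^sub>o X) b) (Hom D X b)) \<and>
        (\<forall>X \<in> Ob D. \<forall>X' \<in> Ob D. \<forall>b \<in> B. \<forall>b' \<in> B.
           \<forall>h \<in> Hom D X' X. \<forall>f \<in> Hom D (L\<^sub>o X) b. \<forall>g \<in> Hom D b b'.
             \<phi> X' b' (g \<cdot>\<^bsub>D\<^esub> f \<cdot>\<^bsub>D\<^esub> L\<^sub>m h) = g \<cdot>\<^bsub>D\<^esub> \<phi> X b f \<cdot>\<^bsub>D\<^esub> h))"

definition admissible :: "('o, 'm::ab_group_add, 'k::field) tri_cat \<Rightarrow> 'o set \<Rightarrow> bool" where
  "admissible D B \<longleftrightarrow> right_admissible D B \<and> left_admissible D B"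

text \<open>
  Sequences indexed by $\Phi_n$ are lists of length $n$, so positions run from $0$ to $n-1$; the
  empty sequence (possible only when all objects are zero) is allowed.

  The components of a semi-orthogonal decomposition are taken to be closed under direct summands.
  This makes each component \<open>\<Pi>\<close> equal to the subcategory it generates, without which the relation
  \<open>finer\<close> would not be reflexive.
\<close>

definition SOD :: "('o, 'm::ab_group_add, 'k::field) tri_cat \<Rightarrow> 'o set list \<Rightarrow> bool" where
  "SOD D Ps \<longleftrightarrow>
     (\<forall>i < length Ps. thick_subcategory D (Ps ! i) \<and> (\<exists>X \<in> Ps ! i. \<not> zero_object D X)) \<and>
     (\<forall>j < length Ps. \<forall>i < j. \<forall>X \<in> Ps ! j. \<forall>Y \<in> Ps ! i. Hom D X Y = {0}) \<and>
     gen D (\<Union>(set Ps)) = Ob D"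

definition finer ::
  "('o, 'm::ab_group_add, 'k::field) tri_cat \<Rightarrow> 'o set list \<Rightarrow> 'o set list \<Rightarrow> bool" where
  "finer D Qs Ps \<longleftrightarrow> (\<exists>r. r ` {..<length Qs} = {..<length Ps} \<and> mono_on {..<length Qs} r \<and>
     (\<forall>j < length Ps. Ps ! j = gen D (\<Union>i \<in> {i. i < length Qs \<and> r i = j}. Qs ! i)))"

definition finest_SODs :: "('o, 'm::ab_group_add, 'k::field) tri_cat \<Rightarrow> 'o set list set" where
  "finest_SODs D = {Ps. SOD D Ps \<and> (\<forall>Qs. SOD D Qs \<and> finer D Qs Ps \<longrightarrow> Qs = Ps)}"

definition SOD_right_mutation ::
  "('o, 'm::ab_group_add, 'k::field) tri_cat \<Rightarrow> nat \<Rightarrow> 'o set list \<Rightarrow> 'o set list" where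
  "SOD_right_mutation D i Ps =
     Ps[i := right_perp D (Ps ! i) \<inter> gen D (Ps ! i \<union> Ps ! Suc i), Suc i := Ps ! i]"

definition SOD_left_mutation ::
  "('o, 'm::ab_group_add, 'k::field) tri_cat \<Rightarrow> nat \<Rightarrow> 'o set list \<Rightarrow> 'o set list" where
  "SOD_left_mutation D i Ps =
     Ps[i := Ps ! Suc i, Suc i := left_perp D (Ps ! Suc i) \<inter> gen D (Ps ! i \<union> Ps ! Suc i)]"

definition exceptional :: "('o, 'm::ab_group_add, 'k::field) tri_cat \<Rightarrow> 'o \<Rightarrow> bool" where
  "exceptional D E \<longleftrightarrow> E \<in> Ob D \<and> bij_betw (\<lambda>c. scl D c (Id D E)) UNIV (Hom D E E) \<and>
     (\<forall>l. l \<noteq> 0 \<longrightarrow> Hom D E (sh D l E) = {0})"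

definition exceptional_seq :: "('o, 'm::ab_group_add, 'k::field) tri_cat \<Rightarrow> 'o list \<Rightarrow> bool" where
  "exceptional_seq D Es \<longleftrightarrow> (\<forall>i < length Es. exceptional D (Es ! i)) \<and>
     (\<forall>j < length Es. \<forall>i < j. \<forall>l. Hom D (Es ! j) (sh D l (Es ! i)) = {0})"

definition full_exceptional_seqs ::
  "('o, 'm::ab_group_add, 'k::field) tri_cat \<Rightarrow> 'o list set" where
  "full_exceptional_seqs D = {Es. exceptional_seq D Es \<and> gen D (set Es) = Ob D}"

definition exceptional_equiv ::
  "('o, 'm::ab_group_add, 'k::field) tri_cat \<Rightarrow> ('o list \<times> 'o list) set" where
  "exceptional_equiv D = {(Es, Fs). Es \<in> full_exceptional_seqs D \<and> Fs \<in> full_exceptional_seqs D \<and>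
     length Es = length Fs \<and> (\<forall>i < length Es. gen D {Es ! i} = gen D {Fs ! i})}"

definition is_basis ::
  "('o, 'm::ab_group_add, 'k::field) tri_cat \<Rightarrow> 'm set \<Rightarrow> 'm set \<Rightarrow> bool" where
  "is_basis D V B \<longleftrightarrow> B \<subseteq> V \<and> \<not> module.dependent (scl D) B \<and> module.span (scl D) B = V"

text \<open>
  For a finite-dimensional vector space $V$ with basis $B$, the object $V \otimes X$ is the direct
  sum of copies of $X$ indexed by $B$, and so is $V^* \otimes X$ (using the dual basis). With bases
  \<open>B l\<close> of $Hom(E,F[l])$, the direct sums over $l$ below are therefore direct sums over the pairs
  $(l,b)$. The component at $(l,b)$ of the evaluation map is $b[-l] : E[-l] \to F$, that of the
  coevaluation map is $b : E \to F[l]$. Mutations are determined only up to isomorphism, hence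
  the relational form.
\<close>

definition left_mutation_object ::
  "('o, 'm::ab_group_add, 'k::field) tri_cat \<Rightarrow> 'o \<Rightarrow> 'o \<Rightarrow> 'o \<Rightarrow> bool" where
  "left_mutation_object D E F L \<longleftrightarrow>
     (\<exists>(B :: int \<Rightarrow> 'm set) P \<iota> \<pi> u w.
        (\<forall>l. is_basis D (Hom D E (sh D l F)) (B l)) \<and>
        direct_sum D (SIGMA l:UNIV. B l) (\<lambda>(l, b). sh D (- l) E) P \<iota> \<pi> \<and>
        dist D L P F u (\<Sum>(l, b) \<in> (SIGMA l:UNIV. B l). shm D (- l) b \<cdot>\<^bsub>D\<^esub> \<pi> (l, b)) w)"

definition right_mutation_object ::
  "('o, 'm::ab_group_add, 'k::field) tri_cat \<Rightarrow> 'o \<Rightarrow> 'o \<Rightarrow> 'o \<Rightarrow> bool" where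
  "right_mutation_object D E F R \<longleftrightarrow>
     (\<exists>(B :: int \<Rightarrow> 'm set) P \<iota> \<pi> v w.
        (\<forall>l. is_basis D (Hom D E (sh D l F)) (B l)) \<and>
        direct_sum D (SIGMA l:UNIV. B l) (\<lambda>(l, b). sh D l F) P \<iota> \<pi> \<and>
        dist D E P R (\<Sum>(l, b) \<in> (SIGMA l:UNIV. B l). \<iota> (l, b) \<cdot>\<^bsub>D\<^esub> b) v w)"

definition left_mutation ::
  "('o, 'm::ab_group_add, 'k::field) tri_cat \<Rightarrow> nat \<Rightarrow> 'o list \<Rightarrow> 'o list \<Rightarrow> bool" where
  "left_mutation D i Es Fs \<longleftrightarrow>
     (\<exists>L. left_mutation_object D (Es ! i) (Es ! Suc i) L \<and> Fs = Es[i := L, Suc i := Es ! i])"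

definition right_mutation ::
  "('o, 'm::ab_group_add, 'k::field) tri_cat \<Rightarrow> nat \<Rightarrow> 'o list \<Rightarrow> 'o list \<Rightarrow> bool" where
  "right_mutation D i Es Fs \<longleftrightarrow>
     (\<exists>R. right_mutation_object D (Es ! i) (Es ! Suc i) R \<and> Fs = Es[i := Es ! Suc i, Suc i := R])"

end

theory Submission
  imports Defs
begin

text \<open>
  Write $\mathrm{Hom}(X,Y[\ast])$ for the total Hom-space. For a full exceptional sequence
  $(E_1,\dots,E_n)$ the objects $X$ with $\mathrm{Hom}(E_k,X[\ast])$ finite-dimensional form a thick
  subcategory; by descending induction on $k$ it contains every $E_i$, the case $i>k$ coming from
  Serre duality. Hence all total Hom-spaces are finite-dimensional, and evaluation and coevaluation
  maps exist. This gives the mutations of exceptional pairs, and shows that a nonzero thick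
  subcategory of $\langle E\rangle$ contains $E$, so that full exceptional sequences give finest
  decompositions.

  Conversely the components of a decomposition must be shown to be admissible. The objects $X$ having
  a universal map $b\to X$ from a thick subcategory $B$ form a thick subcategory, provided that
  idempotents split. They do: an idempotent $e$ fixing some $u\colon E_k[l]\to X$ is replaced by an
  idempotent of the cone of $u$ until all Hom-spaces from exceptional objects vanish. A right adjoint $R$
  of the inclusion of $B$ yields a left adjoint because $\mathrm{Hom}(X,R-)$ is representable, the
  representing object being built up along the exceptional sequence. By the hypothesis every component
  then has an exceptional sequence, and concatenating these refines the decomposition.
\<close>

section \<open>Linear categories and their opposites\<close>

text \<open>Two obstacles shape the proof. Admissibility of the components is not part of the
  definition of a decomposition, which speaks of generation, so universal maps have to be spread
  from the components to all of D by thickness. And D is not assumed idempotent complete, while the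
  universal map to a retract is cut out by an idempotent of the approximating object; the splitting
  is extracted from a full exceptional sequence, which exists because D is an admissible subcategory
  of itself. Serre duality does not turn a right adjoint R of an inclusion directly into a left one:
  composed with R, the Serre functor represents duals of Hom inside B, but is not at once an
  equivalence of B. Representing Hom(X,R-) avoids this. Most statements are proved for one side and
  transferred by reversing arrows, which exchanges evaluation with coevaluation, universal maps from
  B with universal maps to B, and an exceptional sequence with its reversal.\<close>

definition arr :: "('o, 'm::ab_group_add, 'k::field) tri_cat \<Rightarrow> 'o \<Rightarrow> 'o \<Rightarrow> 'm \<Rightarrow> bool" where
  "arr D X Y f \<longleftrightarrow> X \<in> Ob D \<and> Y \<in> Ob D \<and> f \<in> Hom D X Y"

context klinear_category
begin

sublocale vs: vector_space "scl D"
  by (rule vector_space_scl)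

lemma arrI: "\<lbrakk>X \<in> Ob D; Y \<in> Ob D; f \<in> Hom D X Y\<rbrakk> \<Longrightarrow> arr D X Y f"
  by (simp add: arr_def)

lemma arr_Ob: "arr D X Y f \<Longrightarrow> X \<in> Ob D" "arr D X Y f \<Longrightarrow> Y \<in> Ob D"
  by (simp_all add: arr_def)

lemma arr_0 [intro]: "\<lbrakk>X \<in> Ob D; Y \<in> Ob D\<rbrakk> \<Longrightarrow> arr D X Y 0"
  by (simp add: arr_def subspace_Hom vs.subspace_0)

lemma arr_Id [intro]: "X \<in> Ob D \<Longrightarrow> arr D X X (Id D X)"
  by (simp add: arr_def Id_in_Hom)

lemma arr_cmp [intro]: "\<lbrakk>arr D X Y f; arr D Y Z g\<rbrakk> \<Longrightarrow> arr D X Z (g \<cdot> f)"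
  using cmp_in_Hom by (auto simp: arr_def)

lemma arr_add [intro]: "\<lbrakk>arr D X Y f; arr D X Y g\<rbrakk> \<Longrightarrow> arr D X Y (f + g)"
  by (simp add: arr_def subspace_Hom vs.subspace_add)

lemma arr_diff [intro]: "\<lbrakk>arr D X Y f; arr D X Y g\<rbrakk> \<Longrightarrow> arr D X Y (f - g)"
  by (simp add: arr_def subspace_Hom vs.subspace_diff)

lemma arr_minus [intro]: "arr D X Y f \<Longrightarrow> arr D X Y (- f)"
  by (simp add: arr_def subspace_Hom vs.subspace_neg)

lemma arr_scl [intro]: "arr D X Y f \<Longrightarrow> arr D X Y (scl D c f)"
  by (simp add: arr_def subspace_Hom vs.subspace_scale)

lemma arr_sum:
  "\<lbrakk>X \<in> Ob D; Y \<in> Ob D; \<And>i. i \<in> I \<Longrightarrow> arr D X Y (f i)\<rbrakk> \<Longrightarrow> arr D X Y (\<Sum>i\<in>I. f i)"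
  by (simp add: arr_def subspace_Hom vs.subspace_sum)

lemma comp_assoc:
  "\<lbrakk>arr D W X f; arr D X Y g; arr D Y Z h\<rbrakk> \<Longrightarrow> (h \<cdot> g) \<cdot> f = h \<cdot> (g \<cdot> f)"
  by (metis arr_def cmp_assoc)

lemma comp_Id_left: "arr D X Y f \<Longrightarrow> Id D Y \<cdot> f = f"
  by (metis arr_def cmp_Id_left)

lemma comp_Id_right: "arr D X Y f \<Longrightarrow> f \<cdot> Id D X = f"
  by (metis arr_def cmp_Id_right)

lemma comp_add_left:
  "\<lbrakk>arr D X Y f; arr D Y Z g; arr D Y Z g'\<rbrakk> \<Longrightarrow> (g + g') \<cdot> f = g \<cdot> f + g' \<cdot> f"
  by (metis arr_def cmp_add_left)

lemma comp_add_right: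
  "\<lbrakk>arr D X Y f; arr D X Y f'; arr D Y Z g\<rbrakk> \<Longrightarrow> g \<cdot> (f + f') = g \<cdot> f + g \<cdot> f'"
  by (metis arr_def cmp_add_right)

lemma comp_scl_left: "\<lbrakk>arr D X Y f; arr D Y Z g\<rbrakk> \<Longrightarrow> scl D c g \<cdot> f = scl D c (g \<cdot> f)"
  by (metis arr_def cmp_scl_left)

lemma comp_scl_right: "\<lbrakk>arr D X Y f; arr D Y Z g\<rbrakk> \<Longrightarrow> g \<cdot> scl D c f = scl D c (g \<cdot> f)"
  by (metis arr_def cmp_scl_right)

lemma comp_0_left: "\<lbrakk>arr D X Y f; Z \<in> Ob D\<rbrakk> \<Longrightarrow> 0 \<cdot> f = 0"
  using comp_add_left[of X Y f Z 0 0] arr_0[of Y Z] by (simp add: arr_def)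

lemma comp_0_right: "\<lbrakk>arr D Y Z g; X \<in> Ob D\<rbrakk> \<Longrightarrow> g \<cdot> 0 = 0"
  using comp_add_right[of X Y 0 0 Z g] arr_0[of X Y] by (simp add: arr_def)

lemma comp_minus_left: "\<lbrakk>arr D X Y f; arr D Y Z g\<rbrakk> \<Longrightarrow> (- g) \<cdot> f = - (g \<cdot> f)"
  using comp_scl_left[of X Y f Z g "-1"] by simp

lemma comp_minus_right: "\<lbrakk>arr D X Y f; arr D Y Z g\<rbrakk> \<Longrightarrow> g \<cdot> (- f) = - (g \<cdot> f)"
  using comp_scl_right[of X Y f Z g "-1"] by simp

lemma comp_diff_left:
  "\<lbrakk>arr D X Y f; arr D Y Z g; arr D Y Z g'\<rbrakk> \<Longrightarrow> (g - g') \<cdot> f = g \<cdot> f - g' \<cdot> f"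
  using comp_add_left[of X Y f Z g "- g'"] by (auto simp: comp_minus_left)

lemma comp_diff_right:
  "\<lbrakk>arr D X Y f; arr D X Y f'; arr D Y Z g\<rbrakk> \<Longrightarrow> g \<cdot> (f - f') = g \<cdot> f - g \<cdot> f'"
  using comp_add_right[of X Y f "- f'" Z g] by (auto simp: comp_minus_right)

lemma comp_sum_left:
  assumes "arr D X Y f" "Z \<in> Ob D" "\<And>i. i \<in> I \<Longrightarrow> arr D Y Z (g i)"
  shows "(\<Sum>i\<in>I. g i) \<cdot> f = (\<Sum>i\<in>I. g i \<cdot> f)"
  using assms(3)
proof (induction I rule: infinite_finite_induct)
  case (insert i I)
  have "arr D Y Z (sum g I)" using insert.prems assms by (intro arr_sum) (auto simp: arr_def)
  moreover have "arr D Y Z (g i)" using insert.prems by simp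
  ultimately have "(g i + sum g I) \<cdot> f = g i \<cdot> f + sum g I \<cdot> f"
    by (intro comp_add_left[OF assms(1)])
  then show ?case using insert by simp
qed (use assms comp_0_left in auto)

lemma comp_sum_right:
  assumes "arr D Y Z g" "X \<in> Ob D" "\<And>i. i \<in> I \<Longrightarrow> arr D X Y (f i)"
  shows "g \<cdot> (\<Sum>i\<in>I. f i) = (\<Sum>i\<in>I. g \<cdot> f i)"
  using assms(3)
proof (induction I rule: infinite_finite_induct)
  case (insert i I)
  have "arr D X Y (sum f I)" using insert.prems assms by (intro arr_sum) (auto simp: arr_def)
  moreover have "arr D X Y (f i)" using insert.prems by simp
  ultimately have "g \<cdot> (f i + sum f I) = g \<cdot> f i + g \<cdot> sum f I"
    by (intro comp_add_right[OF _ _ assms(1)])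
  then show ?case using insert by simp
qed (use assms comp_0_right in auto)

lemma Hom_zero_iff:
  "\<lbrakk>X \<in> Ob D; Y \<in> Ob D\<rbrakk> \<Longrightarrow> Hom D X Y = {0} \<longleftrightarrow> (\<forall>f. arr D X Y f \<longrightarrow> f = 0)"
  using arr_0[of X Y] by (auto simp: arr_def)

lemma Hom_zeroD: "\<lbrakk>Hom D X Y = {0}; arr D X Y f\<rbrakk> \<Longrightarrow> f = 0"
  by (simp add: arr_def)

lemma zero_object_iff: "zero_object D Z \<longleftrightarrow> Z \<in> Ob D \<and> Id D Z = 0"
proof
  assume *: "Z \<in> Ob D \<and> Id D Z = 0"
  have "f = 0" if "arr D X Z f" for X f
    using comp_Id_left[OF that] comp_0_left[OF that, of Z] * by simp
  moreover have "f = 0" if "arr D Z X f" for X f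
    using comp_Id_right[OF that] comp_0_right[OF that, of Z] * by simp
  ultimately show "zero_object D Z"
    using * by (auto simp: zero_object_def Hom_zero_iff)
qed (use Id_in_Hom in \<open>auto simp: zero_object_def\<close>)

lemma zero_objectI: "\<lbrakk>X \<in> Ob D; Hom D X X = {0}\<rbrakk> \<Longrightarrow> zero_object D X"
  using Id_in_Hom zero_object_iff by blast

lemma zero_object_arr:
  assumes "zero_object D Z" shows "arr D X Z f \<Longrightarrow> f = 0" "arr D Z X f \<Longrightarrow> f = 0"
  using assms by (auto simp: zero_object_def arr_def)

lemma iso_mor_iff: "\<lbrakk>X \<in> Ob D; Y \<in> Ob D\<rbrakk> \<Longrightarrow>
    iso_mor D X Y f \<longleftrightarrow> arr D X Y f \<and> (\<exists>g. arr D Y X g \<and> g \<cdot> f = Id D X \<and> f \<cdot> g = Id D Y)"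
  by (auto simp: iso_mor_def arr_def)

lemma iso_mor_Id: "X \<in> Ob D \<Longrightarrow> iso_mor D X X (Id D X)"
  using arr_Id[of X] comp_Id_left[of X X "Id D X"] by (auto simp: iso_mor_iff)

lemma isomorphic_sym: "isomorphic D X Y \<Longrightarrow> isomorphic D Y X"
  unfolding isomorphic_def using iso_mor_iff by metis

end

text \<open>With the sign below, the rotation axiom carries over to the opposite category unchanged.\<close>

definition opc :: "('o, 'm::ab_group_add, 'k::field) tri_cat \<Rightarrow> ('o, 'm, 'k) tri_cat" where
  "opc D = \<lparr>Ob = Ob D, Hom = (\<lambda>X Y. Hom D Y X), Id = Id D, cmp = (\<lambda>g f. f \<cdot>\<^bsub>D\<^esub> g), scl = scl D,
     sh = (\<lambda>l. sh D (- l)), shm = (\<lambda>l. shm D (- l)),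
     dist = (\<lambda>X Y Z f g h. h \<in> Hom D (sh D (- 1) X) Z \<and> dist D Z Y X g f (- shm D 1 h))\<rparr>"

lemma opc_simps [simp]:
  "Ob (opc D) = Ob D" "Hom (opc D) X Y = Hom D Y X" "Id (opc D) = Id D"
  "g \<cdot>\<^bsub>opc D\<^esub> f = f \<cdot>\<^bsub>D\<^esub> g" "scl (opc D) = scl D" "sh (opc D) l = sh D (- l)"
  "shm (opc D) l = shm D (- l)"
  "dist (opc D) X Y Z f g h \<longleftrightarrow> h \<in> Hom D (sh D (- 1) X) Z \<and> dist D Z Y X g f (- shm D 1 h)"
  by (simp_all add: opc_def)

lemma arr_opc [simp]: "arr (opc D) X Y f \<longleftrightarrow> arr D Y X f"
  by (auto simp: arr_def)

lemma zero_object_opc [simp]: "zero_object (opc D) X \<longleftrightarrow> zero_object D X"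
  by (auto simp: zero_object_def)

lemma iso_mor_opc [simp]: "iso_mor (opc D) X Y f \<longleftrightarrow> iso_mor D Y X f"
  by (auto simp: iso_mor_def)

lemma direct_sum_opc [simp]: "direct_sum (opc D) I X P \<iota> \<pi> \<longleftrightarrow> direct_sum D I X P \<pi> \<iota>"
proof -
  have "(\<forall>i\<in>I. \<forall>j\<in>I. \<iota> j \<cdot>\<^bsub>D\<^esub> \<pi> i = (if i = j then Id D (X i) else 0)) \<longleftrightarrow>
      (\<forall>i\<in>I. \<forall>j\<in>I. \<iota> i \<cdot>\<^bsub>D\<^esub> \<pi> j = (if i = j then Id D (X i) else 0))"
    by metis
  then show ?thesis by (simp add: direct_sum_def) blast
qed

lemma direct_summand_opc [simp]: "direct_summand (opc D) Y X \<longleftrightarrow> direct_summand D Y X"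
  by (auto simp: direct_summand_def)

lemma (in klinear_category) isomorphic_opc [simp]: "isomorphic (opc D) X Y \<longleftrightarrow> isomorphic D X Y"
  using isomorphic_sym by (auto simp: isomorphic_def)

lemma (in klinear_category) klinear_category_opc: "klinear_category (opc D)"
proof
  fix X Y X' Y' f assume "X \<in> Ob (opc D)" "Y \<in> Ob (opc D)" "X' \<in> Ob (opc D)" "Y' \<in> Ob (opc D)"
    "f \<in> Hom (opc D) X Y" "f \<in> Hom (opc D) X' Y'" "f \<noteq> 0"
  then show "X = X' \<and> Y = Y'" using Hom_disjoint[of Y X Y' X' f] by simp
qed (simp_all add: subspace_Hom Id_in_Hom cmp_in_Hom cmp_Id_left cmp_Id_right cmp_assoc
    cmp_add_left cmp_add_right cmp_scl_left cmp_scl_right vs.scale_right_distrib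
    vs.scale_left_distrib)

section \<open>Triangles\<close>

text \<open>The octahedral axiom is never needed; leaving it out makes the axioms visibly self-dual.\<close>

locale pretriangulated_category = klinear_category +
  assumes direct_sums:
      "(\<And>i. i < n \<Longrightarrow> A i \<in> Ob D) \<Longrightarrow> \<exists>P \<iota> \<pi>. direct_sum D {..<n::nat} A P \<iota> \<pi>"
    and sh_in_Ob: "X \<in> Ob D \<Longrightarrow> sh D l X \<in> Ob D"
    and shm_in_Hom:
      "\<lbrakk>X \<in> Ob D; Y \<in> Ob D; f \<in> Hom D X Y\<rbrakk> \<Longrightarrow> shm D l f \<in> Hom D (sh D l X) (sh D l Y)"
    and shm_Id: "X \<in> Ob D \<Longrightarrow> shm D l (Id D X) = Id D (sh D l X)"
    and shm_cmp:
      "\<lbrakk>X \<in> Ob D; Y \<in> Ob D; Z \<in> Ob D; f \<in> Hom D X Y; g \<in> Hom D Y Z\<rbrakk>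
        \<Longrightarrow> shm D l (g \<cdot> f) = shm D l g \<cdot> shm D l f"
    and shm_add:
      "\<lbrakk>X \<in> Ob D; Y \<in> Ob D; f \<in> Hom D X Y; g \<in> Hom D X Y\<rbrakk>
        \<Longrightarrow> shm D l (f + g) = shm D l f + shm D l g"
    and shm_scl:
      "\<lbrakk>X \<in> Ob D; Y \<in> Ob D; f \<in> Hom D X Y\<rbrakk> \<Longrightarrow> shm D l (scl D r f) = scl D r (shm D l f)"
    and sh_0: "X \<in> Ob D \<Longrightarrow> sh D 0 X = X"
    and shm_0: "\<lbrakk>X \<in> Ob D; Y \<in> Ob D; f \<in> Hom D X Y\<rbrakk> \<Longrightarrow> shm D 0 f = f"
    and sh_sh: "X \<in> Ob D \<Longrightarrow> sh D l (sh D m X) = sh D (l + m) X"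
    and shm_shm:
      "\<lbrakk>X \<in> Ob D; Y \<in> Ob D; f \<in> Hom D X Y\<rbrakk> \<Longrightarrow> shm D l (shm D m f) = shm D (l + m) f"
    and dist_typed:
      "dist D X Y Z f g h \<Longrightarrow> X \<in> Ob D \<and> Y \<in> Ob D \<and> Z \<in> Ob D \<and>
         f \<in> Hom D X Y \<and> g \<in> Hom D Y Z \<and> h \<in> Hom D Z (sh D 1 X)"
    and TR1_Id: "\<lbrakk>X \<in> Ob D; zero_object D Z\<rbrakk> \<Longrightarrow> dist D X X Z (Id D X) 0 0"
    and TR1_cone: "\<lbrakk>X \<in> Ob D; Y \<in> Ob D; f \<in> Hom D X Y\<rbrakk> \<Longrightarrow> \<exists>Z g h. dist D X Y Z f g h"
    and TR2:
      "\<lbrakk>X \<in> Ob D; Y \<in> Ob D; Z \<in> Ob D; f \<in> Hom D X Y; g \<in> Hom D Y Z; h \<in> Hom D Z (sh D 1 X)\<rbrakk>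
        \<Longrightarrow> dist D X Y Z f g h \<longleftrightarrow> dist D Y Z (sh D 1 X) g h (- shm D 1 f)"
    and TR3:
      "\<lbrakk>dist D X Y Z f g h; dist D X' Y' Z' f' g' h';
        a \<in> Hom D X X'; b \<in> Hom D Y Y'; b \<cdot> f = f' \<cdot> a\<rbrakk>
        \<Longrightarrow> \<exists>c \<in> Hom D Z Z'. c \<cdot> g = g' \<cdot> b \<and> shm D 1 a \<cdot> h = h' \<cdot> c"

lemma (in klinear_triangulated_category) pretriangulated: "pretriangulated_category D"
  by unfold_locales
    (fact direct_sums sh_in_Ob shm_in_Hom shm_Id shm_cmp shm_add shm_scl sh_0 shm_0 sh_sh shm_shm
      dist_typed TR1_Id TR1_cone TR2 TR3)+

context pretriangulated_category
begin

lemma dist_arr: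
  assumes "dist D X Y Z f g h"
  shows "arr D X Y f" "arr D Y Z g" "arr D Z (sh D 1 X) h" "X \<in> Ob D" "Y \<in> Ob D" "Z \<in> Ob D"
  using dist_typed[OF assms] sh_in_Ob by (auto simp: arr_def)

lemma arr_shm [intro]: "arr D X Y f \<Longrightarrow> arr D (sh D l X) (sh D l Y) (shm D l f)"
  using shm_in_Hom sh_in_Ob by (simp add: arr_def)

lemma shm_comp: "\<lbrakk>arr D X Y f; arr D Y Z g\<rbrakk> \<Longrightarrow> shm D l (g \<cdot> f) = shm D l g \<cdot> shm D l f"
  by (metis arr_def shm_cmp)

lemma obtain_zero_object: obtains Z where "zero_object D Z"
proof -
  obtain P \<iota> \<pi> where "direct_sum D {..<0::nat} (\<lambda>_. undefined) P \<iota> \<pi>"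
    using direct_sums[of 0 "\<lambda>_. undefined"] by auto
  then have "P \<in> Ob D" "Id D P = 0" by (auto simp: direct_sum_def)
  then show thesis using that zero_object_iff by blast
qed

lemma shm_zero [simp]: "shm D l 0 = 0"
proof -
  obtain Z where "Z \<in> Ob D" using obtain_zero_object zero_object_iff by blast
  then have "0 \<in> Hom D Z Z" using arr_0[of Z Z] by (simp add: arr_def)
  then show ?thesis using shm_add[of Z Z 0 0 l] \<open>Z \<in> Ob D\<close> by simp
qed

lemma shm_plus: "\<lbrakk>arr D X Y f; arr D X Y g\<rbrakk> \<Longrightarrow> shm D l (f + g) = shm D l f + shm D l g"
  by (metis arr_def shm_add)

lemma shm_scale: "arr D X Y f \<Longrightarrow> shm D l (scl D c f) = scl D c (shm D l f)"
  by (metis arr_def shm_scl)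

lemma shm_minus: "arr D X Y f \<Longrightarrow> shm D l (- f) = - shm D l f"
  using shm_scale[of X Y f l "-1"] by simp

lemma shm_sum:
  assumes "X \<in> Ob D" "Y \<in> Ob D" "\<And>i. i \<in> I \<Longrightarrow> arr D X Y (f i)"
  shows "shm D l (\<Sum>i\<in>I. f i) = (\<Sum>i\<in>I. shm D l (f i))"
  using assms(3)
proof (induction I rule: infinite_finite_induct)
  case (insert i I)
  have "arr D X Y (sum f I)" using insert.prems assms by (intro arr_sum) (auto simp: arr_def)
  moreover have "arr D X Y (f i)" using insert.prems by simp
  ultimately show ?case using insert shm_plus[of X Y "f i"] by simp
qed auto

lemma sh_inverse [simp]:
  "X \<in> Ob D \<Longrightarrow> sh D l (sh D (- l) X) = X" "X \<in> Ob D \<Longrightarrow> sh D (- l) (sh D l X) = X"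
  by (simp_all add: sh_sh sh_0)

lemma shm_shm': "arr D X Y f \<Longrightarrow> shm D l (shm D m f) = shm D (l + m) f"
  by (metis arr_def shm_shm)

lemma shm_0': "arr D X Y f \<Longrightarrow> shm D 0 f = f"
  by (metis arr_def shm_0)

lemma shm_inverse:
  "arr D X Y f \<Longrightarrow> shm D l (shm D (- l) f) = f" "arr D X Y f \<Longrightarrow> shm D (- l) (shm D l f) = f"
  by (simp_all add: shm_shm' shm_0')

lemma shm_eq_iff: "\<lbrakk>arr D X Y f; arr D X' Y' g\<rbrakk> \<Longrightarrow> shm D l f = shm D l g \<longleftrightarrow> f = g"
  by (metis shm_inverse(2))

lemma shm_eq_0_iff: "arr D X Y f \<Longrightarrow> shm D l f = 0 \<longleftrightarrow> f = 0"
  by (metis shm_inverse(2) shm_zero)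

lemma arr_unshift:
  "\<lbrakk>X \<in> Ob D; Y \<in> Ob D; arr D (sh D l X) (sh D l Y) g\<rbrakk> \<Longrightarrow> arr D X Y (shm D (- l) g)"
  using arr_shm[of "sh D l X" "sh D l Y" g "- l"] by simp

lemma arr_shift_right:
  "\<lbrakk>X \<in> Ob D; Y \<in> Ob D\<rbrakk> \<Longrightarrow> arr D X (sh D l Y) g \<Longrightarrow> arr D (sh D (- l) X) Y (shm D (- l) g)"
  using arr_shm[of X "sh D l Y" g "- l"] by simp

lemma Hom_shift_zero:
  assumes "X \<in> Ob D" "Y \<in> Ob D"
  shows "Hom D (sh D l X) (sh D m Y) = {0} \<longleftrightarrow> Hom D (sh D (l - m) X) Y = {0}"
proof
  assume *: "Hom D (sh D l X) (sh D m Y) = {0}"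
  show "Hom D (sh D (l - m) X) Y = {0}" unfolding Hom_zero_iff[OF sh_in_Ob[OF assms(1)] assms(2)]
  proof (intro allI impI)
    fix f assume f: "arr D (sh D (l - m) X) Y f"
    then have "arr D (sh D l X) (sh D m Y) (shm D m f)"
      using arr_shm[OF f, of m] assms by (simp add: sh_sh)
    then show "f = 0" using Hom_zeroD[OF *] f shm_eq_0_iff by blast
  qed
next
  assume *: "Hom D (sh D (l - m) X) Y = {0}"
  show "Hom D (sh D l X) (sh D m Y) = {0}"
    unfolding Hom_zero_iff[OF sh_in_Ob[OF assms(1)] sh_in_Ob[OF assms(2)]]
  proof (intro allI impI)
    fix f assume f: "arr D (sh D l X) (sh D m Y) f"
    then have "arr D (sh D (l - m) X) Y (shm D (- m) f)"
      using arr_shm[OF f, of "- m"] assms by (simp add: sh_sh sh_0)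
    then show "f = 0" using Hom_zeroD[OF *] f shm_eq_0_iff by blast
  qed
qed

lemma zero_object_sh: "zero_object D Z \<Longrightarrow> zero_object D (sh D l Z)"
  using shm_Id[of Z l] by (auto simp: zero_object_iff sh_in_Ob)

lemma rotate: "dist D X Y Z f g h \<Longrightarrow> dist D Y Z (sh D 1 X) g h (- shm D 1 f)"
  using TR2 dist_typed by blast

lemma rotate_back:
  assumes "dist D X Y Z f g h"
  shows "dist D (sh D (- 1) Z) X Y (- shm D (- 1) h) f g"
proof -
  note a = dist_arr[OF assms]
  have h': "arr D (sh D (- 1) Z) X (- shm D (- 1) h)"
    using arr_shm[OF a(3), of "- 1"] a by auto
  have "- shm D 1 (- shm D (- 1) h) = h"
    using shm_minus[OF h', of 1] shm_inverse(1)[OF a(3), of 1] arr_shm[OF a(3)] by auto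
  then show ?thesis
    using TR2[of "sh D (- 1) Z" X Y "- shm D (- 1) h" f g] h' a assms
    by (simp add: arr_def sh_in_Ob)
qed

lemma TR3_third:
  assumes "dist D X Y Z f g h" "dist D X' Y' Z' f' g' h'" "arr D X X' a" "arr D Y Y' b"
    and "b \<cdot> f = f' \<cdot> a"
  obtains c where "arr D Z Z' c" "c \<cdot> g = g' \<cdot> b" "shm D 1 a \<cdot> h = h' \<cdot> c"
  using TR3[OF assms(1,2) _ _ assms(5)] dist_typed[OF assms(1)] dist_typed[OF assms(2)] assms(3,4)
  by (auto simp: arr_def)

text \<open>TR3 for the rotated triangles returns the missing map only as a map between the shifts
  by 1; it is shifted back, and the signs introduced by the two rotations cancel.\<close>

lemma TR3_first:
  assumes T: "dist D X Y Z f g h" "dist D X' Y' Z' f' g' h'" and bc: "arr D Y Y' b" "arr D Z Z' c"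
    and eq: "c \<cdot> g = g' \<cdot> b"
  obtains a where "arr D X X' a" "b \<cdot> f = f' \<cdot> a" "shm D 1 a \<cdot> h = h' \<cdot> c"
proof -
  note A = dist_arr[OF T(1)] and A' = dist_arr[OF T(2)]
  obtain d where d: "arr D (sh D 1 X) (sh D 1 X') d" "d \<cdot> h = h' \<cdot> c"
      "shm D 1 b \<cdot> (- shm D 1 f) = (- shm D 1 f') \<cdot> d"
    using TR3_third[OF rotate[OF T(1)] rotate[OF T(2)] bc eq] by metis
  define a where "a = shm D (- 1) d"
  have a: "arr D X X' a" unfolding a_def using arr_unshift[OF _ _ d(1)] A A' by simp
  have d_eq: "d = shm D 1 a" unfolding a_def using shm_inverse(1)[OF d(1), of 1] by simp
  have "shm D 1 (b \<cdot> f) = shm D 1 (f' \<cdot> a)"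
    using d(3) comp_minus_right[OF arr_shm[OF A(1)] arr_shm[OF bc(1)], of 1]
      comp_minus_left[OF d(1) arr_shm[OF A'(1)]]
    by (simp add: shm_comp[OF A(1) bc(1)] shm_comp[OF a A'(1)] d_eq)
  then have "b \<cdot> f = f' \<cdot> a" using shm_eq_iff[OF arr_cmp[OF A(1) bc(1)] arr_cmp[OF a A'(1)]] by blast
  then show thesis using that a d(2) d_eq by blast
qed

lemma TR3_second:
  assumes T: "dist D X Y Z f g h" "dist D X' Y' Z' f' g' h'" and ac: "arr D X X' a" "arr D Z Z' c"
    and eq: "shm D 1 a \<cdot> h = h' \<cdot> c"
  obtains b where "arr D Y Y' b" "b \<cdot> f = f' \<cdot> a" "c \<cdot> g = g' \<cdot> b"
proof -
  note A = dist_arr[OF T(1)] and A' = dist_arr[OF T(2)]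
  have k: "arr D (sh D (- 1) Z) X (shm D (- 1) h)" "arr D (sh D (- 1) Z') X' (shm D (- 1) h')"
    using arr_shm[OF A(3), of "- 1"] arr_shm[OF A'(3), of "- 1"] A A' by auto
  have "shm D (- 1) (shm D 1 a \<cdot> h) = shm D (- 1) (h' \<cdot> c)" using eq by simp
  then have "a \<cdot> shm D (- 1) h = shm D (- 1) h' \<cdot> shm D (- 1) c"
    using shm_comp[OF A(3) arr_shm[OF ac(1)], of "- 1"] shm_comp[OF ac(2) A'(3), of "- 1"]
      shm_inverse(2)[OF ac(1), of 1] by simp
  then have "a \<cdot> (- shm D (- 1) h) = (- shm D (- 1) h') \<cdot> shm D (- 1) c"
    using comp_minus_right[OF k(1) ac(1)] comp_minus_left[OF arr_shm[OF ac(2)] k(2)] by simp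
  then obtain b where "arr D Y Y' b" "b \<cdot> f = f' \<cdot> a" "shm D 1 (shm D (- 1) c) \<cdot> g = g' \<cdot> b"
    using TR3_third[OF rotate_back[OF T(1)] rotate_back[OF T(2)] arr_shm[OF ac(2)] ac(1)] by metis
  then show thesis using that shm_inverse(1)[OF ac(2), of 1] by simp
qed

lemma cone: assumes "arr D X Y f" obtains Z g h where "dist D X Y Z f g h"
  using TR1_cone[of X Y f] assms by (auto simp: arr_def)

lemma cocone:
  assumes "arr D Y Z g" obtains X f h where "dist D X Y Z f g h"
proof -
  obtain C p q where "dist D Y Z C g p q" using cone assms by blast
  from rotate_back[OF this] show thesis using that by blast
qed

lemma dist_Id: "\<lbrakk>X \<in> Ob D; zero_object D Z\<rbrakk> \<Longrightarrow> dist D Z X X 0 (Id D X) 0"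
  using rotate_back[OF TR1_Id[OF _ zero_object_sh, of X Z 1]] by (simp add: zero_object_iff)

text \<open>The axioms of the opposite category unwind to those of D: rotation becomes TR2 for the
  triangle that starts one step earlier at X[-1], and TR3 becomes the completion of a morphism of
  triangles at its first vertex, \<open>TR3_first\<close>. Most dual statements below are obtained
  by interpreting the locale in \<open>opc D\<close>.\<close>

lemma pretriangulated_opc: "pretriangulated_category (opc D)"
proof -
  interpret op: klinear_category "opc D" by (rule klinear_category_opc)
  show ?thesis
  proof
    fix n :: nat and A assume "\<And>i. i < n \<Longrightarrow> A i \<in> Ob (opc D)"
    then show "\<exists>P \<iota> \<pi>. direct_sum (opc D) {..<n} A P \<iota> \<pi>"
      using direct_sums[of n A] by auto
  next
    fix X Y Z f g h assume d: "dist (opc D) X Y Z f g h"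
    then have "dist D Z Y X g f (- shm D 1 h)" "h \<in> Hom D (sh D (- 1) X) Z" by simp_all
    then show "X \<in> Ob (opc D) \<and> Y \<in> Ob (opc D) \<and> Z \<in> Ob (opc D) \<and>
         f \<in> Hom (opc D) X Y \<and> g \<in> Hom (opc D) Y Z \<and> h \<in> Hom (opc D) Z (sh (opc D) 1 X)"
      using dist_typed[of Z Y X g f "- shm D 1 h"] by auto
  next
    fix X Z assume *: "X \<in> Ob (opc D)" "zero_object (opc D) Z"
    then have "arr D (sh D (- 1) X) Z 0" by (intro arr_0) (auto simp: sh_in_Ob zero_object_iff)
    then show "dist (opc D) X X Z (Id (opc D) X) 0 0"
      using dist_Id * by (simp add: arr_def)
  next
    fix X Y f assume "X \<in> Ob (opc D)" "Y \<in> Ob (opc D)" "f \<in> Hom (opc D) X Y"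
    then have f: "arr D Y X f" by (simp add: arr_def)
    then obtain Z g h where T: "dist D Z Y X g f h" using cocone by blast
    note A = dist_arr[OF T]
    have k: "arr D (sh D (- 1) X) Z (shm D (- 1) h)" using arr_shm[OF A(3), of "- 1"] A by simp
    then have "- shm D 1 (- shm D (- 1) h) = h" by (simp add: shm_minus shm_inverse(1)[OF A(3), of 1])
    then have "dist (opc D) X Y Z f g (- shm D (- 1) h)" using T arr_minus[OF k] by (simp add: arr_def)
    then show "\<exists>Z g h. dist (opc D) X Y Z f g h" by blast
  next
    fix X Y Z f g h assume "X \<in> Ob (opc D)" "Y \<in> Ob (opc D)" "Z \<in> Ob (opc D)"
      "f \<in> Hom (opc D) X Y" "g \<in> Hom (opc D) Y Z" "h \<in> Hom (opc D) Z (sh (opc D) 1 X)"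
    then have A: "arr D Y X f" "arr D Z Y g" "arr D (sh D (- 1) X) Z h" "X \<in> Ob D"
      by (auto simp: arr_def sh_in_Ob)
    have f: "arr D (sh D (- 1) Y) (sh D (- 1) X) (shm D (- 1) f)" using A by auto
    then have "- shm D 1 (- shm D (- 1) f) = f"
      by (simp add: shm_minus shm_inverse(1)[OF A(1), of 1])
    moreover have "- shm D (- 1) f \<in> Hom D (sh D (- 1) Y) (sh D (- 1) X)"
      using arr_minus[OF f] by (simp add: arr_def)
    ultimately show "dist (opc D) X Y Z f g h \<longleftrightarrow>
        dist (opc D) Y Z (sh (opc D) 1 X) g h (- shm (opc D) 1 f)"
      using TR2[of "sh D (- 1) X" Z Y h g f] A by (auto simp: arr_def)
  next
    fix X Y Z f g h X' Y' Z' f' g' h' a b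
    assume T: "dist (opc D) X Y Z f g h" "dist (opc D) X' Y' Z' f' g' h'"
      and ab: "a \<in> Hom (opc D) X X'" "b \<in> Hom (opc D) Y Y'" and eq: "b \<cdot>\<^bsub>opc D\<^esub> f = f' \<cdot>\<^bsub>opc D\<^esub> a"
    from T have T1: "dist D Z Y X g f (- shm D 1 h)" and T2: "dist D Z' Y' X' g' f' (- shm D 1 h')"
      and h: "h \<in> Hom D (sh D (- 1) X) Z" "h' \<in> Hom D (sh D (- 1) X') Z'" by auto
    note A = dist_arr[OF T1] and A' = dist_arr[OF T2]
    have ab: "arr D X' X a" "arr D Y' Y b" using ab A A' by (auto simp: arr_def)
    have h: "arr D (sh D (- 1) X) Z h" "arr D (sh D (- 1) X') Z' h'"
      using h A A' by (auto simp: arr_def sh_in_Ob)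
    obtain c where c: "arr D Z' Z c" "b \<cdot> g' = g \<cdot> c" "shm D 1 c \<cdot> (- shm D 1 h') = (- shm D 1 h) \<cdot> a"
      using TR3_first[OF T2 T1 ab(2,1)] eq by auto
    have hs: "arr D X (sh D 1 Z) (shm D 1 h)" "arr D X' (sh D 1 Z') (shm D 1 h')"
      using arr_shm[OF h(1), of 1] arr_shm[OF h(2), of 1] A A' by auto
    have "shm D 1 c \<cdot> shm D 1 h' = shm D 1 h \<cdot> a"
      using c(3) comp_minus_right[OF hs(2) arr_shm[OF c(1)]] comp_minus_left[OF ab(1) hs(1)] by simp
    then have "shm D 1 (c \<cdot> h') = shm D 1 (h \<cdot> shm D (- 1) a)"
      using shm_comp[OF h(2) c(1)] shm_comp[OF arr_shm[OF ab(1), of "- 1"] h(1)]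
        shm_inverse(1)[OF ab(1), of 1] by simp
    then have "c \<cdot> h' = h \<cdot> shm D (- 1) a"
      using shm_eq_iff[OF arr_cmp[OF h(2) c(1)] arr_cmp[OF arr_shm[OF ab(1)] h(1)]] by simp
    then show "\<exists>c\<in>Hom (opc D) Z Z'. c \<cdot>\<^bsub>opc D\<^esub> g = g' \<cdot>\<^bsub>opc D\<^esub> b \<and>
        shm (opc D) 1 a \<cdot>\<^bsub>opc D\<^esub> h = h' \<cdot>\<^bsub>opc D\<^esub> c"
      using c by (auto simp: arr_def)
  qed (auto simp: sh_in_Ob shm_in_Hom shm_Id shm_cmp shm_add shm_scl sh_0 shm_0 sh_sh shm_shm)
qed

end

text \<open>Bijectivity of composition with \<open>u\<close> from Hom(W,X) to Hom(W,Y). Injectivity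
  is put as a trivial kernel, which linearity makes equivalent (\<open>rbij_inj\<close>); the dual
  notion \<open>lbij\<close> is the same formula in the opposite category.\<close>

definition rbij :: "('o, 'm::ab_group_add, 'k::field) tri_cat \<Rightarrow> 'o \<Rightarrow> 'o \<Rightarrow> 'o \<Rightarrow> 'm \<Rightarrow> bool" where
  "rbij D W X Y u \<longleftrightarrow> (\<forall>f. arr D W X f \<longrightarrow> u \<cdot>\<^bsub>D\<^esub> f = 0 \<longrightarrow> f = 0) \<and>
     (\<forall>g. arr D W Y g \<longrightarrow> (\<exists>f. arr D W X f \<and> u \<cdot>\<^bsub>D\<^esub> f = g))"

abbreviation lbij :: "('o, 'm::ab_group_add, 'k::field) tri_cat \<Rightarrow> 'o \<Rightarrow> 'o \<Rightarrow> 'o \<Rightarrow> 'm \<Rightarrow> bool" where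
  "lbij D W X Y u \<equiv> rbij (opc D) W Y X u"

text \<open>Vanishing of the total Hom-space. Shifting the source or the target makes no difference
  (\<open>orth_iff_target\<close>), and quantifying over the shifts is what makes both orthogonals
  thick for arbitrary sets of objects.\<close>

definition orth :: "('o, 'm::ab_group_add, 'k::field) tri_cat \<Rightarrow> 'o \<Rightarrow> 'o \<Rightarrow> bool" where
  "orth D W Y \<longleftrightarrow> (\<forall>l. Hom D (sh D l W) Y = {0})"

lemma lbij_def:
  "lbij D W X Y u \<longleftrightarrow> (\<forall>f. arr D Y W f \<longrightarrow> f \<cdot>\<^bsub>D\<^esub> u = 0 \<longrightarrow> f = 0) \<and>
     (\<forall>g. arr D X W g \<longrightarrow> (\<exists>f. arr D Y W f \<and> f \<cdot>\<^bsub>D\<^esub> u = g))"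
  by (simp add: rbij_def)

lemma rbijD0: "\<lbrakk>rbij D W X Y u; arr D W X f; u \<cdot>\<^bsub>D\<^esub> f = 0\<rbrakk> \<Longrightarrow> f = 0"
  by (auto simp: rbij_def)

lemma rbijE:
  assumes "rbij D W X Y u" "arr D W Y g" obtains f where "arr D W X f" "u \<cdot>\<^bsub>D\<^esub> f = g"
  using assms by (auto simp: rbij_def)

lemma lbijD0: "\<lbrakk>lbij D W X Y u; arr D Y W f; f \<cdot>\<^bsub>D\<^esub> u = 0\<rbrakk> \<Longrightarrow> f = 0"
  by (auto simp: rbij_def)

lemma lbijE:
  assumes "lbij D W X Y u" "arr D X W g" obtains f where "arr D Y W f" "f \<cdot>\<^bsub>D\<^esub> u = g"
  using assms by (auto simp: rbij_def)

section \<open>Exactness of Hom-functors, the five lemma and complements of split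
  monomorphisms\<close>

context pretriangulated_category
begin

text \<open>TR3 completes the pair of the identity and \<open>f\<close> to a morphism from the
  triangle X = X -> 0, so the composite factors through a zero object.\<close>

lemma dist_comp_zero:
  assumes T: "dist D X Y Z f g h"
  shows "g \<cdot> f = 0"
proof -
  note A = dist_arr[OF T]
  obtain O' where O': "zero_object D O'" using obtain_zero_object .
  obtain c where "arr D O' Z c" "c \<cdot> 0 = g \<cdot> f"
    using TR3_third[OF TR1_Id[OF A(4) O'] T arr_Id[OF A(4)] A(1)] by metis
  moreover from this have "c = 0" using zero_object_arr O' by blast
  ultimately show ?thesis using comp_0_left[of X O' 0 Z] A O' by (auto simp: zero_object_iff)
qed

lemma dist_comp_zero':
  assumes T: "dist D X Y Z f g h"
  shows "h \<cdot> g = 0" "shm D 1 f \<cdot> h = 0"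
  using dist_comp_zero[OF rotate[OF T]] dist_comp_zero[OF rotate[OF rotate[OF T]]]
    comp_minus_left[OF dist_arr(3)[OF T] arr_shm[OF dist_arr(1)[OF T]]]
  by simp_all

text \<open>Exactness of Hom(W,-) at the middle term: \<open>u\<close> is one component of a
  morphism from the triangle W = W -> 0, and completing it yields the lift.
  \<open>lift_second\<close> and \<open>lift_zeroth\<close> are the rotated versions.\<close>

lemma lift_first:
  assumes T: "dist D X Y Z f g h" and u: "arr D W Y u" "g \<cdot> u = 0"
  obtains v where "arr D W X v" "f \<cdot> v = u"
proof -
  note A = dist_arr[OF T] and W = arr_Ob(1)[OF u(1)]
  obtain O' where O': "zero_object D O'" using obtain_zero_object .
  have "arr D O' Z 0" using O' A by (auto simp: zero_object_iff)
  moreover from this have "0 \<cdot> 0 = g \<cdot> u"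
    using u(2) comp_0_left[OF arr_0, of W O' Z] W O' A by (simp add: zero_object_iff)
  moreover have "dist D W W O' (Id D W) 0 0" using TR1_Id W O' by blast
  ultimately obtain v where v: "arr D W X v" "u \<cdot> Id D W = f \<cdot> v"
    using TR3_first[OF _ T u(1), of W O' "Id D W" 0 0 0] by metis
  then show thesis using that comp_Id_right[OF u(1)] by metis
qed

lemma lift_second:
  assumes T: "dist D X Y Z f g h" and u: "arr D W Z u" "h \<cdot> u = 0"
  obtains v where "arr D W Y v" "g \<cdot> v = u"
  using lift_first[OF rotate[OF T] u] .

lemma lift_zeroth:
  assumes T: "dist D X Y Z f g h" and u: "arr D W X u" "f \<cdot> u = 0"
  obtains v where "arr D W (sh D (- 1) Z) v" "(- shm D (- 1) h) \<cdot> v = u"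
  using lift_first[OF rotate_back[OF T] u] .

text \<open>Exactness of Hom(-,W), by completing a morphism to the triangle 0 -> W = W.\<close>

lemma extend_second:
  assumes T: "dist D X Y Z f g h" and u: "arr D Y W u" "u \<cdot> f = 0"
  obtains v where "arr D Z W v" "v \<cdot> g = u"
proof -
  note A = dist_arr[OF T] and W = arr_Ob(2)[OF u(1)]
  obtain O' where O': "zero_object D O'" using obtain_zero_object .
  have z: "arr D X O' 0" using O' A by (auto simp: zero_object_iff)
  have d: "dist D O' W W 0 (Id D W) 0" using dist_Id W O' by blast
  have "u \<cdot> f = 0 \<cdot> 0" using u comp_0_left[OF z W] by (auto simp: arr_def)
  then obtain v where "arr D Z W v" "v \<cdot> g = Id D W \<cdot> u"
    using TR3_third[OF T d z u(1)] by metis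
  then show thesis using that comp_Id_left[OF u(1)] by metis
qed

lemma extend_first:
  assumes T: "dist D X Y Z f g h" and u: "arr D X W u" "u \<cdot> (- shm D (- 1) h) = 0"
  obtains v where "arr D Y W v" "v \<cdot> f = u"
  using extend_second[OF rotate_back[OF T] u] .

lemma Hom_zero_middle:
  assumes T: "dist D X Y Z f g h" and "W \<in> Ob D" "Hom D W X = {0}" "Hom D W Z = {0}"
  shows "Hom D W Y = {0}"
  unfolding Hom_zero_iff[OF assms(2) dist_arr(5)[OF T]]
proof (intro allI impI)
  fix u assume u: "arr D W Y u"
  have "g \<cdot> u = 0" using Hom_zeroD[OF assms(4)] u dist_arr[OF T] by blast
  then obtain v where "arr D W X v" "f \<cdot> v = u" using lift_first[OF T u] by metis
  moreover from this have "v = 0" using Hom_zeroD[OF assms(3)] by blast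
  ultimately show "u = 0" using comp_0_right[OF dist_arr(1)[OF T] assms(2)] by simp
qed

lemma Hom_zero_middle':
  assumes T: "dist D X Y Z f g h" and "W \<in> Ob D" "Hom D X W = {0}" "Hom D Z W = {0}"
  shows "Hom D Y W = {0}"
  unfolding Hom_zero_iff[OF dist_arr(5)[OF T] assms(2)]
proof (intro allI impI)
  fix u assume u: "arr D Y W u"
  have "u \<cdot> f = 0" using Hom_zeroD[OF assms(3)] u dist_arr[OF T] by blast
  then obtain v where "arr D Z W v" "v \<cdot> g = u" using extend_second[OF T u] by metis
  moreover from this have "v = 0" using Hom_zeroD[OF assms(4)] by blast
  ultimately show "u = 0" using comp_0_left[OF dist_arr(2)[OF T] assms(2)] by simp
qed

lemma rbij_inj:
  assumes "rbij D W X Y u" "arr D X Y u" "arr D W X f" "arr D W X f'" "u \<cdot> f = u \<cdot> f'"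
  shows "f = f'"
  using rbijD0[OF assms(1) arr_diff[OF assms(3,4)]] comp_diff_right[OF assms(3,4,2)] assms(5)
  by simp

lemma lbij_inj:
  assumes "lbij D W X Y u" "arr D X Y u" "arr D Y W f" "arr D Y W f'" "f \<cdot> u = f' \<cdot> u"
  shows "f = f'"
  using lbijD0[OF assms(1) arr_diff[OF assms(3,4)]] comp_diff_left[OF assms(2,3,4)] assms(5)
  by simp

lemma rbij_comp:
  assumes "rbij D W X Y u" "rbij D W Y Z v" "arr D X Y u" "arr D Y Z v"
  shows "rbij D W X Z (v \<cdot> u)"
  unfolding rbij_def
proof (intro conjI allI impI)
  fix f assume f: "arr D W X f" "(v \<cdot> u) \<cdot> f = 0"
  then have "v \<cdot> (u \<cdot> f) = 0" using comp_assoc[OF f(1) assms(3,4)] by simp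
  then show "f = 0" using rbijD0[OF assms(2)] rbijD0[OF assms(1)] f(1) assms(3) by blast
next
  fix g assume "arr D W Z g"
  then obtain f where f: "arr D W Y f" "v \<cdot> f = g" using rbijE[OF assms(2)] by blast
  then obtain e where e: "arr D W X e" "u \<cdot> e = f" using rbijE[OF assms(1)] by blast
  then show "\<exists>f. arr D W X f \<and> (v \<cdot> u) \<cdot> f = g" using f comp_assoc[OF e(1) assms(3,4)] by auto
qed

lemma iso_rbij:
  assumes "iso_mor D X Y u" "X \<in> Ob D" "Y \<in> Ob D"
  shows "rbij D W X Y u"
proof -
  obtain v where v: "arr D X Y u" "arr D Y X v" "v \<cdot> u = Id D X" "u \<cdot> v = Id D Y"
    using assms iso_mor_iff by blast
  show ?thesis unfolding rbij_def
  proof (intro conjI allI impI)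
    fix f assume f: "arr D W X f" "u \<cdot> f = 0"
    then have "(v \<cdot> u) \<cdot> f = 0" using comp_assoc[OF f(1) v(1,2)] comp_0_right[OF v(2)] by (auto simp: arr_def)
    then show "f = 0" using v comp_Id_left[OF f(1)] by simp
  next
    fix g assume g: "arr D W Y g"
    then have "u \<cdot> (v \<cdot> g) = g" using comp_assoc[OF g v(2,1)] v(4) comp_Id_left[OF g] by simp
    then show "\<exists>f. arr D W X f \<and> u \<cdot> f = g" using g v by blast
  qed
qed

lemma iso_if_rbij:
  assumes "arr D X Y u" "rbij D X X Y u" "rbij D Y X Y u"
  shows "iso_mor D X Y u"
proof -
  note Ob = arr_Ob[OF assms(1)]
  obtain v where v: "arr D Y X v" "u \<cdot> v = Id D Y" using rbijE[OF assms(3) arr_Id[OF Ob(2)]] .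
  have "u \<cdot> (v \<cdot> u) = u \<cdot> Id D X"
    using comp_assoc[OF assms(1) v(1) assms(1)] v(2) comp_Id_left[OF assms(1)]
      comp_Id_right[OF assms(1)] by simp
  then have "v \<cdot> u = Id D X" using rbij_inj[OF assms(2,1)] v assms(1) Ob by blast
  then show ?thesis using iso_mor_iff[OF Ob] v assms(1) by blast
qed

lemma rbij_shift_iff:
  assumes "arr D X Y u" "W \<in> Ob D"
  shows "rbij D (sh D (- l) W) X Y u \<longleftrightarrow> rbij D W (sh D l X) (sh D l Y) (shm D l u)"
proof -
  note Ob = arr_Ob[OF assms(1)]
  have up: "arr D W (sh D l Z) (shm D l f)" if "arr D (sh D (- l) W) Z f" for Z f
    using arr_shm[OF that, of l] assms by simp
  have down: "arr D (sh D (- l) W) Z (shm D (- l) f)" "shm D l (shm D (- l) f) = f"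
    if "Z \<in> Ob D" "arr D W (sh D l Z) f" for Z f
    using arr_shm[OF that(2), of "- l"] that shm_inverse[OF that(2), of l] by auto
  have cmp: "shm D l (u \<cdot> f) = shm D l u \<cdot> shm D l f" if "arr D (sh D (- l) W) X f" for f
    using shm_comp[OF that assms(1)] .
  show ?thesis
  proof
    assume *: "rbij D (sh D (- l) W) X Y u"
    show "rbij D W (sh D l X) (sh D l Y) (shm D l u)" unfolding rbij_def
    proof (intro conjI allI impI)
      fix f assume f: "arr D W (sh D l X) f" "shm D l u \<cdot> f = 0"
      note d = down[OF Ob(1) f(1)]
      have "shm D l (u \<cdot> shm D (- l) f) = 0" using cmp[OF d(1)] d(2) f(2) by simp
      then have "shm D (- l) f = 0"
        using rbijD0[OF * d(1)] shm_eq_0_iff[OF arr_cmp[OF d(1) assms(1)]] by simp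
      then show "f = 0" using d(2) by simp
    next
      fix g assume g: "arr D W (sh D l Y) g"
      note d = down[OF Ob(2) g]
      obtain f where f: "arr D (sh D (- l) W) X f" "u \<cdot> f = shm D (- l) g"
        using rbijE[OF * d(1)] .
      then have "shm D l u \<cdot> shm D l f = g" using cmp[OF f(1)] d(2) by simp
      then show "\<exists>f. arr D W (sh D l X) f \<and> shm D l u \<cdot> f = g" using up[OF f(1)] by blast
    qed
  next
    assume *: "rbij D W (sh D l X) (sh D l Y) (shm D l u)"
    show "rbij D (sh D (- l) W) X Y u" unfolding rbij_def
    proof (intro conjI allI impI)
      fix f assume f: "arr D (sh D (- l) W) X f" "u \<cdot> f = 0"
      then have "shm D l f = 0" using rbijD0[OF * up[OF f(1)]] cmp[OF f(1)] by simp
      then show "f = 0" using shm_eq_0_iff[OF f(1)] by simp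
    next
      fix g assume g: "arr D (sh D (- l) W) Y g"
      obtain f where f: "arr D W (sh D l X) f" "shm D l u \<cdot> f = shm D l g"
        using rbijE[OF * up[OF g]] .
      note d = down[OF Ob(1) f(1)]
      have "shm D l (u \<cdot> shm D (- l) f) = shm D l g" using cmp[OF d(1)] d(2) f(2) by simp
      then have "u \<cdot> shm D (- l) f = g"
        using shm_eq_iff[OF arr_cmp[OF d(1) assms(1)] g] by simp
      then show "\<exists>f. arr D (sh D (- l) W) X f \<and> u \<cdot> f = g" using d by blast
    qed
  qed
qed

text \<open>The five lemma for the long exact sequences of Hom(W,-). The four outer isomorphisms are
  \<open>a\<close> and \<open>c\<close> in degree 0, \<open>a\<close> at X[1] and \<open>c\<close>
  at Z[-1]; the last two are expressed by shifting W by -1 and by 1 instead.\<close>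

lemma five_lemma:
  assumes T: "dist D X Y Z f g h" "dist D X' Y' Z' f' g' h'"
    and abc: "arr D X X' a" "arr D Y Y' b" "arr D Z Z' c"
    and eq: "b \<cdot> f = f' \<cdot> a" "c \<cdot> g = g' \<cdot> b" "shm D 1 a \<cdot> h = h' \<cdot> c"
    and a: "rbij D W X X' a" "rbij D (sh D (- 1) W) X X' a"
    and c: "rbij D W Z Z' c" "rbij D (sh D 1 W) Z Z' c" and W: "W \<in> Ob D"
  shows "rbij D W Y Y' b"
  unfolding rbij_def
proof (intro conjI allI impI)
  note A = dist_arr[OF T(1)] and A' = dist_arr[OF T(2)]
  fix y assume y: "arr D W Y y" "b \<cdot> y = 0"
  have "c \<cdot> (g \<cdot> y) = 0"
    using comp_assoc[OF y(1) A(2) abc(3)] comp_assoc[OF y(1) abc(2) A'(2)] y(2) eq(2)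
      comp_0_right[OF A'(2) W] by simp
  then have "g \<cdot> y = 0" using rbijD0[OF c(1)] y A by blast
  then obtain x where x: "arr D W X x" "f \<cdot> x = y" using lift_first[OF T(1) y(1)] by blast
  have "f' \<cdot> (a \<cdot> x) = 0"
    using comp_assoc[OF x(1) abc(1) A'(1)] comp_assoc[OF x(1) A(1) abc(2)] x(2) y(2) eq(1) by simp
  then obtain z' where z': "arr D W (sh D (- 1) Z') z'" "(- shm D (- 1) h') \<cdot> z' = a \<cdot> x"
    using lift_zeroth[OF T(2) arr_cmp[OF x(1) abc(1)]] by blast
  have "rbij D W (sh D (- 1) Z) (sh D (- 1) Z') (shm D (- 1) c)"
    using rbij_shift_iff[OF abc(3) W, of "- 1"] c(2) by simp
  from rbijE[OF this z'(1)]
  obtain z where z: "arr D W (sh D (- 1) Z) z" "shm D (- 1) c \<cdot> z = z'" .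
  have k: "arr D (sh D (- 1) Z) X (shm D (- 1) h)" "arr D (sh D (- 1) Z') X' (shm D (- 1) h')"
    using arr_shm[OF A(3), of "- 1"] arr_shm[OF A'(3), of "- 1"] A A' by auto
  have e: "a \<cdot> shm D (- 1) h = shm D (- 1) h' \<cdot> shm D (- 1) c"
    using arg_cong[OF eq(3), of "shm D (- 1)"] shm_comp[OF A(3) arr_shm[OF abc(1)], of "- 1"]
      shm_comp[OF abc(3) A'(3), of "- 1"] shm_inverse(2)[OF abc(1), of 1] by simp
  have "a \<cdot> ((- shm D (- 1) h) \<cdot> z) = (- shm D (- 1) h') \<cdot> (shm D (- 1) c \<cdot> z)"
    using comp_assoc[OF z(1) arr_minus[OF k(1)] abc(1)]
      comp_assoc[OF z(1) arr_shm[OF abc(3)] arr_minus[OF k(2)]] e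
      comp_minus_right[OF k(1) abc(1)] comp_minus_left[OF arr_shm[OF abc(3)] k(2)] by simp
  then have "a \<cdot> ((- shm D (- 1) h) \<cdot> z) = a \<cdot> x" using z z' by simp
  then have "x = (- shm D (- 1) h) \<cdot> z"
    using rbij_inj[OF a(1) abc(1) x(1) arr_cmp[OF z(1) arr_minus[OF k(1)]]] by simp
  then show "y = 0"
    using x(2) comp_assoc[OF z(1) arr_minus[OF k(1)] A(1)] dist_comp_zero[OF rotate_back[OF T(1)]]
      comp_0_left[OF z(1)] A by simp
next
  note A = dist_arr[OF T(1)] and A' = dist_arr[OF T(2)]
  fix y' assume y': "arr D W Y' y'"
  obtain z where z: "arr D W Z z" "c \<cdot> z = g' \<cdot> y'"
    using rbijE[OF c(1) arr_cmp[OF y' A'(2)]] .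
  have "shm D 1 a \<cdot> (h \<cdot> z) = h' \<cdot> (g' \<cdot> y')"
    using comp_assoc[OF z(1) A(3) arr_shm[OF abc(1)]] comp_assoc[OF z(1) abc(3) A'(3)] eq(3) z(2)
    by simp
  also have "\<dots> = 0"
    using comp_assoc[OF y' A'(2,3)] dist_comp_zero'(1)[OF T(2)] comp_0_left[OF y'] arr_Ob[OF A'(3)]
    by simp
  finally have "h \<cdot> z = 0"
    using rbijD0[OF rbij_shift_iff[OF abc(1) W, THEN iffD1, OF a(2)] arr_cmp[OF z(1) A(3)]] by simp
  then obtain y0 where y0: "arr D W Y y0" "g \<cdot> y0 = z" using lift_second[OF T(1) z(1)] by blast
  have "g' \<cdot> (y' - b \<cdot> y0) = 0"
    using comp_diff_right[OF y' arr_cmp[OF y0(1) abc(2)] A'(2)]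
      comp_assoc[OF y0(1) abc(2) A'(2)] comp_assoc[OF y0(1) A(2) abc(3)] eq(2) y0(2) z(2) by simp
  then obtain x' where x': "arr D W X' x'" "f' \<cdot> x' = y' - b \<cdot> y0"
    using lift_first[OF T(2) arr_diff[OF y' arr_cmp[OF y0(1) abc(2)]]] by blast
  obtain x where x: "arr D W X x" "a \<cdot> x = x'" using rbijE[OF a(1) x'(1)] .
  have "b \<cdot> (y0 + f \<cdot> x) = b \<cdot> y0 + f' \<cdot> (a \<cdot> x)"
    using comp_add_right[OF y0(1) arr_cmp[OF x(1) A(1)] abc(2)] comp_assoc[OF x(1) A(1) abc(2)]
      comp_assoc[OF x(1) abc(1) A'(1)] eq(1) by simp
  also have "\<dots> = y'" using x x' by simp
  finally show "\<exists>y. arr D W Y y \<and> b \<cdot> y = y'"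
    using arr_add[OF y0(1) arr_cmp[OF x(1) A(1)]] by blast
qed

lemma rbij_if_orth_cone:
  assumes T: "dist D X Y Z f g h" and W: "W \<in> Ob D"
    and "Hom D W Z = {0}" "Hom D (sh D 1 W) Z = {0}"
  shows "rbij D W X Y f"
  unfolding rbij_def
proof (intro conjI allI impI)
  note A = dist_arr[OF T]
  fix u assume u: "arr D W X u" "f \<cdot> u = 0"
  obtain v where v: "arr D W (sh D (- 1) Z) v" "(- shm D (- 1) h) \<cdot> v = u"
    using lift_zeroth[OF T u] .
  have "Hom D W (sh D (- 1) Z) = {0}" using Hom_shift_zero[of W Z 0 "- 1"] assms A by (simp add: sh_0)
  then have "v = 0" using v(1) Hom_zeroD by blast
  moreover have "arr D (sh D (- 1) Z) X (- shm D (- 1) h)" using arr_shm[OF A(3), of "- 1"] A by auto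
  ultimately show "u = 0" using v(2) comp_0_right W by blast
next
  note A = dist_arr[OF T]
  fix u assume u: "arr D W Y u"
  then have "g \<cdot> u = 0" using Hom_zeroD[OF assms(3)] A by blast
  then show "\<exists>v. arr D W X v \<and> f \<cdot> v = u" using lift_first[OF T u] by metis
qed

lemma orth_cone_if_rbij:
  assumes T: "dist D X Y Z f g h" and W: "W \<in> Ob D"
    and "rbij D W X Y f" "rbij D (sh D (- 1) W) X Y f"
  shows "Hom D W Z = {0}"
  unfolding Hom_zero_iff[OF W dist_arr(6)[OF T]]
proof (intro allI impI)
  note A = dist_arr[OF T]
  fix u assume u: "arr D W Z u"
  have "shm D 1 f \<cdot> (h \<cdot> u) = 0"
    using comp_assoc[OF u A(3) arr_shm[OF A(1)]] dist_comp_zero'(2)[OF T] comp_0_left[OF u] A sh_in_Ob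
    by simp
  moreover have "rbij D W (sh D 1 X) (sh D 1 Y) (shm D 1 f)"
    using rbij_shift_iff[OF A(1) W, of 1] assms by simp
  ultimately have "h \<cdot> u = 0" using rbijD0[OF _ arr_cmp[OF u A(3)]] by blast
  then obtain v where v: "arr D W Y v" "g \<cdot> v = u" using lift_second[OF T u] by blast
  then obtain w where w: "arr D W X w" "f \<cdot> w = v" using rbijE[OF assms(3)] by blast
  then have "u = (g \<cdot> f) \<cdot> w" using v comp_assoc[OF w(1) A(1,2)] by simp
  then show "u = 0" using dist_comp_zero[OF T] comp_0_left[OF w(1)] A by simp
qed

lemma orthI: "(\<And>l. Hom D (sh D l W) Y = {0}) \<Longrightarrow> orth D W Y"
  by (simp add: orth_def)

text \<open>In the long exact sequence Hom(W,Z) sits between two neighbouring degrees of composition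
  with \<open>f\<close>, so an equivalence arises only when all shifts are taken at once. This is
  the bridge between universal maps and orthogonal cones.\<close>

lemma rbij_all_shifts_iff:
  assumes T: "dist D X Y Z f g h" and W: "W \<in> Ob D"
  shows "(\<forall>l. rbij D (sh D l W) X Y f) \<longleftrightarrow> orth D W Z"
proof
  assume *: "\<forall>l. rbij D (sh D l W) X Y f"
  show "orth D W Z"
    by (intro orthI orth_cone_if_rbij[OF T]) (use * W in \<open>simp_all add: sh_in_Ob sh_sh\<close>)
next
  assume "orth D W Z"
  then show "\<forall>l. rbij D (sh D l W) X Y f"
    by (intro allI rbij_if_orth_cone[OF T]) (use W in \<open>simp_all add: orth_def sh_in_Ob sh_sh\<close>)
qed

lemma iso_if_cone_zero:
  assumes T: "dist D X Y Z f g h" and Z: "zero_object D Z"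
  shows "iso_mor D X Y f"
  by (intro iso_if_rbij dist_arr(1)[OF T] rbij_if_orth_cone[OF T] dist_arr(4,5)[OF T])
    (use Z dist_arr[OF T] in \<open>auto simp: zero_object_def sh_in_Ob\<close>)

text \<open>A split monomorphism has zero connecting map: \<open>h\<close> equals p[1] i[1] h, and
  i[1] h = 0 in a triangle. Hence \<open>g\<close> has a section and the third vertex is a
  complement of Y in X.\<close>

lemma complement:
  assumes i: "arr D Y X i" and p: "arr D X Y p" and pi: "p \<cdot> i = Id D Y"
  obtains Z s g h where "dist D Y X Z i g h" "arr D Z X s" "g \<cdot> s = Id D Z" "p \<cdot> s = 0"
    "i \<cdot> p + s \<cdot> g = Id D X"
proof -
  obtain Z g h where T: "dist D Y X Z i g h" using cone i by blast
  note A = dist_arr[OF T]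
  have "h = shm D 1 (p \<cdot> i) \<cdot> h" using pi shm_Id[of Y 1] A comp_Id_left[OF A(3)] by simp
  also have "\<dots> = 0"
    using shm_comp[OF i p] comp_assoc[OF A(3) arr_shm[OF i] arr_shm[OF p]] dist_comp_zero'(2)[OF T]
      comp_0_right[OF arr_shm[OF p], of Z 1] A by simp
  finally have "h \<cdot> Id D Z = 0" using comp_0_left[OF arr_Id, of Z] A sh_in_Ob by simp
  then obtain t where t: "arr D Z X t" "g \<cdot> t = Id D Z" using lift_second[OF T arr_Id] A by blast
  \<comment> \<open>Removing from the arbitrary section \<open>t\<close> its component along
    \<open>i\<close> gives a section that \<open>p\<close> kills.\<close>
  define s where "s = t - i \<cdot> (p \<cdot> t)"
  have ipt: "arr D Z X (i \<cdot> (p \<cdot> t))" using i p t by blast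
  have s: "arr D Z X s" unfolding s_def using t ipt by blast
  have gi: "g \<cdot> i = 0" using dist_comp_zero[OF T] .
  have gs: "g \<cdot> s = Id D Z"
    using comp_diff_right[OF t(1) ipt A(2)] comp_assoc[OF arr_cmp[OF t(1) p] i A(2)] gi t(2)
      comp_0_left[OF arr_cmp[OF t(1) p]] A by (simp add: s_def)
  have ps: "p \<cdot> s = 0"
    using comp_diff_right[OF t(1) ipt p] comp_assoc[OF arr_cmp[OF t(1) p] i p] pi
      comp_Id_left[OF arr_cmp[OF t(1) p]] by (simp add: s_def)
  \<comment> \<open>The defect of the decomposition. It is killed by \<open>g\<close>, so it factors
    through \<open>i\<close>; the factor is p d, which also vanishes.\<close>
  define d where "d = Id D X - (i \<cdot> p + s \<cdot> g)"
  have ip: "arr D X X (i \<cdot> p)" and sg: "arr D X X (s \<cdot> g)" and I: "arr D X X (Id D X)"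
    using i p s A by auto
  have d: "arr D X X d" unfolding d_def using ip sg I by blast
  have "g \<cdot> d = g - (g \<cdot> (i \<cdot> p) + g \<cdot> (s \<cdot> g))"
    using comp_diff_right[OF I arr_add[OF ip sg] A(2)] comp_add_right[OF ip sg A(2)]
      comp_Id_right[OF A(2)] by (simp add: d_def)
  also have "\<dots> = 0"
    using comp_assoc[OF p i A(2)] comp_assoc[OF A(2) s A(2)] gi gs comp_0_left[OF p]
      comp_Id_left[OF A(2)] A by simp
  finally obtain v where v: "arr D X Y v" "i \<cdot> v = d" using lift_first[OF T d] by blast
  have "v = p \<cdot> d" using comp_assoc[OF v(1) i p] pi comp_Id_left[OF v(1)] v(2) by simp
  also have "\<dots> = p - (p \<cdot> (i \<cdot> p) + p \<cdot> (s \<cdot> g))"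
    using comp_diff_right[OF I arr_add[OF ip sg] p] comp_add_right[OF ip sg p]
      comp_Id_right[OF p] by (simp add: d_def)
  also have "\<dots> = 0"
    using comp_assoc[OF p i p] comp_assoc[OF A(2) s p] pi ps comp_0_left[OF A(2)]
      comp_Id_left[OF p] A by simp
  finally have "d = 0" using v(2) comp_0_right[OF i] A by simp
  then have "i \<cdot> p + s \<cdot> g = Id D X" by (simp add: d_def)
  then show thesis using that T s gs ps by blast
qed

lemma direct_summandI:
  assumes i: "arr D Y X i" and p: "arr D X Y p" and pi: "p \<cdot> i = Id D Y"
  shows "direct_summand D Y X"
proof -
  obtain Z s g h where T: "dist D Y X Z i g h" and s: "arr D Z X s" "g \<cdot> s = Id D Z" "p \<cdot> s = 0"
    "i \<cdot> p + s \<cdot> g = Id D X" using complement[OF assms] .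
  note A = dist_arr[OF T]
  have "direct_sum D UNIV (\<lambda>b. if b then Y else Z) X (\<lambda>b. if b then i else s) (\<lambda>b. if b then p else g)"
    using assms s A dist_comp_zero[OF T] by (auto simp: direct_sum_def UNIV_bool arr_def add.commute)
  then show ?thesis by (auto simp: direct_summand_def)
qed

lemma direct_summandE:
  assumes "direct_summand D Y X"
  obtains i p where "arr D Y X i" "arr D X Y p" "p \<cdot> i = Id D Y"
proof -
  obtain Y' \<iota> \<pi> where *: "direct_sum D (UNIV :: bool set) (\<lambda>b. if b then Y else Y') X \<iota> \<pi>"
    using assms by (auto simp: direct_summand_def)
  have "arr D Y X (\<iota> True)" "arr D X Y (\<pi> True)" "\<pi> True \<cdot> \<iota> True = Id D Y"
    using * by (auto simp: direct_sum_def arr_def split: if_splits)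
  then show thesis using that by blast
qed

section \<open>Thick subcategories\<close>

lemma dist_opcI:
  assumes T: "dist D X Y Z f g h"
  shows "dist (opc D) Z Y X g f (- shm D (- 1) h)"
proof -
  note A = dist_arr[OF T]
  have k: "arr D (sh D (- 1) Z) X (- shm D (- 1) h)"
    using arr_minus[OF arr_shm[OF A(3), of "- 1"]] A by simp
  have "- shm D 1 (- shm D (- 1) h) = h"
    using shm_minus[OF arr_shm[OF A(3), of "- 1"], of 1] shm_inverse(1)[OF A(3), of 1] by simp
  then show ?thesis using T k by (simp add: arr_def)
qed

text \<open>Isomorphic objects and direct summands are both retracts, so one closure condition
  covers the two, and no complementary summand has to be named.\<close>

lemma thickI:
  assumes "B \<subseteq> Ob D" "\<And>Z. zero_object D Z \<Longrightarrow> Z \<in> B" "\<And>X l. X \<in> B \<Longrightarrow> sh D l X \<in> B"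
    and "\<And>X Y Z f g h. \<lbrakk>dist D X Y Z f g h; X \<in> B; Z \<in> B\<rbrakk> \<Longrightarrow> Y \<in> B"
    and retract: "\<And>X Y i p. \<lbrakk>arr D Y X i; arr D X Y p; p \<cdot> i = Id D Y; X \<in> B\<rbrakk> \<Longrightarrow> Y \<in> B"
  shows "thick_subcategory D B"
  unfolding thick_subcategory_def triangulated_subcategory_def
proof (intro conjI allI impI)
  show "B \<noteq> {}" using assms(2) obtain_zero_object by blast
  fix X Y
  { assume "X \<in> B \<and> isomorphic D X Y"
    then obtain u v where "X \<in> B" "arr D X Y u" "arr D Y X v" "u \<cdot> v = Id D Y"
      unfolding isomorphic_def using iso_mor_iff[of X Y] by auto
    then show "Y \<in> B" using retract[of Y X v u] by simp }
  { assume *: "X \<in> B \<and> direct_summand D Y X"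
    then obtain i p where "arr D Y X i" "arr D X Y p" "p \<cdot> i = Id D Y"
      using direct_summandE[of Y X] by metis
    then show "Y \<in> B" using retract[of Y X i p] * by simp }
qed (use assms in blast)+

lemma thick_Ob: "thick_subcategory D B \<Longrightarrow> X \<in> B \<Longrightarrow> X \<in> Ob D"
  by (metis subsetD thick_subcategory_def triangulated_subcategory_def)

lemma thick_sh: "thick_subcategory D B \<Longrightarrow> X \<in> B \<Longrightarrow> sh D l X \<in> B"
  by (metis thick_subcategory_def triangulated_subcategory_def)

lemma thick_extension:
  "\<lbrakk>thick_subcategory D B; dist D X Y Z f g h; X \<in> B; Z \<in> B\<rbrakk> \<Longrightarrow> Y \<in> B"
  unfolding thick_subcategory_def triangulated_subcategory_def by blast

lemma thick_retract:
  "\<lbrakk>thick_subcategory D B; arr D Y X i; arr D X Y p; p \<cdot> i = Id D Y; X \<in> B\<rbrakk> \<Longrightarrow> Y \<in> B"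
  using direct_summandI[of Y X i p] by (simp add: thick_subcategory_def)

text \<open>A zero object is a retract of any member.\<close>

lemma thick_zero:
  assumes B: "thick_subcategory D B" and Z: "zero_object D Z"
  shows "Z \<in> B"
proof -
  obtain X where X: "X \<in> B" using B
    by (metis equals0I thick_subcategory_def triangulated_subcategory_def)
  then have "arr D Z X 0" "arr D X Z 0" using thick_Ob[OF B X] Z by (auto simp: zero_object_iff)
  moreover have "0 \<cdot> 0 = Id D Z"
    using comp_0_left[OF calculation(1), of Z] Z by (simp add: zero_object_iff)
  ultimately show ?thesis using thick_retract[OF B] X by blast
qed

lemma thick_iso:
  "\<lbrakk>thick_subcategory D B; iso_mor D X Y u; X \<in> B; Y \<in> Ob D\<rbrakk> \<Longrightarrow> Y \<in> B"
  using thick_retract[of B Y X] thick_Ob iso_mor_iff by metis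

lemma thick_cone:
  "\<lbrakk>thick_subcategory D B; dist D X Y Z f g h; X \<in> B; Y \<in> B\<rbrakk> \<Longrightarrow> Z \<in> B"
  using thick_extension[OF _ rotate] thick_sh by blast

lemma thick_cocone:
  "\<lbrakk>thick_subcategory D B; dist D X Y Z f g h; Y \<in> B; Z \<in> B\<rbrakk> \<Longrightarrow> X \<in> B"
  using thick_extension[OF _ rotate_back] thick_sh by blast

lemma thick_Ob_D: "thick_subcategory D (Ob D)"
  by (rule thickI) (use dist_arr in \<open>auto simp: sh_in_Ob zero_object_iff arr_def\<close>)

lemma thick_Inter:
  assumes "\<And>B. B \<in> \<B> \<Longrightarrow> thick_subcategory D B" "\<B> \<noteq> {}"
  shows "thick_subcategory D (\<Inter>\<B>)"
proof (rule thickI)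
  show "\<Inter>\<B> \<subseteq> Ob D" using assms thick_Ob by blast
next
  fix Z assume "zero_object D Z" then show "Z \<in> \<Inter>\<B>" using thick_zero assms(1) by blast
next
  fix X l assume "X \<in> \<Inter>\<B>" then show "sh D l X \<in> \<Inter>\<B>" using thick_sh assms(1) by blast
next
  fix X Y Z f g h assume "dist D X Y Z f g h" "X \<in> \<Inter>\<B>" "Z \<in> \<Inter>\<B>"
  then show "Y \<in> \<Inter>\<B>" using thick_extension[OF assms(1)] by (metis InterE InterI)
next
  fix X Y i p assume "arr D Y X i" "arr D X Y p" "p \<cdot> i = Id D Y" "X \<in> \<Inter>\<B>"
  then show "Y \<in> \<Inter>\<B>" using thick_retract[OF assms(1)] by (metis InterE InterI)
qed

lemma thick_gen: "S \<subseteq> Ob D \<Longrightarrow> thick_subcategory D (gen D S)"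
  unfolding gen_def hull_def using thick_Ob_D by (intro thick_Inter) auto

lemma gen_superset: "S \<subseteq> gen D S"
  unfolding gen_def by (rule hull_subset)

lemma gen_least: "\<lbrakk>S \<subseteq> B; thick_subcategory D B\<rbrakk> \<Longrightarrow> gen D S \<subseteq> B"
  unfolding gen_def by (rule hull_minimal)

lemma gen_thick: "thick_subcategory D B \<Longrightarrow> gen D B = B"
  using gen_least[of B B] gen_superset by blast

lemma gen_mono: "S \<subseteq> T \<Longrightarrow> gen D S \<subseteq> gen D T"
  unfolding gen_def by (rule hull_mono)

lemma gen_Ob: "S \<subseteq> Ob D \<Longrightarrow> X \<in> gen D S \<Longrightarrow> X \<in> Ob D"
  using thick_gen thick_Ob by blast

lemma gen_eqI: "\<lbrakk>S \<subseteq> gen D T; T \<subseteq> gen D S; S \<subseteq> Ob D; T \<subseteq> Ob D\<rbrakk> \<Longrightarrow> gen D S = gen D T"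
  using gen_least thick_gen by (metis subset_antisym)

lemma gen_UN_gen:
  assumes "\<And>i. i \<in> I \<Longrightarrow> S i \<subseteq> Ob D"
  shows "gen D (\<Union>i\<in>I. gen D (S i)) = gen D (\<Union>i\<in>I. S i)"
proof (rule gen_eqI)
  show "(\<Union>i\<in>I. gen D (S i)) \<subseteq> gen D (\<Union>i\<in>I. S i)"
    by (intro UN_least gen_mono) auto
  have "S i \<subseteq> gen D (\<Union>i\<in>I. gen D (S i))" if "i \<in> I" for i
    using gen_superset[of "S i"] gen_superset[of "\<Union>i\<in>I. gen D (S i)"] that by blast
  then show "(\<Union>i\<in>I. S i) \<subseteq> gen D (\<Union>i\<in>I. gen D (S i))" by blast
  show "(\<Union>i\<in>I. gen D (S i)) \<subseteq> Ob D" using assms gen_Ob by (intro UN_least subsetI) metis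
  show "(\<Union>i\<in>I. S i) \<subseteq> Ob D" using assms by blast
qed

lemma thick_opc [simp]: "thick_subcategory (opc D) B \<longleftrightarrow> thick_subcategory D B"
proof -
  interpret op: pretriangulated_category "opc D" by (rule pretriangulated_opc)
  show ?thesis
  proof
    assume B: "thick_subcategory (opc D) B"
    show "thick_subcategory D B"
    proof (rule thickI)
      fix X Y Z f g h assume "dist D X Y Z f g h" "X \<in> B" "Z \<in> B"
      then show "Y \<in> B" using op.thick_extension[OF B] dist_opcI by blast
    next
      fix X l assume "X \<in> B" then show "sh D l X \<in> B" using op.thick_sh[OF B, of X "- l"] by simp
    next
      fix X Y i p assume "arr D Y X i" "arr D X Y p" "p \<cdot> i = Id D Y" "X \<in> B"
      then show "Y \<in> B" using op.thick_retract[OF B, of Y X p i] by simp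
    qed (use op.thick_Ob[OF B] op.thick_zero[OF B] in auto)
  next
    assume B: "thick_subcategory D B"
    show "thick_subcategory (opc D) B"
    proof (rule op.thickI)
      fix X Y Z f g h assume "dist (opc D) X Y Z f g h" "X \<in> B" "Z \<in> B"
      then show "Y \<in> B" using thick_extension[OF B] by auto
    next
      fix X l assume "X \<in> B" then show "sh (opc D) l X \<in> B" using thick_sh[OF B] by simp
    next
      fix X Y i p
      assume "arr (opc D) Y X i" "arr (opc D) X Y p" "p \<cdot>\<^bsub>opc D\<^esub> i = Id (opc D) Y" "X \<in> B"
      then show "Y \<in> B" using thick_retract[OF B, of Y X p i] by simp
    qed (use thick_Ob[OF B] thick_zero[OF B] in auto)
  qed
qed

lemma gen_opc [simp]: "gen (opc D) S = gen D S"
  by (simp add: gen_def hull_def)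

lemma orth_opc: "\<lbrakk>X \<in> Ob D; Y \<in> Ob D\<rbrakk> \<Longrightarrow> orth (opc D) X Y \<longleftrightarrow> orth D Y X"
proof -
  assume "X \<in> Ob D" "Y \<in> Ob D"
  then have "Hom D Y (sh D (- l) X) = {0} \<longleftrightarrow> Hom D (sh D l Y) X = {0}" for l
    using Hom_shift_zero[of Y X 0 "- l"] by (simp add: sh_0)
  then show ?thesis by (simp add: orth_def)
qed

lemma orth_iff_target: "\<lbrakk>X \<in> Ob D; Y \<in> Ob D\<rbrakk> \<Longrightarrow> orth D X Y \<longleftrightarrow> (\<forall>l. Hom D X (sh D l Y) = {0})"
proof -
  assume "X \<in> Ob D" "Y \<in> Ob D"
  then have "Hom D (sh D l X) Y = {0} \<longleftrightarrow> Hom D X (sh D (- l) Y) = {0}" for l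
    using Hom_shift_zero[of X Y 0 "- l"] by (simp add: sh_0)
  then show ?thesis unfolding orth_def by (metis minus_minus)
qed

lemma orth_Hom: "orth D X Y \<Longrightarrow> X \<in> Ob D \<Longrightarrow> Hom D X Y = {0}"
  unfolding orth_def by (metis sh_0)

lemma orth_arr: "orth D X Y \<Longrightarrow> arr D X Y f \<Longrightarrow> f = 0"
  using orth_Hom Hom_zeroD arr_Ob by blast

lemma orth_sh_right:
  "\<lbrakk>X \<in> Ob D; Y \<in> Ob D; orth D X Y\<rbrakk> \<Longrightarrow> orth D X (sh D l Y)"
  unfolding orth_def using Hom_shift_zero by blast

lemma orth_retract:
  assumes "orth D W X" "W \<in> Ob D" "arr D Y X i" "arr D X Y p" "p \<cdot> i = Id D Y"
  shows "orth D W Y"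
proof (rule orthI)
  fix l
  have "f = 0" if f: "arr D (sh D l W) Y f" for f
  proof -
    have "i \<cdot> f = 0" using Hom_zeroD[OF _ arr_cmp[OF f assms(3)]] assms(1) by (simp add: orth_def)
    then have "(p \<cdot> i) \<cdot> f = 0"
      using comp_assoc[OF f assms(3,4)] comp_0_right[OF assms(4)] arr_Ob[OF f] by simp
    then show ?thesis using assms(5) comp_Id_left[OF f] by simp
  qed
  then show "Hom D (sh D l W) Y = {0}" using Hom_zero_iff sh_in_Ob assms by (auto simp: arr_def)
qed

lemma thick_right_orth:
  assumes "S \<subseteq> Ob D" shows "thick_subcategory D {Y \<in> Ob D. \<forall>W\<in>S. orth D W Y}"
  (is "thick_subcategory D ?T")
proof (rule thickI)
  fix X Y Z f g h
  assume T: "dist D X Y Z f g h" and "X \<in> ?T" "Z \<in> ?T"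
  then show "Y \<in> ?T"
    using Hom_zero_middle[OF T] dist_arr[OF T] assms sh_in_Ob by (auto simp: orth_def)
next
  fix X Y i p
  assume "arr D Y X i" "arr D X Y p" "p \<cdot> i = Id D Y" "X \<in> ?T"
  then show "Y \<in> ?T"
    using orth_retract assms arr_Ob by blast
next
  fix Z assume Z: "zero_object D Z"
  then show "Z \<in> ?T"
    using assms sh_in_Ob by (auto simp: orth_def zero_object_def subset_iff)
next
  fix X l assume "X \<in> ?T"
  then show "sh D l X \<in> ?T"
    using orth_sh_right assms sh_in_Ob by auto
qed auto

lemma thick_left_orth:
  assumes "S \<subseteq> Ob D" shows "thick_subcategory D {X \<in> Ob D. \<forall>W\<in>S. orth D X W}"
proof -
  interpret op: pretriangulated_category "opc D" by (rule pretriangulated_opc)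
  have "{X \<in> Ob D. \<forall>W\<in>S. orth D X W} = {X \<in> Ob (opc D). \<forall>W\<in>S. orth (opc D) W X}"
    using assms orth_opc by auto
  then show ?thesis using op.thick_right_orth[of S] assms by simp
qed

text \<open>Right and left orthogonals are thick, so orthogonality spreads from generators to the
  generated subcategories, first in the second variable and then in the first.\<close>

lemma gen_orth:
  assumes "S \<subseteq> Ob D" "T \<subseteq> Ob D" "\<And>X Y. \<lbrakk>X \<in> S; Y \<in> T\<rbrakk> \<Longrightarrow> orth D X Y"
    and "X \<in> gen D S" "Y \<in> gen D T"
  shows "orth D X Y"
proof -
  have "T \<subseteq> {Y \<in> Ob D. \<forall>W\<in>S. orth D W Y}" using assms by auto
  then have "gen D T \<subseteq> {Y \<in> Ob D. \<forall>W\<in>S. orth D W Y}"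
    using gen_least thick_right_orth[OF assms(1)] by blast
  then have "S \<subseteq> {X \<in> Ob D. \<forall>W\<in>gen D T. orth D X W}" using assms(1) by auto
  moreover have "gen D T \<subseteq> Ob D" using gen_Ob[OF assms(2)] by blast
  ultimately have "gen D S \<subseteq> {X \<in> Ob D. \<forall>W\<in>gen D T. orth D X W}"
    using gen_least thick_left_orth by blast
  then show ?thesis using assms by auto
qed

text \<open>Orthogonality spreads from the generators to X itself, so the identity of X
  vanishes.\<close>

lemma zero_if_orth_gen:
  assumes "S \<subseteq> Ob D" "X \<in> gen D S" "\<And>W. W \<in> S \<Longrightarrow> orth D W X"
  shows "zero_object D X"
proof -
  have X: "X \<in> Ob D" using assms gen_Ob by blast
  have "orth D X X"
    using gen_orth[of S "{X}" X X] assms X gen_superset[of "{X}"] by blast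
  then show ?thesis using zero_objectI X orth_Hom by blast
qed

lemma right_perp_thick:
  assumes B: "thick_subcategory D B"
  shows "right_perp D B = {X \<in> Ob D. \<forall>W\<in>B. orth D W X}"
  unfolding right_perp_def orth_def using thick_sh[OF B] sh_0 thick_Ob[OF B] by (metis (lifting))

lemma right_perp_gen:
  assumes "S \<subseteq> Ob D"
  shows "right_perp D (gen D S) = {X \<in> Ob D. \<forall>W\<in>S. orth D W X}"
proof -
  have "orth D W X" if "\<forall>W\<in>S. orth D W X" "X \<in> Ob D" "W \<in> gen D S" for W X
    using gen_orth[of S "{X}" W X] that assms gen_superset[of "{X}"] by auto
  then show ?thesis using right_perp_thick[OF thick_gen[OF assms]] gen_superset[of S] by auto
qed

section \<open>Finite direct sums\<close>

lemma direct_sum_arr: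
  assumes "direct_sum D I A P \<iota> \<pi>" "i \<in> I"
  shows "arr D (A i) P (\<iota> i)" "arr D P (A i) (\<pi> i)" "A i \<in> Ob D" "P \<in> Ob D"
  using assms by (auto simp: direct_sum_def arr_def)

lemma direct_sum_eq:
  assumes "direct_sum D I A P \<iota> \<pi>" "i \<in> I" "j \<in> I"
  shows "\<pi> i \<cdot> \<iota> j = (if i = j then Id D (A i) else 0)"
  using assms by (auto simp: direct_sum_def)

lemma direct_sum_decomp:
  assumes "direct_sum D I A P \<iota> \<pi>" "arr D W P f"
  shows "f = (\<Sum>i\<in>I. \<iota> i \<cdot> (\<pi> i \<cdot> f))"
proof -
  note a = direct_sum_arr[OF assms(1)]
  have "f = (\<Sum>i\<in>I. \<iota> i \<cdot> \<pi> i) \<cdot> f"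
    using assms comp_Id_left[OF assms(2)] by (simp add: direct_sum_def)
  also have "\<dots> = (\<Sum>i\<in>I. (\<iota> i \<cdot> \<pi> i) \<cdot> f)"
    by (rule comp_sum_left[OF assms(2)], rule arr_Ob[OF assms(2)], rule arr_cmp[OF a(2,1)])
  also have "\<dots> = (\<Sum>i\<in>I. \<iota> i \<cdot> (\<pi> i \<cdot> f))"
    by (rule sum.cong[OF refl], rule comp_assoc[OF assms(2) a(2,1)])
  finally show ?thesis .
qed

lemma direct_sum_decomp':
  assumes "direct_sum D I A P \<iota> \<pi>" "arr D P W f"
  shows "f = (\<Sum>i\<in>I. (f \<cdot> \<iota> i) \<cdot> \<pi> i)"
proof -
  interpret op: pretriangulated_category "opc D" by (rule pretriangulated_opc)
  show ?thesis using op.direct_sum_decomp[of I A P \<pi> \<iota> W f] assms by simp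
qed

text \<open>Direct sums are given over initial segments of the natural numbers; an enumeration of
  \<open>I\<close> transports them to \<open>I\<close>.\<close>

lemma direct_sum_exists:
  assumes "finite I" "\<And>i. i \<in> I \<Longrightarrow> A i \<in> Ob D"
  obtains P \<iota> \<pi> where "direct_sum D I A P \<iota> \<pi>"
proof -
  obtain e where e: "bij_betw e I {..<card I}"
    using ex_bij_betw_finite_nat[OF assms(1)] by (auto simp: atLeast0LessThan)
  define d where "d = inv_into I e"
  have d: "bij_betw d {..<card I} I" unfolding d_def using e by (rule bij_betw_inv_into)
  have de: "d (e i) = i" "e i < card I" if "i \<in> I" for i
    using that e bij_betw_inv_into_left[OF e] by (auto simp: d_def bij_betw_def)
  obtain P \<iota> \<pi> where P: "direct_sum D {..<card I} (\<lambda>k. A (d k)) P \<iota> \<pi>"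
    using direct_sums[of "card I" "\<lambda>k. A (d k)"] assms(2) bij_betwE[OF d] by blast
  have "(\<Sum>i\<in>I. \<iota> (e i) \<cdot> \<pi> (e i)) = (\<Sum>k<card I. \<iota> k \<cdot> \<pi> k)"
    using sum.reindex_bij_betw[OF e, of "\<lambda>k. \<iota> k \<cdot> \<pi> k"] by simp
  moreover have "e i = e j \<longleftrightarrow> i = j" if "i \<in> I" "j \<in> I" for i j
    using that de by metis
  moreover have "arr D (A i) P (\<iota> (e i)) \<and> arr D P (A i) (\<pi> (e i))" if "i \<in> I" for i
    using direct_sum_arr[OF P, of "e i"] de[OF that] by simp
  ultimately have "direct_sum D I A P (\<iota> \<circ> e) (\<pi> \<circ> e)"
    using P assms de unfolding direct_sum_def by (auto simp: de arr_def)
  then show thesis using that by blast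
qed

text \<open>Induction on the number of summands: the triangle on one inclusion exhibits the sum as
  an extension of the rest by that summand.\<close>

lemma direct_sum_in_thick:
  assumes B: "thick_subcategory D B"
  shows "\<lbrakk>direct_sum D I A P \<iota> \<pi>; \<And>i. i \<in> I \<Longrightarrow> A i \<in> B\<rbrakk> \<Longrightarrow> P \<in> B"
proof (induction "card I" arbitrary: I P \<iota> \<pi>)
  case 0
  then have "I = {}" by (auto simp: direct_sum_def)
  then have "zero_object D P" using 0 by (auto simp: direct_sum_def zero_object_iff)
  then show ?case using thick_zero[OF B] by blast
next
  case (Suc n)
  then obtain j where j: "j \<in> I" by fastforce
  have fin: "finite I" using Suc by (auto simp: direct_sum_def)
  note a = direct_sum_arr[OF Suc.prems(1)]
  note eq = direct_sum_eq[OF Suc.prems(1)]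
  obtain Z s g h where T: "dist D (A j) P Z (\<iota> j) g h" and s: "arr D Z P s" "g \<cdot> s = Id D Z"
    "\<pi> j \<cdot> s = 0" "\<iota> j \<cdot> \<pi> j + s \<cdot> g = Id D P"
    using complement[OF a(1,2)[OF j]] eq[OF j j] by (metis (full_types))
  note A = dist_arr[OF T]
  \<comment> \<open>The third vertex is the sum of the remaining objects, since \<open>s\<close> and
    \<open>g\<close> identify it with the kernel of \<open>\<pi> j\<close>.\<close>
  have "direct_sum D (I - {j}) A Z (\<lambda>i. g \<cdot> \<iota> i) (\<lambda>i. \<pi> i \<cdot> s)"
    unfolding direct_sum_def
  proof (intro conjI ballI)
    show "finite (I - {j})" "Z \<in> Ob D" using fin A by auto
    fix i assume i: "i \<in> I - {j}"
    show "A i \<in> Ob D" "g \<cdot> \<iota> i \<in> Hom D (A i) Z" "\<pi> i \<cdot> s \<in> Hom D Z (A i)"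
      using a[of i] i s A arr_cmp by (auto simp: arr_def)
    fix k assume k: "k \<in> I - {j}"
    have ik: "arr D (A k) P (\<iota> k)" "arr D P (A i) (\<pi> i)" using a i k by auto
    have jk: "\<pi> j \<cdot> \<iota> k = 0" "\<pi> i \<cdot> \<iota> j = 0" using eq j i k by auto
    have sg: "s \<cdot> g = Id D P - \<iota> j \<cdot> \<pi> j" using s(4) by (metis add_diff_cancel_left')
    have jj: "arr D P P (\<iota> j \<cdot> \<pi> j)" using a[OF j] by auto
    have "(\<pi> i \<cdot> s) \<cdot> (g \<cdot> \<iota> k) = \<pi> i \<cdot> ((s \<cdot> g) \<cdot> \<iota> k)"
      using comp_assoc[OF arr_cmp[OF ik(1) A(2)] s(1) ik(2)] comp_assoc[OF ik(1) A(2) s(1)] by simp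
    also have "(s \<cdot> g) \<cdot> \<iota> k = \<iota> k"
      using comp_diff_left[OF ik(1) arr_Id jj] a[OF j] comp_assoc[OF ik(1) a(2)[OF j] a(1)[OF j]] jk
        comp_0_right[OF a(1)[OF j]] comp_Id_left[OF ik(1)] arr_Ob[OF ik(1)] by (simp add: sg)
    finally show "(\<pi> i \<cdot> s) \<cdot> (g \<cdot> \<iota> k) = (if i = k then Id D (A i) else 0)"
      using eq i k by auto
  next
    have gi: "arr D (A i) Z (g \<cdot> \<iota> i)" "arr D Z (A i) (\<pi> i \<cdot> s)" if "i \<in> I" for i
      using a[OF that] A s by auto
    have "Id D Z = (g \<cdot> Id D P) \<cdot> s" using s comp_Id_right[OF A(2)] by simp
    also have "g \<cdot> Id D P = (\<Sum>i\<in>I. (g \<cdot> \<iota> i) \<cdot> \<pi> i)"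
      using direct_sum_decomp'[OF Suc.prems(1) A(2)] comp_Id_right[OF A(2)] by simp
    also have "\<dots> \<cdot> s = (\<Sum>i\<in>I. ((g \<cdot> \<iota> i) \<cdot> \<pi> i) \<cdot> s)"
      by (rule comp_sum_left[OF s(1)], rule A, rule arr_cmp[OF a(2) gi(1)])
    also have "\<dots> = (\<Sum>i\<in>I. (g \<cdot> \<iota> i) \<cdot> (\<pi> i \<cdot> s))"
      by (rule sum.cong[OF refl], rule comp_assoc[OF s(1) a(2) gi(1)])
    also have "\<dots> = (\<Sum>i\<in>I - {j}. (g \<cdot> \<iota> i) \<cdot> (\<pi> i \<cdot> s))"
      using s(3) comp_0_right[OF gi(1)[OF j]] A by (simp add: sum.remove[OF fin j])
    finally show "(\<Sum>i\<in>I - {j}. (g \<cdot> \<iota> i) \<cdot> (\<pi> i \<cdot> s)) = Id D Z" by simp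
  qed
  moreover have "n = card (I - {j})" using Suc.hyps(2) j by simp
  ultimately have "Z \<in> B" using Suc.hyps(1) Suc.prems(2) by blast
  then show ?case using thick_extension[OF B T] Suc.prems(2) j by blast
qed

end

text \<open>Together with \<open>finite_dim_Homs\<close> this makes the total Hom-space from X to Y
  finite-dimensional.\<close>

definition fin_hom :: "('o, 'm::ab_group_add, 'k::field) tri_cat \<Rightarrow> 'o \<Rightarrow> 'o \<Rightarrow> bool" where
  "fin_hom D X Y \<longleftrightarrow> finite {l. Hom D (sh D l X) Y \<noteq> {0}}"

text \<open>\<open>rap\<close>: right approximation, a universal map from \<open>B\<close> to \<open>X\<close>; \<open>lap\<close> is its dual.\<close>

definition rap :: "('o, 'm::ab_group_add, 'k::field) tri_cat \<Rightarrow> 'o set \<Rightarrow> 'o \<Rightarrow> 'o \<Rightarrow> 'm \<Rightarrow> bool" where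
  "rap D B X b u \<longleftrightarrow> b \<in> B \<and> arr D b X u \<and> (\<forall>W\<in>B. rbij D W b X u)"

abbreviation lap :: "('o, 'm::ab_group_add, 'k::field) tri_cat \<Rightarrow> 'o set \<Rightarrow> 'o \<Rightarrow> 'o \<Rightarrow> 'm \<Rightarrow> bool" where
  "lap D \<equiv> rap (opc D)"

text \<open>\<open>crep D F\<^sub>o F\<^sub>m X W \<xi> Y\<close> says that the Yoneda map $Hom(W,Y) \to Hom(X,FY)$
  of \<open>\<xi>\<close> is bijective.\<close>

definition crep :: "('o, 'm::ab_group_add, 'k::field) tri_cat \<Rightarrow> ('o \<Rightarrow> 'o) \<Rightarrow> ('m \<Rightarrow> 'm) \<Rightarrow>
    'o \<Rightarrow> 'o \<Rightarrow> 'm \<Rightarrow> 'o \<Rightarrow> bool" where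
  "crep D F\<^sub>o F\<^sub>m X W \<xi> Y \<longleftrightarrow> (\<forall>f. arr D W Y f \<longrightarrow> F\<^sub>m f \<cdot>\<^bsub>D\<^esub> \<xi> = 0 \<longrightarrow> f = 0) \<and>
     (\<forall>s. arr D X (F\<^sub>o Y) s \<longrightarrow> (\<exists>f. arr D W Y f \<and> F\<^sub>m f \<cdot>\<^bsub>D\<^esub> \<xi> = s))"

text \<open>Exactness of Hom(W,F-) at the middle of a triangle. It is stated for this functor rather
  than for F, so that F can be the identity or a right adjoint for which no commutation with shifts
  has been chosen.\<close>

definition hom_exact :: "('o, 'm::ab_group_add, 'k::field) tri_cat \<Rightarrow> ('o \<Rightarrow> 'o) \<Rightarrow> ('m \<Rightarrow> 'm) \<Rightarrow>
    'o \<Rightarrow> bool" where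
  "hom_exact D F\<^sub>o F\<^sub>m W \<longleftrightarrow> (\<forall>X Y Z f g h s. dist D X Y Z f g h \<longrightarrow> arr D W (F\<^sub>o Y) s \<longrightarrow>
     F\<^sub>m g \<cdot>\<^bsub>D\<^esub> s = 0 \<longrightarrow> (\<exists>t. arr D W (F\<^sub>o X) t \<and> F\<^sub>m f \<cdot>\<^bsub>D\<^esub> t = s))"

lemma crepD0: "\<lbrakk>crep D F\<^sub>o F\<^sub>m X W \<xi> Y; arr D W Y f; F\<^sub>m f \<cdot>\<^bsub>D\<^esub> \<xi> = 0\<rbrakk> \<Longrightarrow> f = 0"
  by (auto simp: crep_def)

lemma crepE:
  assumes "crep D F\<^sub>o F\<^sub>m X W \<xi> Y" "arr D X (F\<^sub>o Y) s"
  obtains f where "arr D W Y f" "F\<^sub>m f \<cdot>\<^bsub>D\<^esub> \<xi> = s"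
  using assms by (auto simp: crep_def)

lemma hom_exactE:
  assumes "hom_exact D F\<^sub>o F\<^sub>m W" "dist D X Y Z f g h" "arr D W (F\<^sub>o Y) s" "F\<^sub>m g \<cdot>\<^bsub>D\<^esub> s = 0"
  obtains t where "arr D W (F\<^sub>o X) t" "F\<^sub>m f \<cdot>\<^bsub>D\<^esub> t = s"
  using assms unfolding hom_exact_def by blast

lemma crep_id: "crep D (\<lambda>X. X) (\<lambda>f. f) X W \<xi> Y \<longleftrightarrow> lbij D Y X W \<xi>"
  by (simp add: crep_def rbij_def)

context klinear_category
begin

lemma linear_functor_id: "linear_functor D (\<lambda>X. X) (\<lambda>f. f)"
  by (simp add: linear_functor_def)

lemma functor_Ob: "\<lbrakk>linear_functor D F\<^sub>o F\<^sub>m; X \<in> Ob D\<rbrakk> \<Longrightarrow> F\<^sub>o X \<in> Ob D"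
  by (simp add: linear_functor_def)

lemma functor_Id: "\<lbrakk>linear_functor D F\<^sub>o F\<^sub>m; X \<in> Ob D\<rbrakk> \<Longrightarrow> F\<^sub>m (Id D X) = Id D (F\<^sub>o X)"
  by (simp add: linear_functor_def)

lemma functor_arr: "\<lbrakk>linear_functor D F\<^sub>o F\<^sub>m; arr D X Y f\<rbrakk> \<Longrightarrow> arr D (F\<^sub>o X) (F\<^sub>o Y) (F\<^sub>m f)"
  unfolding linear_functor_def arr_def by blast

lemma functor_add:
  "\<lbrakk>linear_functor D F\<^sub>o F\<^sub>m; arr D X Y f; arr D X Y g\<rbrakk> \<Longrightarrow> F\<^sub>m (f + g) = F\<^sub>m f + F\<^sub>m g"
  unfolding linear_functor_def arr_def by blast

lemma functor_scl:
  "\<lbrakk>linear_functor D F\<^sub>o F\<^sub>m; arr D X Y f\<rbrakk> \<Longrightarrow> F\<^sub>m (scl D c f) = scl D c (F\<^sub>m f)"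
  unfolding linear_functor_def arr_def by blast

lemma functor_comp:
  "\<lbrakk>linear_functor D F\<^sub>o F\<^sub>m; arr D X Y f; arr D Y Z g\<rbrakk> \<Longrightarrow> F\<^sub>m (g \<cdot> f) = F\<^sub>m g \<cdot> F\<^sub>m f"
  unfolding linear_functor_def arr_def by blast

lemma functor_0: "\<lbrakk>linear_functor D F\<^sub>o F\<^sub>m; X \<in> Ob D\<rbrakk> \<Longrightarrow> F\<^sub>m 0 = 0"
  using functor_scl[of F\<^sub>o F\<^sub>m X X 0 0] by auto

lemma functor_diff:
  assumes F: "linear_functor D F\<^sub>o F\<^sub>m" and f: "arr D X Y f" "arr D X Y g"
  shows "F\<^sub>m (f - g) = F\<^sub>m f - F\<^sub>m g"
  using functor_add[OF F arr_diff[OF f] f(2)] by (simp add: algebra_simps)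

end

context pretriangulated_category
begin

lemma hom_exact_id: "hom_exact D (\<lambda>X. X) (\<lambda>f. f) W"
  unfolding hom_exact_def using lift_first by metis

text \<open>Rotating three times shifts a triangle by one at the price of signs. The maps stay
  existential because later uses depend on the three objects only.\<close>

lemma dist_shift:
  assumes "dist D X Y Z f g h"
  shows "\<exists>f g h. dist D (sh D l X) (sh D l Y) (sh D l Z) f g h"
proof -
  note Ob = dist_arr(4-6)[OF assms]
  show ?thesis
  proof (induction l rule: int_induct[where k = 0])
    case base
    then show ?case using assms Ob by (auto simp: sh_0)
  next
    case (step1 i)
    then obtain f g h where "dist D (sh D i X) (sh D i Y) (sh D i Z) f g h" by blast
    from rotate[OF rotate[OF rotate[OF this]]] show ?case using Ob by (simp add: sh_sh add.commute) blast
  next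
    case (step2 i)
    then obtain f g h where "dist D (sh D i X) (sh D i Y) (sh D i Z) f g h" by blast
    from rotate_back[OF rotate_back[OF rotate_back[OF this]]] show ?case using Ob by (simp add: sh_sh) blast
  qed
qed

lemma thick_fin_right:
  assumes W: "W \<in> Ob D" shows "thick_subcategory D {Y \<in> Ob D. fin_hom D W Y}"
  (is "thick_subcategory D ?T")
proof (rule thickI)
  fix Z assume "zero_object D Z"
  then show "Z \<in> ?T"
    using W sh_in_Ob by (auto simp: fin_hom_def zero_object_def)
next
  fix Y l assume Y: "Y \<in> ?T"
  then have "finite ((\<lambda>m. m + l) ` {m. Hom D (sh D m W) Y \<noteq> {0}})" by (auto simp: fin_hom_def)
  moreover have "{m. Hom D (sh D m W) (sh D l Y) \<noteq> {0}} \<subseteq> (\<lambda>m. m + l) ` {m. Hom D (sh D m W) Y \<noteq> {0}}"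
    using Hom_shift_zero[OF W, of Y _ l] Y by (auto intro!: image_eqI[of _ _ "_ - l"])
  ultimately have "finite {m. Hom D (sh D m W) (sh D l Y) \<noteq> {0}}" by (rule finite_subset[rotated])
  then show "sh D l Y \<in> ?T"
    using Y sh_in_Ob by (simp add: fin_hom_def)
next
  fix X Y Z f g h
  assume T: "dist D X Y Z f g h" and XZ: "X \<in> ?T" "Z \<in> ?T"
  have "{m. Hom D (sh D m W) Y \<noteq> {0}} \<subseteq>
      {m. Hom D (sh D m W) X \<noteq> {0}} \<union> {m. Hom D (sh D m W) Z \<noteq> {0}}"
    using Hom_zero_middle[OF T sh_in_Ob[OF W]] by auto
  then show "Y \<in> ?T"
    using XZ dist_arr(5)[OF T] unfolding fin_hom_def by (auto intro: finite_subset)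
next
  fix X Y i p
  assume ip: "arr D Y X i" "arr D X Y p" "p \<cdot> i = Id D Y" and X: "X \<in> ?T"
  have "Hom D (sh D m W) Y = {0}" if *: "Hom D (sh D m W) X = {0}" for m
  proof -
    have "f = 0" if f: "arr D (sh D m W) Y f" for f
    proof -
      have "i \<cdot> f = 0" using Hom_zeroD[OF * arr_cmp[OF f ip(1)]] .
      then show ?thesis using comp_assoc[OF f ip(1,2)] ip(3) comp_Id_left[OF f]
          comp_0_right[OF ip(2)] arr_Ob[OF f] by simp
    qed
    then show ?thesis using Hom_zero_iff sh_in_Ob W arr_Ob[OF ip(1)] by blast
  qed
  then have "{m. Hom D (sh D m W) Y \<noteq> {0}} \<subseteq> {m. Hom D (sh D m W) X \<noteq> {0}}" by auto
  then show "Y \<in> ?T"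
    using X arr_Ob[OF ip(1)] finite_subset by (auto simp: fin_hom_def)
qed auto

lemma fin_hom_iff_target:
  assumes "X \<in> Ob D" "Y \<in> Ob D"
  shows "fin_hom D X Y \<longleftrightarrow> finite {l. Hom D X (sh D l Y) \<noteq> {0}}"
proof -
  have "Hom D (sh D l X) Y = {0} \<longleftrightarrow> Hom D X (sh D (- l) Y) = {0}" for l
    using Hom_shift_zero[OF assms, of 0 "- l"] assms by (simp add: sh_0)
  then have "{l. Hom D X (sh D l Y) \<noteq> {0}} = uminus ` {l. Hom D (sh D l X) Y \<noteq> {0}}"
    by (force intro: image_eqI[of _ _ "- _"])
  then show ?thesis by (simp add: fin_hom_def finite_image_iff)
qed

lemma fin_hom_opc: "\<lbrakk>X \<in> Ob D; Y \<in> Ob D\<rbrakk> \<Longrightarrow> fin_hom (opc D) X Y \<longleftrightarrow> fin_hom D Y X"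
proof -
  assume "X \<in> Ob D" "Y \<in> Ob D"
  then have "Hom D Y (sh D (- l) X) = {0} \<longleftrightarrow> Hom D (sh D l Y) X = {0}" for l
    using Hom_shift_zero[of Y X 0 "- l"] by (simp add: sh_0)
  then show ?thesis by (simp add: fin_hom_def)
qed

section \<open>Exceptional objects\<close>

lemma exceptional_iff:
  "exceptional D E \<longleftrightarrow> E \<in> Ob D \<and> Id D E \<noteq> 0 \<and> (\<forall>f. arr D E E f \<longrightarrow> (\<exists>c. f = scl D c (Id D E))) \<and>
     (\<forall>l f. l \<noteq> 0 \<longrightarrow> arr D E (sh D l E) f \<longrightarrow> f = 0)"
proof (cases "E \<in> Ob D")
  case E: True
  have "bij_betw (\<lambda>c. scl D c (Id D E)) UNIV (Hom D E E) \<longleftrightarrow>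
      Id D E \<noteq> 0 \<and> (\<forall>f. arr D E E f \<longrightarrow> (\<exists>c. f = scl D c (Id D E)))"
  proof
    assume b: "bij_betw (\<lambda>c. scl D c (Id D E)) UNIV (Hom D E E)"
    have "Id D E \<noteq> 0"
    proof
      assume "Id D E = 0"
      then have "scl D 0 (Id D E) = scl D 1 (Id D E)" by simp
      then show False using b by (metis UNIV_I bij_betw_def inj_on_def zero_neq_one)
    qed
    then show "Id D E \<noteq> 0 \<and> (\<forall>f. arr D E E f \<longrightarrow> (\<exists>c. f = scl D c (Id D E)))"
      using b by (auto simp: arr_def bij_betw_def)
  next
    assume *: "Id D E \<noteq> 0 \<and> (\<forall>f. arr D E E f \<longrightarrow> (\<exists>c. f = scl D c (Id D E)))"
    have "inj (\<lambda>c. scl D c (Id D E))" using * by (auto intro!: injI)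
    moreover have "scl D c (Id D E) \<in> Hom D E E" for c
      using arr_scl[OF arr_Id[OF E]] by (simp add: arr_def)
    ultimately show "bij_betw (\<lambda>c. scl D c (Id D E)) UNIV (Hom D E E)"
      using * E by (auto simp: bij_betw_def arr_def)
  qed
  then show ?thesis using E Hom_zero_iff[OF E sh_in_Ob[OF E]] by (auto simp: exceptional_def)
qed (simp add: exceptional_def)

lemma exceptional_arr_neq:
  assumes E: "exceptional D E" and f: "arr D (sh D l E) (sh D m E) f" and "l \<noteq> m"
  shows "f = 0"
proof -
  have E': "E \<in> Ob D" using E by (simp add: exceptional_iff)
  then have "arr D E (sh D (m - l) E) (shm D (- l) f)"
    using arr_shm[OF f, of "- l"] by (simp add: sh_sh sh_0)
  moreover have "m - l \<noteq> 0" using \<open>l \<noteq> m\<close> by simp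
  ultimately have "shm D (- l) f = 0" using E unfolding exceptional_iff by blast
  then show ?thesis using shm_eq_0_iff[OF f] by simp
qed

lemma exceptional_arr_eq:
  assumes E: "exceptional D E" and f: "arr D (sh D l E) (sh D l E) f"
  obtains c where "f = scl D c (Id D (sh D l E))"
proof -
  have E': "E \<in> Ob D" using E by (simp add: exceptional_iff)
  then have "arr D E E (shm D (- l) f)" using arr_unshift[OF _ _ f] by simp
  then obtain c where "shm D (- l) f = scl D c (Id D E)" using E by (auto simp: exceptional_iff)
  then have "shm D l (shm D (- l) f) = scl D c (Id D (sh D l E))"
    using shm_scale[OF arr_Id[OF E']] shm_Id[OF E'] by simp
  then have "f = scl D c (Id D (sh D l E))" using shm_inverse(1)[OF f] by simp
  then show thesis by (rule that)
qed

lemma exceptional_opc [simp]: "exceptional (opc D) E \<longleftrightarrow> exceptional D E"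
proof (cases "E \<in> Ob D")
  case True
  have "(\<forall>l. l \<noteq> 0 \<longrightarrow> Hom D (sh D (- l) E) E = {0}) \<longleftrightarrow> (\<forall>l. l \<noteq> 0 \<longrightarrow> Hom D E (sh D l E) = {0})"
    using Hom_shift_zero[OF True True, of 0] True by (simp add: sh_0)
  then show ?thesis by (simp add: exceptional_def)
qed (simp add: exceptional_def)

text \<open>Bases of all the spaces \<open>V m\<close> at once, the index \<open>i\<close> having
  degree \<open>d i\<close>. A family over \<open>I\<close>, rather than a set of vectors, can be
  replaced by its shifts degree by degree, as \<open>evaluation_rap\<close> does.\<close>

definition basis_family :: "'i set \<Rightarrow> ('i \<Rightarrow> int) \<Rightarrow> ('i \<Rightarrow> 'b) \<Rightarrow> (int \<Rightarrow> 'b set) \<Rightarrow> bool" where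
  "basis_family I d c V \<longleftrightarrow> (\<forall>m.
     (\<forall>a. (\<Sum>i | i \<in> I \<and> d i = m. scl D (a i) (c i)) = 0 \<longrightarrow> (\<forall>i\<in>I. d i = m \<longrightarrow> a i = 0)) \<and>
     (\<forall>s\<in>V m. \<exists>a. s = (\<Sum>i | i \<in> I \<and> d i = m. scl D (a i) (c i))))"

lemma basis_family_Sigma:
  assumes B: "\<And>l. is_basis D (V l) (B l)" and fin: "finite (SIGMA l:UNIV. B l)"
  shows "basis_family (SIGMA l:UNIV. B l) fst snd V"
  unfolding basis_family_def
proof (rule allI, rule conjI)
  fix m
  have finB: "finite (B m)"
    using finite_subset[OF _ finite_imageI[OF fin, of snd], of "B m"] by force
  have sum_eq: "(\<Sum>i | i \<in> (SIGMA l:UNIV. B l) \<and> fst i = m. scl D (a i) (snd i)) =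
      (\<Sum>b\<in>B m. scl D (a (m, b)) b)" for a
    by (intro sum.reindex_bij_witness[of _ "\<lambda>b. (m, b)" snd]) auto
  show "\<forall>a. (\<Sum>i | i \<in> (SIGMA l:UNIV. B l) \<and> fst i = m. scl D (a i) (snd i)) = 0 \<longrightarrow>
      (\<forall>i\<in>SIGMA l:UNIV. B l. fst i = m \<longrightarrow> a i = 0)"
  proof (intro allI impI ballI)
    fix a i assume "(\<Sum>i | i \<in> (SIGMA l:UNIV. B l) \<and> fst i = m. scl D (a i) (snd i)) = 0"
      and i: "i \<in> (SIGMA l:UNIV. B l)" "fst i = m"
    then have "(\<Sum>b\<in>B m. scl D (a (m, b)) b) = 0" using sum_eq by simp
    then have "a (m, snd i) = 0"
      using vs.independentD[of "B m" "B m" "\<lambda>b. a (m, b)" "snd i"] B[of m] finB i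
      by (auto simp: is_basis_def)
    then show "a i = 0" using i by (metis prod.collapse)
  qed
  show "\<forall>s\<in>V m. \<exists>a. s = (\<Sum>i | i \<in> (SIGMA l:UNIV. B l) \<and> fst i = m. scl D (a i) (snd i))"
  proof
    fix s assume "s \<in> V m"
    then have "s \<in> range (\<lambda>u. \<Sum>b\<in>B m. scl D (u b) b)"
      using B[of m] vs.span_finite[OF finB] by (simp add: is_basis_def)
    then obtain u where "s = (\<Sum>b\<in>B m. scl D (u b) b)" by blast
    then have "s = (\<Sum>b\<in>B m. scl D ((u \<circ> snd) (m, b)) b)" by simp
    then show "\<exists>a. s = (\<Sum>i | i \<in> (SIGMA l:UNIV. B l) \<and> fst i = m. scl D (a i) (snd i))"
      using sum_eq by metis
  qed
qed

text \<open>By exceptionality a map from the sum of the E[d i] to E[m] has scalar components where d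
  i = m and zero components elsewhere. Pairing it with \<open>\<xi>\<close> gives the combination of
  the degree m vectors \<open>c i\<close> with these scalars, so bijectivity in each degree is the
  basis property. Allowing a functor covers both the usual coevaluation (the identity) and
  Hom(X,R-).\<close>

lemma coevaluation:
  assumes F: "linear_functor D F\<^sub>o F\<^sub>m" and E: "exceptional D E"
    and P: "direct_sum D I (\<lambda>i. sh D (d i) E) P \<iota> \<pi>"
    and c: "\<And>i. i \<in> I \<Longrightarrow> arr D X (F\<^sub>o (sh D (d i) E)) (c i)" and X: "X \<in> Ob D"
    and basis: "basis_family I d c (\<lambda>m. Hom D X (F\<^sub>o (sh D m E)))"
  defines "\<xi> \<equiv> (\<Sum>i\<in>I. F\<^sub>m (\<iota> i) \<cdot> c i)"
  shows "arr D X (F\<^sub>o P) \<xi>" "crep D F\<^sub>o F\<^sub>m X P \<xi> (sh D m E)"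
proof -
  have E': "E \<in> Ob D" using E by (simp add: exceptional_iff)
  have fin: "finite I" and P': "P \<in> Ob D" using P by (auto simp: direct_sum_def)
  note a = direct_sum_arr[OF P]
  have ic: "arr D X (F\<^sub>o P) (F\<^sub>m (\<iota> i) \<cdot> c i)" if "i \<in> I" for i
    using c[OF that] functor_arr[OF F a(1)[OF that]] by (rule arr_cmp)
  then show \<xi>: "arr D X (F\<^sub>o P) \<xi>" unfolding \<xi>_def by (intro arr_sum X functor_Ob[OF F P'])
  have eval: "F\<^sub>m f \<cdot> \<xi> = (\<Sum>i | i \<in> I \<and> d i = m. scl D (k i) (c i))"
    if f: "arr D P (sh D m E) f"
      and k: "\<And>i. i \<in> I \<Longrightarrow> d i = m \<Longrightarrow> f \<cdot> \<iota> i = scl D (k i) (Id D (sh D m E))" for f k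
  proof -
    have "F\<^sub>m f \<cdot> \<xi> = (\<Sum>i\<in>I. F\<^sub>m f \<cdot> (F\<^sub>m (\<iota> i) \<cdot> c i))"
      unfolding \<xi>_def by (rule comp_sum_right[OF functor_arr[OF F f] X ic])
    also have "\<dots> = (\<Sum>i\<in>I. F\<^sub>m (f \<cdot> \<iota> i) \<cdot> c i)"
      using comp_assoc[OF c functor_arr[OF F a(1)] functor_arr[OF F f]] functor_comp[OF F a(1) f]
      by (intro sum.cong) auto
    also have "\<dots> = (\<Sum>i\<in>I. if d i = m then scl D (k i) (c i) else 0)"
    proof (intro sum.cong refl)
      fix i assume i: "i \<in> I"
      show "F\<^sub>m (f \<cdot> \<iota> i) \<cdot> c i = (if d i = m then scl D (k i) (c i) else 0)"
      proof (cases "d i = m")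
        case True
        have I: "arr D (sh D m E) (sh D m E) (Id D (sh D m E))" using sh_in_Ob[OF E'] by (rule arr_Id)
        have ci: "arr D X (F\<^sub>o (sh D m E)) (c i)" using c[OF i] True by simp
        have "F\<^sub>m (f \<cdot> \<iota> i) = scl D (k i) (Id D (F\<^sub>o (sh D m E)))"
          using k[OF i True] functor_scl[OF F I] functor_Id[OF F sh_in_Ob[OF E']] by simp
        then show ?thesis
          using True comp_scl_left[OF ci arr_Id] arr_Ob(2)[OF ci] comp_Id_left[OF ci] by simp
      next
        case False
        then have "f \<cdot> \<iota> i = 0" using exceptional_arr_neq[OF E arr_cmp[OF a(1)[OF i] f]] by simp
        then show ?thesis
          using False functor_0[OF F X] comp_0_left[OF c[OF i] functor_Ob[OF F sh_in_Ob[OF E'], of m]] by simp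
      qed
    qed
    finally show ?thesis using fin by (simp add: sum.If_cases Int_def)
  qed
  show "crep D F\<^sub>o F\<^sub>m X P \<xi> (sh D m E)"
    unfolding crep_def
  proof (intro conjI allI impI)
    fix f assume f: "arr D P (sh D m E) f" and 0: "F\<^sub>m f \<cdot> \<xi> = 0"
    have "\<exists>k. f \<cdot> \<iota> i = scl D k (Id D (sh D m E))" if "i \<in> I" "d i = m" for i
      using exceptional_arr_eq[OF E] arr_cmp[OF a(1)[OF that(1)] f] that(2) by metis
    then obtain k where k: "\<And>i. i \<in> I \<Longrightarrow> d i = m \<Longrightarrow> f \<cdot> \<iota> i = scl D (k i) (Id D (sh D m E))"
      by metis
    have "\<forall>i\<in>I. d i = m \<longrightarrow> k i = 0" using eval[OF f k] 0 basis by (simp add: basis_family_def)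
    then have "f \<cdot> \<iota> i = 0" if "i \<in> I" for i
      using k[OF that] exceptional_arr_neq[OF E arr_cmp[OF a(1)[OF that] f]] that by fastforce
    then have "(f \<cdot> \<iota> i) \<cdot> \<pi> i = 0" if "i \<in> I" for i
      using that comp_0_left[OF a(2)[OF that] sh_in_Ob[OF E']] by simp
    then show "f = 0" using direct_sum_decomp'[OF P f] by simp
  next
    fix s assume "arr D X (F\<^sub>o (sh D m E)) s"
    then have "s \<in> Hom D X (F\<^sub>o (sh D m E))" by (simp add: arr_def)
    then obtain k where k: "s = (\<Sum>i | i \<in> I \<and> d i = m. scl D (k i) (c i))"
      using basis unfolding basis_family_def by blast
    define I' where "I' = {i. i \<in> I \<and> d i = m}"
    \<comment> \<open>The coordinates of \<open>s\<close>, assembled into a map by means of the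
      projections of degree \<open>m\<close>.\<close>
    define f where "f = (\<Sum>i\<in>I'. scl D (k i) (\<pi> i))"
    have \<pi>: "arr D P (sh D m E) (\<pi> i)" if "i \<in> I'" for i using a(2)[of i] that by (auto simp: I'_def)
    have f: "arr D P (sh D m E) f"
      unfolding f_def using \<pi> by (intro arr_sum P' sh_in_Ob[OF E']) auto
    have "f \<cdot> \<iota> j = scl D (k j) (Id D (sh D m E))" if j: "j \<in> I" "d j = m" for j
    proof -
      note \<iota>j = a(1)[OF j(1)]
      have "f \<cdot> \<iota> j = (\<Sum>i\<in>I'. scl D (k i) (\<pi> i) \<cdot> \<iota> j)"
        unfolding f_def using \<pi> by (intro comp_sum_left[OF \<iota>j sh_in_Ob[OF E']]) auto
      also have "\<dots> = (\<Sum>i\<in>I'. scl D (k i) (\<pi> i \<cdot> \<iota> j))"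
        using comp_scl_left[OF \<iota>j \<pi>] by simp
      also have "\<dots> = (\<Sum>i\<in>I'. if i = j then scl D (k j) (Id D (sh D m E)) else 0)"
        using direct_sum_eq[OF P _ j(1)] j(2) by (intro sum.cong) (auto simp: I'_def)
      also have "\<dots> = scl D (k j) (Id D (sh D m E))"
        using fin j by (simp add: I'_def)
      finally show ?thesis .
    qed
    then have "F\<^sub>m f \<cdot> \<xi> = s" using eval[OF f] k by simp
    then show "\<exists>f. arr D P (sh D m E) f \<and> F\<^sub>m f \<cdot> \<xi> = s" using f by blast
  qed
qed

text \<open>The five lemma for the Yoneda map from Hom(W,-) to Hom(X,F-), whose outer terms are Y1,
  Y3 and their neighbours Y1[1] and Y3[-1]. Exactness of the second functor is used on the triangle
  and on its backward rotation.\<close>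

lemma crep_extension:
  assumes F: "linear_functor D F\<^sub>o F\<^sub>m" and ex: "hom_exact D F\<^sub>o F\<^sub>m X" and \<xi>: "arr D X (F\<^sub>o W) \<xi>"
    and T: "dist D Y1 Y2 Y3 f g h"
    and c: "crep D F\<^sub>o F\<^sub>m X W \<xi> Y1" "crep D F\<^sub>o F\<^sub>m X W \<xi> (sh D 1 Y1)"
      "crep D F\<^sub>o F\<^sub>m X W \<xi> Y3" "crep D F\<^sub>o F\<^sub>m X W \<xi> (sh D (- 1) Y3)"
    and W: "W \<in> Ob D"
  shows "crep D F\<^sub>o F\<^sub>m X W \<xi> Y2"
  unfolding crep_def
proof (intro conjI allI impI)
  note A = dist_arr[OF T]
  have act: "F\<^sub>m (v \<cdot> u) \<cdot> \<xi> = F\<^sub>m v \<cdot> (F\<^sub>m u \<cdot> \<xi>)" if "arr D W Y u" "arr D Y Z v" for Y Z u v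
    using functor_comp[OF F that] comp_assoc[OF \<xi> functor_arr[OF F that(1)] functor_arr[OF F that(2)]]
    by simp
  fix y assume y: "arr D W Y2 y" "F\<^sub>m y \<cdot> \<xi> = 0"
  have "F\<^sub>m (g \<cdot> y) \<cdot> \<xi> = 0"
    using act[OF y(1) A(2)] y(2) comp_0_right[OF functor_arr[OF F A(2)]] arr_Ob[OF \<xi>] by simp
  then have "g \<cdot> y = 0" using crepD0[OF c(3) arr_cmp[OF y(1) A(2)]] by simp
  then obtain t where t: "arr D W Y1 t" "f \<cdot> t = y" using lift_first[OF T y(1)] by blast
  note T' = rotate_back[OF T]
  define k where "k = - shm D (- 1) h"
  have k: "arr D (sh D (- 1) Y3) Y1 k" unfolding k_def using dist_arr(1)[OF T'] .
  have "arr D X (F\<^sub>o Y1) (F\<^sub>m t \<cdot> \<xi>)" using arr_cmp[OF \<xi> functor_arr[OF F t(1)]] .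
  moreover have "F\<^sub>m f \<cdot> (F\<^sub>m t \<cdot> \<xi>) = 0" using act[OF t(1) A(1)] t(2) y(2) by simp
  ultimately obtain s where s: "arr D X (F\<^sub>o (sh D (- 1) Y3)) s" "F\<^sub>m k \<cdot> s = F\<^sub>m t \<cdot> \<xi>"
    unfolding k_def using hom_exactE[OF ex T'] by metis
  obtain z where z: "arr D W (sh D (- 1) Y3) z" "F\<^sub>m z \<cdot> \<xi> = s" using crepE[OF c(4) s(1)] .
  note kz = arr_cmp[OF z(1) k]
  have "F\<^sub>m (t - k \<cdot> z) \<cdot> \<xi> = 0"
    using functor_diff[OF F t(1) kz] act[OF z(1) k] z(2) s(2)
      comp_diff_left[OF \<xi> functor_arr[OF F t(1)] functor_arr[OF F kz]] by simp
  then have "t = k \<cdot> z" using crepD0[OF c(1) arr_diff[OF t(1) kz]] by simp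
  then have "y = (f \<cdot> k) \<cdot> z" using t(2) comp_assoc[OF z(1) k A(1)] by simp
  then show "y = 0" using dist_comp_zero[OF T'] comp_0_left[OF z(1)] A by (simp add: k_def)
next
  note A = dist_arr[OF T]
  have act: "F\<^sub>m (v \<cdot> u) \<cdot> \<xi> = F\<^sub>m v \<cdot> (F\<^sub>m u \<cdot> \<xi>)" if "arr D W Y u" "arr D Y Z v" for Y Z u v
    using functor_comp[OF F that] comp_assoc[OF \<xi> functor_arr[OF F that(1)] functor_arr[OF F that(2)]]
    by simp
  fix s assume s: "arr D X (F\<^sub>o Y2) s"
  obtain z where z: "arr D W Y3 z" "F\<^sub>m z \<cdot> \<xi> = F\<^sub>m g \<cdot> s"
    using crepE[OF c(3) arr_cmp[OF s functor_arr[OF F A(2)]]] .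
  have "F\<^sub>m (h \<cdot> z) \<cdot> \<xi> = F\<^sub>m (h \<cdot> g) \<cdot> s"
    using act[OF z(1) A(3)] z(2) functor_comp[OF F A(2,3)]
      comp_assoc[OF s functor_arr[OF F A(2)] functor_arr[OF F A(3)]] by simp
  also have "\<dots> = 0"
    using dist_comp_zero'(1)[OF T] functor_0[OF F W] comp_0_left[OF s] arr_Ob[OF functor_arr[OF F A(3)]]
    by simp
  finally have "h \<cdot> z = 0" using crepD0[OF c(2) arr_cmp[OF z(1) A(3)]] by simp
  then obtain y where y: "arr D W Y2 y" "g \<cdot> y = z" using lift_second[OF T z(1)] by blast
  note y\<xi> = arr_cmp[OF \<xi> functor_arr[OF F y(1)]]
  have "F\<^sub>m g \<cdot> (s - F\<^sub>m y \<cdot> \<xi>) = 0"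
    using comp_diff_right[OF s y\<xi> functor_arr[OF F A(2)]] act[OF y(1) A(2)] y(2) z(2) by simp
  then obtain t where t: "arr D X (F\<^sub>o Y1) t" "F\<^sub>m f \<cdot> t = s - F\<^sub>m y \<cdot> \<xi>"
    using hom_exactE[OF ex T arr_diff[OF s y\<xi>]] by blast
  obtain x where x: "arr D W Y1 x" "F\<^sub>m x \<cdot> \<xi> = t" using crepE[OF c(1) t(1)] .
  note fx = arr_cmp[OF x(1) A(1)]
  have "F\<^sub>m (y + f \<cdot> x) \<cdot> \<xi> = F\<^sub>m y \<cdot> \<xi> + F\<^sub>m (f \<cdot> x) \<cdot> \<xi>"
    using functor_add[OF F y(1) fx] comp_add_left[OF \<xi> functor_arr[OF F y(1)] functor_arr[OF F fx]]
    by simp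
  also have "\<dots> = s" using act[OF x(1) A(1)] x(2) t(2) by simp
  finally show "\<exists>y. arr D W Y2 y \<and> F\<^sub>m y \<cdot> \<xi> = s" using arr_add[OF y(1) fx] by blast
qed

text \<open>All shifts are demanded because \<open>crep_extension\<close> consults the neighbouring
  degrees.\<close>

lemma thick_crep:
  assumes F: "linear_functor D F\<^sub>o F\<^sub>m" and ex: "hom_exact D F\<^sub>o F\<^sub>m X" and \<xi>: "arr D X (F\<^sub>o W) \<xi>"
    and W: "W \<in> Ob D"
  shows "thick_subcategory D {Y \<in> Ob D. \<forall>l. crep D F\<^sub>o F\<^sub>m X W \<xi> (sh D l Y)}"
  (is "thick_subcategory D ?T")
proof -
  have act: "F\<^sub>m (v \<cdot> u) \<cdot> \<xi> = F\<^sub>m v \<cdot> (F\<^sub>m u \<cdot> \<xi>)" if "arr D W Y u" "arr D Y Z v" for Y Z u v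
    using functor_comp[OF F that] comp_assoc[OF \<xi> functor_arr[OF F that(1)] functor_arr[OF F that(2)]]
    by simp
  show ?thesis
  proof (rule thickI)
    fix Z assume Z: "zero_object D Z"
    have "crep D F\<^sub>o F\<^sub>m X W \<xi> (sh D l Z)" for l
    proof -
      have lZ: "zero_object D (sh D l Z)" using zero_object_sh[OF Z] .
      then have FZ: "zero_object D (F\<^sub>o (sh D l Z))"
        using functor_Id[OF F] functor_0[OF F] functor_Ob[OF F] by (metis zero_object_iff)
      have "arr D W (sh D l Z) 0" using W lZ by (auto simp: zero_object_iff)
      moreover have "F\<^sub>m 0 \<cdot> \<xi> = 0"
        using functor_0[OF F W] comp_0_left[OF \<xi> arr_Ob(1)[OF \<xi>]] by simp
      ultimately show ?thesis unfolding crep_def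
        using zero_object_arr(1)[OF lZ] zero_object_arr(1)[OF FZ] by metis
    qed
    then show "Z \<in> ?T"
      using Z by (simp add: zero_object_iff)
  next
    fix Y l assume "Y \<in> ?T"
    then show "sh D l Y \<in> ?T"
      by (simp add: sh_sh sh_in_Ob)
  next
    fix Y1 Y2 Y3 f g h
    assume T: "dist D Y1 Y2 Y3 f g h"
      and Y: "Y1 \<in> ?T"
        "Y3 \<in> ?T"
    have "crep D F\<^sub>o F\<^sub>m X W \<xi> (sh D l Y2)" for l
    proof -
      obtain f g h where T': "dist D (sh D l Y1) (sh D l Y2) (sh D l Y3) f g h"
        using dist_shift[OF T] by blast
      show ?thesis by (rule crep_extension[OF F ex \<xi> T' _ _ _ _ W]) (use Y in \<open>simp_all add: sh_sh\<close>)
    qed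
    then show "Y2 \<in> ?T"
      using dist_arr(5)[OF T] by simp
  next
    fix Y' Y i p
    assume ip: "arr D Y Y' i" "arr D Y' Y p" "p \<cdot> i = Id D Y"
      and Y': "Y' \<in> ?T"
    have "crep D F\<^sub>o F\<^sub>m X W \<xi> (sh D l Y)" for l
    proof -
      note il = arr_shm[OF ip(1), of l] and pl = arr_shm[OF ip(2), of l]
      have c: "crep D F\<^sub>o F\<^sub>m X W \<xi> (sh D l Y')" using Y' by simp
      have e: "shm D l p \<cdot> shm D l i = Id D (sh D l Y)"
        using shm_comp[OF ip(1,2), of l] ip(3) shm_Id[of Y l] arr_Ob[OF ip(1)] by simp
      show ?thesis unfolding crep_def
      proof (intro conjI allI impI)
        fix f assume f: "arr D W (sh D l Y) f" "F\<^sub>m f \<cdot> \<xi> = 0"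
        then have "F\<^sub>m (shm D l i \<cdot> f) \<cdot> \<xi> = 0"
          using act[OF f(1) il] comp_0_right[OF functor_arr[OF F il]] arr_Ob[OF \<xi>] by simp
        then have "shm D l i \<cdot> f = 0" using crepD0[OF c arr_cmp[OF f(1) il]] by simp
        then show "f = 0"
          using comp_assoc[OF f(1) il pl] e comp_Id_left[OF f(1)] comp_0_right[OF pl W] by simp
      next
        fix s assume s: "arr D X (F\<^sub>o (sh D l Y)) s"
        obtain y where y: "arr D W (sh D l Y') y" "F\<^sub>m y \<cdot> \<xi> = F\<^sub>m (shm D l i) \<cdot> s"
          using crepE[OF c arr_cmp[OF s functor_arr[OF F il]]] .
        have "F\<^sub>m (shm D l p \<cdot> y) \<cdot> \<xi> = F\<^sub>m (shm D l p \<cdot> shm D l i) \<cdot> s"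
          using act[OF y(1) pl] y(2) functor_comp[OF F il pl]
            comp_assoc[OF s functor_arr[OF F il] functor_arr[OF F pl]] by simp
        also have "\<dots> = s"
          using e functor_Id[OF F sh_in_Ob] arr_Ob[OF ip(1)] comp_Id_left[OF s] by simp
        finally show "\<exists>f. arr D W (sh D l Y) f \<and> F\<^sub>m f \<cdot> \<xi> = s" using arr_cmp[OF y(1) pl] by blast
      qed
    qed
    then show "Y \<in> ?T"
      using arr_Ob[OF ip(1)] by simp
  qed auto
qed

lemma crep_gen:
  assumes F: "linear_functor D F\<^sub>o F\<^sub>m" and ex: "hom_exact D F\<^sub>o F\<^sub>m X" and \<xi>: "arr D X (F\<^sub>o W) \<xi>"
    and W: "W \<in> Ob D" and S: "S \<subseteq> Ob D"
    and c: "\<And>Y l. Y \<in> S \<Longrightarrow> crep D F\<^sub>o F\<^sub>m X W \<xi> (sh D l Y)" and Y: "Y \<in> gen D S"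
  shows "crep D F\<^sub>o F\<^sub>m X W \<xi> Y"
proof -
  have "gen D S \<subseteq> {Y \<in> Ob D. \<forall>l. crep D F\<^sub>o F\<^sub>m X W \<xi> (sh D l Y)}"
    using S c by (intro gen_least[OF _ thick_crep[OF F ex \<xi> W]]) auto
  then have "Y \<in> Ob D" "crep D F\<^sub>o F\<^sub>m X W \<xi> (sh D 0 Y)" using Y by auto
  then show ?thesis by (simp add: sh_0)
qed

lemma basis_exists:
  assumes "finite_dim_Homs D" "X \<in> Ob D" "Y \<in> Ob D"
  obtains B where "finite B" "is_basis D (Hom D X Y) B"
proof -
  obtain C where C: "finite C" "C \<subseteq> Hom D X Y" "vs.span C = Hom D X Y"
    using assms(1)[unfolded finite_dim_Homs_def, rule_format, OF assms(2,3)] by metis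
  obtain B where B: "B \<subseteq> C" "vs.independent B" "C \<subseteq> vs.span B"
    using vs.maximal_independent_subset[of C] by blast
  have "vs.span B = Hom D X Y"
    using B C by (metis subset_antisym vs.span_mono vs.span_minimal vs.subspace_span)
  then have "is_basis D (Hom D X Y) B" using B C by (auto simp: is_basis_def)
  then show thesis by (rule that[OF finite_subset[OF B(1) C(1)]])
qed

lemma finite_Sigma_basis:
  assumes B: "\<And>l. is_basis D (Hom D X (Y l)) (B l)" and fd: "finite_dim_Homs D"
    and XY: "X \<in> Ob D" "\<And>l. Y l \<in> Ob D" and fin: "finite {l. Hom D X (Y l) \<noteq> {0}}"
  shows "finite (SIGMA l:UNIV. B l)"
proof -
  have "finite (B l)" for l
  proof -
    obtain C where C: "finite C" "C \<subseteq> Hom D X (Y l)" "vs.span C = Hom D X (Y l)"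
      using fd[unfolded finite_dim_Homs_def, rule_format, OF XY, of l] by metis
    show ?thesis
      using vs.independent_span_bound[OF C(1), of "B l"] B[of l] C(3) by (auto simp: is_basis_def)
  qed
  then have "finite (SIGMA l:{l. Hom D X (Y l) \<noteq> {0}}. B l)" using fin by (intro finite_SigmaI)
  \<comment> \<open>A basis of the zero space is empty, 0 being dependent, so the degrees without
    morphisms contribute no index.\<close>
  moreover have "Hom D X (Y l) \<noteq> {0}" if "b \<in> B l" for l b
    using B[of l] that vs.dependent_zero[of "B l"] by (auto simp: is_basis_def)
  then have "(SIGMA l:UNIV. B l) \<subseteq> (SIGMA l:{l. Hom D X (Y l) \<noteq> {0}}. B l)" by auto
  ultimately show ?thesis by (rule finite_subset[rotated])
qed

text \<open>\<open>P\<close> is the sum of shifts of E over bases of the graded pieces, finitely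
  many by assumption; bijectivity is checked on shifts of E and spreads over the thick closure. The
  last clause holds because a nonzero \<open>P\<close> has some shift of E as a summand.\<close>

lemma corepresentation_exists:
  assumes fd: "finite_dim_Homs D" and F: "linear_functor D F\<^sub>o F\<^sub>m" and E: "exceptional D E"
    and ex: "hom_exact D F\<^sub>o F\<^sub>m X" and X: "X \<in> Ob D"
    and fin: "finite {l. Hom D X (F\<^sub>o (sh D l E)) \<noteq> {0}}"
  obtains P \<xi> where "P \<in> gen D {E}" "arr D X (F\<^sub>o P) \<xi>"
    "\<And>Y. Y \<in> gen D {E} \<Longrightarrow> crep D F\<^sub>o F\<^sub>m X P \<xi> Y"
    "\<And>B. \<lbrakk>thick_subcategory D B; P \<in> B; \<not> zero_object D P\<rbrakk> \<Longrightarrow> E \<in> B"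
proof -
  have E': "E \<in> Ob D" "{E} \<subseteq> Ob D" using E by (auto simp: exceptional_iff)
  have FE: "F\<^sub>o (sh D l E) \<in> Ob D" for l using functor_Ob[OF F sh_in_Ob[OF E'(1)]] .
  have "\<exists>B. is_basis D (Hom D X (F\<^sub>o (sh D l E))) B" for l using basis_exists[OF fd X FE] by metis
  then obtain B where B: "\<And>l. is_basis D (Hom D X (F\<^sub>o (sh D l E))) (B l)" by metis
  have finI: "finite (SIGMA l:UNIV. B l)" using finite_Sigma_basis[OF B fd X FE fin] .
  obtain P \<iota> \<pi> where P: "direct_sum D (SIGMA l:UNIV. B l) (\<lambda>i. sh D (fst i) E) P \<iota> \<pi>"
    using direct_sum_exists[OF finI sh_in_Ob[OF E'(1)]] by metis
  have c: "arr D X (F\<^sub>o (sh D (fst i) E)) (snd i)" if "i \<in> (SIGMA l:UNIV. B l)" for i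
    using B[of "fst i"] X FE that by (auto simp: is_basis_def arr_def)
  note co = coevaluation[OF F E P c X basis_family_Sigma[OF B finI]]
  have "P \<in> gen D {E}"
    by (rule direct_sum_in_thick[OF thick_gen[OF E'(2)] P])
      (use thick_sh[OF thick_gen[OF E'(2)]] gen_superset in blast)
  moreover have PO: "P \<in> Ob D" using P by (simp add: direct_sum_def)
  moreover have "E \<in> B'" if B': "thick_subcategory D B'" "P \<in> B'" "\<not> zero_object D P" for B'
  proof -
    have "(SIGMA l:UNIV. B l) \<noteq> {}"
    proof
      assume "(SIGMA l:UNIV. B l) = {}"
      then have "Id D P = 0" using P unfolding direct_sum_def by (metis sum.empty)
      then show False using PO B'(3) zero_object_iff by simp
    qed
    then obtain i where i: "i \<in> (SIGMA l:UNIV. B l)" by blast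
    have "sh D (fst i) E \<in> B'"
      using thick_retract[OF B'(1) direct_sum_arr(1,2)[OF P i]] direct_sum_eq[OF P i i] B'(2) by simp
    from thick_sh[OF B'(1) this, of "- fst i"] show ?thesis using E'(1) by simp
  qed
  moreover have "crep D F\<^sub>o F\<^sub>m X P (\<Sum>i\<in>(SIGMA l:UNIV. B l). F\<^sub>m (\<iota> i) \<cdot> snd i) Y"
    if "Y \<in> gen D {E}" for Y
    by (rule crep_gen[OF F ex co(1) PO E'(2) _ that]) (use co(2) in auto)
  moreover have "arr D X (F\<^sub>o P) (\<Sum>i\<in>(SIGMA l:UNIV. B l). F\<^sub>m (\<iota> i) \<cdot> snd i)"
    by (rule co(1))
  ultimately show thesis by (intro that)
qed

lemma lap_exists:
  assumes fd: "finite_dim_Homs D" and E: "exceptional D E" and X: "X \<in> Ob D" and "fin_hom D X E"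
  obtains P v where "lap D (gen D {E}) X P v"
    "\<And>B. \<lbrakk>thick_subcategory D B; P \<in> B; \<not> zero_object D P\<rbrakk> \<Longrightarrow> E \<in> B"
proof -
  have "E \<in> Ob D" using E by (simp add: exceptional_iff)
  then have "finite {l. Hom D X (sh D l E) \<noteq> {0}}" using fin_hom_iff_target X assms(4) by blast
  then show thesis
  proof (rule corepresentation_exists[OF fd linear_functor_id E hom_exact_id X])
    fix P \<xi> assume P: "P \<in> gen D {E}" "arr D X P \<xi>"
      "\<And>Y. Y \<in> gen D {E} \<Longrightarrow> crep D (\<lambda>X. X) (\<lambda>f. f) X P \<xi> Y"
      "\<And>B. \<lbrakk>thick_subcategory D B; P \<in> B; \<not> zero_object D P\<rbrakk> \<Longrightarrow> E \<in> B"
    have "lap D (gen D {E}) X P \<xi>" using P(1-3) by (auto simp: rap_def crep_id)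
    then show thesis using P(4) by (rule that)
  qed
qed

end

lemma rap_opc_opc [simp]: "rap (opc (opc D)) B X b u \<longleftrightarrow> rap D B X b u"
  by (simp add: rap_def rbij_def)

lemma finite_dim_Homs_opc [simp]: "finite_dim_Homs (opc D) \<longleftrightarrow> finite_dim_Homs D"
  by (auto simp: finite_dim_Homs_def)

lemma right_perp_opc [simp]: "right_perp (opc D) B = left_perp D B"
  by (simp add: right_perp_def left_perp_def)

lemma (in klinear_category) zero_object_iso:
  assumes "isomorphic D X Y" "zero_object D X"
  shows "zero_object D Y"
proof -
  obtain u v where uv: "arr D X Y u" "arr D Y X v" "u \<cdot> v = Id D Y" and Y: "Y \<in> Ob D"
    using assms(1) unfolding isomorphic_def using iso_mor_iff by metis
  have "v = 0" using zero_object_arr(1)[OF assms(2) uv(2)] .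
  then show ?thesis using uv Y comp_0_right[OF uv(1) Y] by (simp add: zero_object_iff)
qed

section \<open>Universal maps for one exceptional object, and the mutation of an exceptional
  pair\<close>

context pretriangulated_category
begin

lemma rap_exists:
  assumes "finite_dim_Homs D" "exceptional D E" "X \<in> Ob D" "fin_hom D E X"
  obtains P v where "rap D (gen D {E}) X P v"
    "\<And>B. \<lbrakk>thick_subcategory D B; P \<in> B; \<not> zero_object D P\<rbrakk> \<Longrightarrow> E \<in> B"
proof -
  interpret op: pretriangulated_category "opc D" by (rule pretriangulated_opc)
  have "fin_hom (opc D) X E" using assms fin_hom_opc by (simp add: exceptional_iff)
  show thesis
  proof (rule op.lap_exists[of E X])
    fix P v assume "lap (opc D) (gen (opc D) {E}) X P v"
      "\<And>B. \<lbrakk>thick_subcategory (opc D) B; P \<in> B; \<not> zero_object (opc D) P\<rbrakk> \<Longrightarrow> E \<in> B"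
    then show thesis using that[of P v] by simp
  qed (use assms \<open>fin_hom (opc D) X E\<close> in simp_all)
qed

text \<open>A universal map amounts to a triangle b -> X -> C with b in B and C right orthogonal to
  B. Closure of B under shifts lets the condition in \<open>rap\<close>, stated in one degree, be
  read in all degrees.\<close>

lemma rap_cone:
  assumes T: "dist D b X C u g h" and "thick_subcategory D B"
  shows "rap D B X b u \<longleftrightarrow> b \<in> B \<and> (\<forall>W\<in>B. orth D W C)"
proof -
  note A = dist_arr[OF T]
  have "(\<forall>W\<in>B. rbij D W b X u) \<longleftrightarrow> (\<forall>W\<in>B. \<forall>l. rbij D (sh D l W) b X u)"
    using thick_sh[OF assms(2)] thick_Ob[OF assms(2)] sh_0 by metis
  then show ?thesis
    using rbij_all_shifts_iff[OF T] thick_Ob[OF assms(2)] A(1) by (auto simp: rap_def)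
qed

lemma rap_iso:
  assumes "rap D B X b u" "X \<in> B"
  shows "iso_mor D b X u"
  using assms by (intro iso_if_rbij) (auto simp: rap_def)

text \<open>\<open>L\<close> is the left mutation of \<open>F\<close> through \<open>E\<close>, \<open>v\<close> being the evaluation map.\<close>

context
  fixes E F L P u v w
  assumes E: "exceptional D E" and F: "exceptional D F" and FE: "orth D F E"
    and T: "dist D L P F u v w" and v: "rap D (gen D {E}) F P v"
begin

lemma mutation_Ob: "E \<in> Ob D" "F \<in> Ob D" "L \<in> Ob D" "P \<in> Ob D"
  using E F dist_arr[OF T] by (auto simp: exceptional_iff)

lemma mutation_thick: "thick_subcategory D (gen D {E})"
  using thick_gen mutation_Ob by simp

text \<open>The cone of the universal map \<open>v\<close> is L[1] rather than L, hence the shift by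
  -1 at the end.\<close>

lemma mutation_orth: "orth D E L"
proof -
  have "orth D E (sh D 1 L)"
    using v rap_cone[OF rotate[OF T] mutation_thick] gen_superset[of "{E}"] by auto
  then show ?thesis using orth_sh_right[of E "sh D 1 L" "- 1"] mutation_Ob sh_in_Ob by simp
qed

text \<open>The graded endomorphisms of L are those of F. As F is orthogonal to P, composing with
  \<open>w\<close> identifies the maps from shifts of F to F with those to L[1]; as P is orthogonal
  to L, precomposing with \<open>w\<close> identifies the maps from L[1] to shifts of L with those
  from F.\<close>

lemma mutation_exceptional: "exceptional D L"
proof -
  interpret op: pretriangulated_category "opc D" by (rule pretriangulated_opc)
  note A = dist_arr[OF T] and O = mutation_Ob
  have P: "P \<in> gen D {E}" using v by (simp add: rap_def)
  have "orth D F P" using gen_orth[of "{F}" "{E}" F P] FE O P gen_superset[of "{F}"] by auto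
  then have "orth D F (sh D 1 P)" using orth_sh_right O by blast
  then have r: "rbij D (sh D l F) F (sh D 1 L) w" for l
    using rbij_all_shifts_iff[OF rotate[OF rotate[OF T]] O(2)] by blast
  have "orth D P L"
    using gen_orth[of "{E}" "{L}" P L] mutation_orth O P gen_superset[of "{L}"] by auto
  then have "orth (opc D) L P" using orth_opc O by blast
  then have l: "lbij D (sh D l L) F (sh D 1 L) w" for l
    using op.rbij_all_shifts_iff[OF dist_opcI[OF rotate[OF T]], of L] O by (simp, metis minus_minus)
  have w0: "w \<noteq> 0"
  proof
    assume "w = 0"
    then have "w \<cdot> Id D F = 0" using comp_Id_right[OF A(3)] by simp
    moreover have "rbij D F F (sh D 1 L) w" using r[of 0] O by (simp add: sh_0)
    ultimately have "Id D F = 0" using rbijD0 arr_Id O by metis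
    then show False using F by (simp add: exceptional_iff)
  qed
  have "Id D L \<noteq> 0"
  proof
    assume "Id D L = 0"
    then have "zero_object D (sh D 1 L)" using O zero_object_sh zero_object_iff by blast
    then show False using w0 zero_object_arr A(3) by blast
  qed
  moreover have "\<exists>c. f = scl D c (Id D L)" if f: "arr D L L f" for f
  proof -
    note f1 = arr_shm[OF f, of 1]
    obtain y where y: "arr D F F y" "w \<cdot> y = shm D 1 f \<cdot> w"
      using rbijE[OF r[of 0]] arr_cmp[OF A(3) f1] O by (metis sh_0)
    then obtain c where c: "y = scl D c (Id D F)" using F by (auto simp: exceptional_iff)
    have I: "arr D (sh D 1 L) (sh D 1 L) (Id D (sh D 1 L))" using O sh_in_Ob by blast
    have "shm D 1 f \<cdot> w = scl D c (Id D (sh D 1 L)) \<cdot> w"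
      using y(2) c comp_scl_right[OF arr_Id A(3)] O comp_Id_right[OF A(3)]
        comp_scl_left[OF A(3) I] comp_Id_left[OF A(3)] by simp
    then have "shm D 1 f = shm D 1 (scl D c (Id D L))"
      using lbij_inj[OF l[of 1] A(3) f1 arr_scl[OF I]] shm_scale[OF arr_Id] shm_Id O by simp
    then show ?thesis using shm_eq_iff[OF f arr_scl[OF arr_Id]] O by blast
  qed
  moreover have "f = 0" if f: "arr D L (sh D m L) f" and m: "m \<noteq> 0" for m f
  proof -
    have f1: "arr D (sh D 1 L) (sh D (m + 1) L) (shm D 1 f)"
      using arr_shm[OF f, of 1] O by (simp add: sh_sh add.commute)
    define g where "g = shm D 1 f \<cdot> w"
    have g: "arr D F (sh D (m + 1) L) g" unfolding g_def using arr_cmp[OF A(3) f1] .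
    \<comment> \<open>With the shift moved to the source the map can be lifted along
      \<open>w\<close> to a map from F[-m] to F, which is zero for nonzero \<open>m\<close>.\<close>
    have gm: "arr D (sh D (- m) F) (sh D 1 L) (shm D (- m) g)"
      using arr_shm[OF g, of "- m"] O by (simp add: sh_sh)
    obtain y where y: "arr D (sh D (- m) F) F y" "w \<cdot> y = shm D (- m) g" using rbijE[OF r gm] .
    have "y = 0"
      using exceptional_arr_neq[OF F, of "- m" 0 y] y(1) m O by (simp add: sh_0)
    then have "shm D (- m) g = 0" using y comp_0_right[OF A(3)] arr_Ob[OF y(1)] by simp
    then have "g = 0" using shm_eq_0_iff[OF g] by simp
    then have "shm D 1 f = 0" using lbijD0[OF l f1] by (simp add: g_def)
    then show ?thesis using shm_eq_0_iff[OF f] by simp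
  qed
  ultimately show ?thesis using O by (simp add: exceptional_iff)
qed

lemma mutation_gen_subset: "L \<in> gen D {E, F}" "F \<in> gen D {E, L}"
proof -
  have t: "thick_subcategory D (gen D {E, F})" "thick_subcategory D (gen D {E, L})"
    using thick_gen mutation_Ob by simp_all
  have P: "P \<in> gen D {E, F}" "P \<in> gen D {E, L}"
    using v gen_mono[of "{E}" "{E, F}"] gen_mono[of "{E}" "{E, L}"] by (auto simp: rap_def)
  show "L \<in> gen D {E, F}" using thick_cocone[OF t(1) T P(1)] gen_superset by blast
  show "F \<in> gen D {E, L}" using thick_cone[OF t(2) T _ P(2)] gen_superset by blast
qed

text \<open>Let X in <E,L> be right orthogonal to E. The cone of the universal map from <L> to X is
  right orthogonal to both E and L yet lies in <E,L>, so it vanishes and X lies in <L>. Finiteness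
  of the total Hom-spaces from L provides the universal map.\<close>

lemma mutation_gen:
  assumes fd: "finite_dim_Homs D" and fin: "\<And>X. X \<in> Ob D \<Longrightarrow> fin_hom D L X"
  shows "gen D {L} = right_perp D (gen D {E}) \<inter> gen D (gen D {E} \<union> gen D {F})"
proof -
  note O = mutation_Ob
  have EF: "{E, F} \<subseteq> Ob D" and EL: "{E, L} \<subseteq> Ob D" using O by auto
  have "gen D (gen D {E} \<union> gen D {F}) = gen D {E, F}"
  proof (rule gen_eqI)
    show "gen D {E} \<union> gen D {F} \<subseteq> gen D {E, F}" by (intro Un_least gen_mono) auto
    show "{E, F} \<subseteq> gen D (gen D {E} \<union> gen D {F})"
      using gen_superset[of "{E}"] gen_superset[of "{F}"] gen_superset[of "gen D {E} \<union> gen D {F}"]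
      by blast
    show "gen D {E} \<union> gen D {F} \<subseteq> Ob D" using gen_Ob[of "{E}"] gen_Ob[of "{F}"] O by auto
  qed (rule EF)
  moreover have "gen D {E, F} = gen D {E, L}"
    using mutation_gen_subset gen_superset[of "{E, F}"] gen_superset[of "{E, L}"] EF EL
    by (intro gen_eqI) auto
  moreover have rp: "right_perp D (gen D {E}) = {X \<in> Ob D. orth D E X}"
    using right_perp_gen[of "{E}"] O by auto
  moreover have "gen D {L} = {X \<in> Ob D. orth D E X} \<inter> gen D {E, L}"
  proof
    have "gen D {L} \<subseteq> {X \<in> Ob D. \<forall>W\<in>{E}. orth D W X}"
      using mutation_orth O by (intro gen_least[OF _ thick_right_orth]) auto
    then show sub: "gen D {L} \<subseteq> {X \<in> Ob D. orth D E X} \<inter> gen D {E, L}"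
      using gen_mono[of "{L}" "{E, L}"] by auto
    show "{X \<in> Ob D. orth D E X} \<inter> gen D {E, L} \<subseteq> gen D {L}"
    proof
      fix X assume X: "X \<in> {X \<in> Ob D. orth D E X} \<inter> gen D {E, L}"
      then obtain b k where b: "rap D (gen D {L}) X b k"
        using rap_exists[OF fd mutation_exceptional _ fin] by blast
      then obtain C g h where C: "dist D b X C k g h" using cone[of b X k] b unfolding rap_def by metis
      have tL: "thick_subcategory D (gen D {L})" and tEL: "thick_subcategory D (gen D {E, L})"
        using thick_gen EL by auto
      have bL: "b \<in> gen D {L}" using b by (simp add: rap_def)
      have "orth D L C" using b rap_cone[OF C tL] gen_superset[of "{L}"] by auto
      moreover have "C \<in> {X \<in> Ob D. \<forall>W\<in>{E}. orth D W X}"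
        using thick_cone[OF thick_right_orth[of "{E}"] C] X sub bL O by auto
      moreover have "C \<in> gen D {E, L}" using thick_cone[OF tEL C] X sub bL by auto
      ultimately have "zero_object D C" using zero_if_orth_gen[OF EL, of C] by auto
      then have "iso_mor D b X k" using iso_if_cone_zero[OF C] by simp
      then show "X \<in> gen D {L}" using thick_iso[OF tL] bL X by auto
    qed
  qed
  ultimately show ?thesis by simp
qed

end

lemma coevaluation_lap:
  assumes E: "exceptional D E" and P: "direct_sum D I (\<lambda>i. sh D (d i) E) P \<iota> \<pi>"
    and c: "\<And>i. i \<in> I \<Longrightarrow> arr D X (sh D (d i) E) (c i)" and X: "X \<in> Ob D"
    and basis: "basis_family I d c (\<lambda>m. Hom D X (sh D m E))"
  shows "lap D (gen D {E}) X P (\<Sum>i\<in>I. \<iota> i \<cdot> c i)"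
proof -
  have E': "E \<in> Ob D" using E by (simp add: exceptional_iff)
  note t = thick_gen[of "{E}"]
  have PO: "P \<in> Ob D" using P by (simp add: direct_sum_def)
  have \<xi>: "arr D X P (\<Sum>i\<in>I. \<iota> i \<cdot> c i)"
    by (rule coevaluation(1)[OF linear_functor_id E P c X basis])
  have "crep D (\<lambda>X. X) (\<lambda>f. f) X P (\<Sum>i\<in>I. \<iota> i \<cdot> c i) (sh D m E)" for m
    by (rule coevaluation(2)[OF linear_functor_id E P c X basis])
  then have "crep D (\<lambda>X. X) (\<lambda>f. f) X P (\<Sum>i\<in>I. \<iota> i \<cdot> c i) Y" if "Y \<in> gen D {E}" for Y
    using crep_gen[OF linear_functor_id hom_exact_id \<xi> PO, of "{E}" Y] E' that by auto
  moreover have "P \<in> gen D {E}"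
    using direct_sum_in_thick[OF t P] thick_sh[OF t] gen_superset[of "{E}"] E' by auto
  ultimately show ?thesis using \<xi> by (simp add: rap_def crep_id)
qed

text \<open>Evaluation is coevaluation in the opposite category, where the shift of E in degree l is
  E[-l]. The bases of Hom(E,F[l]) turn into bases of Hom(E[-l],F) because the shift is linear and
  invertible.\<close>

lemma evaluation_rap:
  assumes E: "exceptional D E" and F: "F \<in> Ob D"
    and B: "\<And>l. is_basis D (Hom D E (sh D l F)) (B l)"
    and P: "direct_sum D (SIGMA l:UNIV. B l) (\<lambda>(l, b). sh D (- l) E) P \<iota> \<pi>"
  shows "rap D (gen D {E}) F P (\<Sum>(l, b)\<in>(SIGMA l:UNIV. B l). shm D (- l) b \<cdot> \<pi> (l, b))"
proof -
  interpret op: pretriangulated_category "opc D" by (rule pretriangulated_opc)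
  let ?I = "SIGMA l:UNIV. B l"
  let ?c = "\<lambda>i. shm D (- fst i) (snd i)"
  have E': "E \<in> Ob D" using E by (simp add: exceptional_iff)
  have fin: "finite ?I" using P by (simp add: direct_sum_def)
  have b: "arr D E (sh D (fst i) F) (snd i)" if "i \<in> ?I" for i
    using B[of "fst i"] that E' F sh_in_Ob by (auto simp: is_basis_def arr_def)
  have c: "arr D (sh D (- fst i) E) F (?c i)" if "i \<in> ?I" for i
    using arr_shift_right[OF E' F b[OF that]] .
  have bf: "(\<Sum>i | i \<in> ?I \<and> fst i = m. scl D (a i) (snd i)) = 0 \<Longrightarrow> i \<in> ?I \<Longrightarrow> fst i = m \<Longrightarrow> a i = 0"
    "s \<in> Hom D E (sh D m F) \<Longrightarrow> \<exists>a. s = (\<Sum>i | i \<in> ?I \<and> fst i = m. scl D (a i) (snd i))" for a i m s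
    using basis_family_Sigma[OF B fin] unfolding basis_family_def by blast+
  have shift: "(\<Sum>i | i \<in> ?I \<and> fst i = m. scl D (a i) (?c i)) =
      shm D (- m) (\<Sum>i | i \<in> ?I \<and> fst i = m. scl D (a i) (snd i))"
    and ty: "arr D E (sh D m F) (\<Sum>i | i \<in> ?I \<and> fst i = m. scl D (a i) (snd i))" for a m
  proof -
    have *: "arr D E (sh D m F) (scl D (a i) (snd i))" if "i \<in> {i \<in> ?I. fst i = m}" for i
      using b[of i] that by (intro arr_scl) auto
    show "arr D E (sh D m F) (\<Sum>i | i \<in> ?I \<and> fst i = m. scl D (a i) (snd i))"
      using * by (intro arr_sum E' sh_in_Ob[OF F]) auto
    have "shm D (- m) (\<Sum>i | i \<in> ?I \<and> fst i = m. scl D (a i) (snd i)) =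
        (\<Sum>i | i \<in> ?I \<and> fst i = m. shm D (- m) (scl D (a i) (snd i)))"
      using * by (intro shm_sum[OF E' sh_in_Ob[OF F]]) auto
    also have "\<dots> = (\<Sum>i | i \<in> ?I \<and> fst i = m. scl D (a i) (?c i))"
      using shm_scale[OF b] by (intro sum.cong) auto
    finally show "(\<Sum>i | i \<in> ?I \<and> fst i = m. scl D (a i) (?c i)) =
      shm D (- m) (\<Sum>i | i \<in> ?I \<and> fst i = m. scl D (a i) (snd i))" by simp
  qed
  have "op.basis_family ?I fst ?c (\<lambda>m. Hom (opc D) F (sh (opc D) m E))"
    unfolding op.basis_family_def opc_simps
  proof (intro allI conjI impI ballI)
    fix m a i assume "(\<Sum>i | i \<in> ?I \<and> fst i = m. scl D (a i) (?c i)) = 0" "i \<in> ?I" "fst i = m"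
    then show "a i = 0" using shift[of a m] shm_eq_0_iff[OF ty] bf(1)[of a m i] by simp
  next
    fix m s assume "s \<in> Hom D (sh D (- m) E) F"
    then have s: "arr D (sh D (- m) E) F s" using E' F sh_in_Ob by (simp add: arr_def)
    then have "arr D E (sh D m F) (shm D m s)" using arr_shm[OF s, of m] E' by simp
    then obtain a where "shm D m s = (\<Sum>i | i \<in> ?I \<and> fst i = m. scl D (a i) (snd i))"
      using bf(2) unfolding arr_def by blast
    then have "shm D (- m) (shm D m s) = (\<Sum>i | i \<in> ?I \<and> fst i = m. scl D (a i) (?c i))"
      using shift by simp
    then show "\<exists>a. s = (\<Sum>i | i \<in> ?I \<and> fst i = m. scl D (a i) (?c i))"
      using shm_inverse(2)[OF s] by auto
  qed
  moreover have "direct_sum (opc D) ?I (\<lambda>i. sh (opc D) (fst i) E) P \<pi> \<iota>"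
    using P by (simp add: case_prod_beta')
  ultimately have "lap (opc D) (gen (opc D) {E}) F P (\<Sum>i\<in>?I. \<pi> i \<cdot>\<^bsub>opc D\<^esub> ?c i)"
    using E F c by (intro op.coevaluation_lap) auto
  then show ?thesis by (simp add: case_prod_beta')
qed

end

section \<open>Mutations when all total Hom-spaces are finite-dimensional\<close>

locale ext_finite_category = pretriangulated_category +
  assumes finite_dim_Homs: "finite_dim_Homs D"
    and fin_hom: "\<lbrakk>X \<in> Ob D; Y \<in> Ob D\<rbrakk> \<Longrightarrow> fin_hom D X Y"
begin

lemma ext_finite_opc: "ext_finite_category (opc D)"
proof -
  interpret op: pretriangulated_category "opc D" by (rule pretriangulated_opc)
  show ?thesis by unfold_locales (simp_all add: finite_dim_Homs fin_hom fin_hom_opc)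
qed

lemma mutation_bases:
  assumes "E \<in> Ob D" "F \<in> Ob D"
  obtains B where "\<forall>l. is_basis D (Hom D E (sh D l F)) (B l)" "finite (SIGMA l:UNIV. B l)"
proof -
  have F: "sh D l F \<in> Ob D" for l using sh_in_Ob assms by blast
  have "\<exists>B. is_basis D (Hom D E (sh D l F)) B" for l
    using basis_exists[OF finite_dim_Homs assms(1) F] by metis
  then obtain B where B: "\<And>l. is_basis D (Hom D E (sh D l F)) (B l)" by metis
  have "finite {l. Hom D E (sh D l F) \<noteq> {0}}" using fin_hom[OF assms] fin_hom_iff_target assms by blast
  from finite_Sigma_basis[OF B finite_dim_Homs assms(1) F this] B show thesis using that by blast
qed

lemma left_mutation_object_exists:
  assumes E: "exceptional D E" and F: "F \<in> Ob D"
  shows "\<exists>L. left_mutation_object D E F L"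
proof -
  have E': "E \<in> Ob D" using E by (simp add: exceptional_iff)
  obtain B where B: "\<And>l. is_basis D (Hom D E (sh D l F)) (B l)" and fin: "finite (SIGMA l:UNIV. B l)"
    using mutation_bases[OF E' F] by metis
  obtain P \<iota> \<pi> where P: "direct_sum D (SIGMA l:UNIV. B l) (\<lambda>i. sh D (- fst i) E) P \<iota> \<pi>"
    using direct_sum_exists[OF fin sh_in_Ob[OF E']] by metis
  then have P: "direct_sum D (SIGMA l:UNIV. B l) (\<lambda>(l, b). sh D (- l) E) P \<iota> \<pi>"
    by (simp add: case_prod_beta')
  have "arr D P F (\<Sum>(l, b)\<in>(SIGMA l:UNIV. B l). shm D (- l) b \<cdot> \<pi> (l, b))"
    using evaluation_rap[OF E F B P] by (simp add: rap_def)
  then obtain L u w where "dist D L P F u (\<Sum>(l, b)\<in>(SIGMA l:UNIV. B l). shm D (- l) b \<cdot> \<pi> (l, b)) w"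
    using cocone by blast
  then show ?thesis using B P unfolding left_mutation_object_def by blast
qed

lemma right_mutation_lap:
  assumes F: "exceptional D F" and E: "E \<in> Ob D"
    and B: "\<And>l. is_basis D (Hom D E (sh D l F)) (B l)"
    and P: "direct_sum D (SIGMA l:UNIV. B l) (\<lambda>(l, b). sh D l F) P \<iota> \<pi>"
  shows "lap D (gen D {F}) E P (\<Sum>(l, b)\<in>(SIGMA l:UNIV. B l). \<iota> (l, b) \<cdot> b)"
proof -
  have F': "sh D l F \<in> Ob D" for l using F sh_in_Ob by (simp add: exceptional_iff)
  have fin: "finite (SIGMA l:UNIV. B l)" using P by (simp add: direct_sum_def)
  have P': "direct_sum D (SIGMA l:UNIV. B l) (\<lambda>i. sh D (fst i) F) P \<iota> \<pi>"
    using P by (simp add: case_prod_beta')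
  have c: "arr D E (sh D (fst i) F) (snd i)" if "i \<in> (SIGMA l:UNIV. B l)" for i
    using B[of "fst i"] that E F' by (auto simp: is_basis_def arr_def)
  have "lap D (gen D {F}) E P (\<Sum>i\<in>(SIGMA l:UNIV. B l). \<iota> i \<cdot> snd i)"
    by (rule coevaluation_lap[OF F P' c E basis_family_Sigma[OF B fin]])
  then show ?thesis by (simp add: case_prod_beta')
qed

lemma right_mutation_object_exists:
  assumes F: "exceptional D F" and E: "E \<in> Ob D"
  shows "\<exists>R. right_mutation_object D E F R"
proof -
  have F': "F \<in> Ob D" using F by (simp add: exceptional_iff)
  obtain B where B: "\<And>l. is_basis D (Hom D E (sh D l F)) (B l)" and fin: "finite (SIGMA l:UNIV. B l)"
    using mutation_bases[OF E F'] by metis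
  obtain P \<iota> \<pi> where P: "direct_sum D (SIGMA l:UNIV. B l) (\<lambda>i. sh D (fst i) F) P \<iota> \<pi>"
    using direct_sum_exists[OF fin sh_in_Ob[OF F']] by metis
  then have P: "direct_sum D (SIGMA l:UNIV. B l) (\<lambda>(l, b). sh D l F) P \<iota> \<pi>"
    by (simp add: case_prod_beta')
  have "arr D E P (\<Sum>(l, b)\<in>(SIGMA l:UNIV. B l). \<iota> (l, b) \<cdot> b)"
    using right_mutation_lap[OF F E B P] by (simp add: rap_def)
  then obtain R v w where "dist D E P R (\<Sum>(l, b)\<in>(SIGMA l:UNIV. B l). \<iota> (l, b) \<cdot> b) v w"
    using cone by blast
  then show ?thesis using B P unfolding right_mutation_object_def by blast
qed

lemma left_mutation_object:
  assumes E: "exceptional D E" and F: "exceptional D F" and FE: "orth D F E"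
    and L: "left_mutation_object D E F L"
  shows "exceptional D L" "orth D E L" "L \<in> gen D {E, F}" "F \<in> gen D {E, L}"
    "gen D {L} = right_perp D (gen D {E}) \<inter> gen D (gen D {E} \<union> gen D {F})"
proof -
  obtain B P \<iota> \<pi> u w where B: "\<And>l. is_basis D (Hom D E (sh D l F)) (B l)"
    and P: "direct_sum D (SIGMA l:UNIV. B l) (\<lambda>(l, b). sh D (- l) E) P \<iota> \<pi>"
    and T: "dist D L P F u (\<Sum>(l, b)\<in>(SIGMA l:UNIV. B l). shm D (- l) b \<cdot> \<pi> (l, b)) w"
    using L unfolding left_mutation_object_def by blast
  have v: "rap D (gen D {E}) F P (\<Sum>(l, b)\<in>(SIGMA l:UNIV. B l). shm D (- l) b \<cdot> \<pi> (l, b))"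
    using evaluation_rap[OF E _ B P] F by (simp add: exceptional_iff)
  show "exceptional D L" "orth D E L" "L \<in> gen D {E, F}" "F \<in> gen D {E, L}"
    "gen D {L} = right_perp D (gen D {E}) \<inter> gen D (gen D {E} \<union> gen D {F})"
    using mutation_exceptional[OF E F FE T v] mutation_orth[OF E F FE T v]
      mutation_gen_subset[OF E F FE T v] mutation_gen[OF E F FE T v finite_dim_Homs fin_hom]
      mutation_Ob[OF E F FE T v] by simp_all
qed

text \<open>In the opposite category \<open>R\<close> is the left mutation of E through F: the
  triangle is reversed, coevaluation becomes evaluation and the two objects of the pair exchange
  their roles.\<close>

lemma right_mutation_object:
  assumes E: "exceptional D E" and F: "exceptional D F" and FE: "orth D F E"
    and R: "right_mutation_object D E F R"
  shows "exceptional D R" "orth D R F" "R \<in> gen D {E, F}" "E \<in> gen D {F, R}"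
    "gen D {R} = left_perp D (gen D {F}) \<inter> gen D (gen D {E} \<union> gen D {F})"
proof -
  interpret op: ext_finite_category "opc D" by (rule ext_finite_opc)
  have O: "E \<in> Ob D" "F \<in> Ob D" using E F by (auto simp: exceptional_iff)
  obtain B P \<iota> \<pi> v w where B: "\<And>l. is_basis D (Hom D E (sh D l F)) (B l)"
    and P: "direct_sum D (SIGMA l:UNIV. B l) (\<lambda>(l, b). sh D l F) P \<iota> \<pi>"
    and T: "dist D E P R (\<Sum>(l, b)\<in>(SIGMA l:UNIV. B l). \<iota> (l, b) \<cdot> b) v w"
    using R unfolding right_mutation_object_def by blast
  have RO: "R \<in> Ob D" using dist_arr(6)[OF T] .
  have ev: "rap (opc D) (gen (opc D) {F}) E P (\<Sum>(l, b)\<in>(SIGMA l:UNIV. B l). \<iota> (l, b) \<cdot> b)"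
    using right_mutation_lap[OF F _ B P] O by simp
  have e: "exceptional (opc D) E" "exceptional (opc D) F" "orth (opc D) E F"
    using E F FE O orth_opc by auto
  note m = e(2,1,3) dist_opcI[OF T] ev
  show "exceptional D R" "orth D R F" "R \<in> gen D {E, F}" "E \<in> gen D {F, R}"
    "gen D {R} = left_perp D (gen D {F}) \<inter> gen D (gen D {E} \<union> gen D {F})"
    using op.mutation_exceptional[OF m] op.mutation_orth[OF m] orth_opc[of F R] RO O
      op.mutation_gen_subset[OF m] op.mutation_gen[OF m op.finite_dim_Homs op.fin_hom]
    by (simp_all add: insert_commute Un_commute)
qed

text \<open>An object of <E> is isomorphic to its own universal approximation, a finite sum of
  shifts of E. So a nonzero thick subcategory of <E> is all of <E>, which makes the decompositions
  into such pieces indivisible.\<close>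

lemma exceptional_in_thick:
  assumes E: "exceptional D E" and B: "thick_subcategory D B"
    and X: "X \<in> gen D {E}" "X \<in> B" "\<not> zero_object D X"
  shows "E \<in> B"
proof -
  have O: "E \<in> Ob D" "X \<in> Ob D" using E B X thick_Ob by (auto simp: exceptional_iff)
  show ?thesis
  proof (rule rap_exists[OF finite_dim_Homs E O(2) fin_hom[OF O]])
    fix P v assume r: "rap D (gen D {E}) X P v"
      and P: "\<And>B. \<lbrakk>thick_subcategory D B; P \<in> B; \<not> zero_object D P\<rbrakk> \<Longrightarrow> E \<in> B"
    have i: "isomorphic D P X"
      using rap_iso[OF r X(1)] r O by (auto simp: isomorphic_def rap_def arr_def)
    then have "P \<in> B" using isomorphic_sym[OF i] B X(2)
      by (metis thick_subcategory_def triangulated_subcategory_def)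
    moreover have "\<not> zero_object D P"
      using zero_object_iso[OF i] X(3) by blast
    ultimately show "E \<in> B" using P B by blast
  qed
qed

end

section \<open>Splitting of idempotents\<close>

definition splits :: "('o, 'm::ab_group_add, 'k::field) tri_cat \<Rightarrow> 'o \<Rightarrow> 'm \<Rightarrow> bool" where
  "splits D X e \<longleftrightarrow>
     (\<exists>Y i p. arr D Y X i \<and> arr D X Y p \<and> p \<cdot>\<^bsub>D\<^esub> i = Id D Y \<and> i \<cdot>\<^bsub>D\<^esub> p = e)"

context pretriangulated_category
begin

lemma splits_complement: "splits D X e \<Longrightarrow> splits D X (Id D X - e)"
proof -
  assume "splits D X e"
  then obtain Y i p where ip: "arr D Y X i" "arr D X Y p" "p \<cdot> i = Id D Y" "i \<cdot> p = e"
    by (auto simp: splits_def)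
  obtain Z s g h where *: "dist D Y X Z i g h" "arr D Z X s" "g \<cdot> s = Id D Z"
    "i \<cdot> p + s \<cdot> g = Id D X"
    using complement[OF ip(1-3)] by metis
  have "s \<cdot> g = Id D X - e" using *(4) ip(4) by (metis add_diff_cancel_left')
  then show ?thesis unfolding splits_def using * dist_arr(2)[OF *(1)] by blast
qed

text \<open>The idempotents tg and gt have isomorphic images: \<open>t\<close> and \<open>g\<close>
  restrict to mutually inverse maps between them, so a splitting of one is carried to the
  other.\<close>

lemma splits_transfer:
  assumes g: "arr D X C g" and t: "arr D C X t" and id: "(t \<cdot> g) \<cdot> (t \<cdot> g) = t \<cdot> g"
    and "splits D C (g \<cdot> t)"
  shows "splits D X (t \<cdot> g)"
proof -
  obtain Y i p where ip: "arr D Y C i" "arr D C Y p" "p \<cdot> i = Id D Y" "i \<cdot> p = g \<cdot> t"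
    using assms(4) by (auto simp: splits_def)
  have gti: "g \<cdot> (t \<cdot> i) = i"
    using comp_assoc[OF ip(1) t g] ip(4) comp_assoc[OF ip(1,2,1)] ip(3) comp_Id_right[OF ip(1)] by simp
  have "(p \<cdot> g) \<cdot> (t \<cdot> i) = Id D Y"
    using comp_assoc[OF arr_cmp[OF ip(1) t] g ip(2)] gti ip(3) by simp
  moreover have "(t \<cdot> i) \<cdot> (p \<cdot> g) = t \<cdot> g"
  proof -
    have "(t \<cdot> i) \<cdot> (p \<cdot> g) = t \<cdot> ((i \<cdot> p) \<cdot> g)"
      using comp_assoc[OF arr_cmp[OF g ip(2)] ip(1) t] comp_assoc[OF g ip(2,1)] by simp
    also have "\<dots> = (t \<cdot> g) \<cdot> (t \<cdot> g)"
      using ip(4) comp_assoc[OF g t g] comp_assoc[OF arr_cmp[OF g t] g t] by simp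
    finally show ?thesis using id by simp
  qed
  ultimately show ?thesis
    unfolding splits_def using arr_cmp[OF ip(1) t] arr_cmp[OF g ip(2)] by blast
qed

text \<open>
  If \<open>e\<close> fixes \<open>u\<close>, then $1-e$ factors through the cone of \<open>u\<close> as $tg$, and the image of $1-e$
  is the image of the idempotent $gt$ of the cone.
\<close>

lemma splits_by_cone:
  assumes T: "dist D b X C u g h" and e: "arr D X X e" "e \<cdot> e = e" and eu: "e \<cdot> u = u"
    and C: "\<And>f. \<lbrakk>arr D C C f; f \<cdot> f = f\<rbrakk> \<Longrightarrow> splits D C f"
  shows "splits D X e"
proof -
  note A = dist_arr[OF T]
  define e' where "e' = Id D X - e"
  have I: "arr D X X (Id D X)" using A by blast
  have e': "arr D X X e'" unfolding e'_def using I e(1) by blast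
  have ee': "e \<cdot> e' = 0"
    using comp_diff_right[OF I e(1) e(1)] comp_Id_right[OF e(1)] e(2) by (simp add: e'_def)
  have e'e': "e' \<cdot> e' = e'"
    using comp_diff_left[OF e' I e(1)] comp_Id_left[OF e'] ee' by (simp add: e'_def[symmetric])
  have "e' \<cdot> u = 0"
    using comp_diff_left[OF A(1) I e(1)] comp_Id_left[OF A(1)] eu by (simp add: e'_def)
  then obtain t0 where t0: "arr D C X t0" "t0 \<cdot> g = e'" using extend_second[OF T e'] by blast
  \<comment> \<open>Composing \<open>t0\<close> with the idempotent ensures e' t = t, and with it
    that g t is idempotent.\<close>
  define t where "t = e' \<cdot> t0"
  have t: "arr D C X t" unfolding t_def using arr_cmp[OF t0(1) e'] .
  have tg: "t \<cdot> g = e'" using comp_assoc[OF A(2) t0(1) e'] t0(2) e'e' by (simp add: t_def)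
  have et: "e' \<cdot> t = t" using comp_assoc[OF t0(1) e' e'] e'e' by (simp add: t_def)
  have "(g \<cdot> t) \<cdot> (g \<cdot> t) = g \<cdot> (e' \<cdot> t)"
    using comp_assoc[OF arr_cmp[OF t A(2)] t A(2)] comp_assoc[OF t A(2) t] tg by simp
  then have "splits D C (g \<cdot> t)" using C[OF arr_cmp[OF t A(2)]] et by simp
  then have "splits D X e'" using splits_transfer[OF A(2) t] tg e'e' by simp
  from splits_complement[OF this] show ?thesis by (simp add: e'_def)
qed

text \<open>Rank and nullity for a surjective composition with one known kernel vector: a nonzero
  \<open>u\<close> is extended to a basis and the images of the other basis vectors still span. The
  conditional summand also gives the plain inequality for u = 0.\<close>

lemma dim_drop:
  assumes fd: "finite_dim_Homs D" and A: "A \<in> Ob D" and g: "arr D X C g"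
    and surj: "\<And>w. arr D A C w \<Longrightarrow> \<exists>v. arr D A X v \<and> g \<cdot> v = w"
    and u: "arr D A X u" "g \<cdot> u = 0"
  shows "vs.dim (Hom D A C) + (if u = 0 then 0 else 1) \<le> vs.dim (Hom D A X)"
proof -
  note X = arr_Ob[OF g]
  obtain K where K: "finite K" "is_basis D (Hom D A X) K" using basis_exists[OF fd A X(1)] .
  have "vs.independent ({u} - {0})" by (cases "u = 0") (auto simp: vs.independent_empty)
  moreover have "{u} - {0} \<subseteq> Hom D A X" using u by (auto simp: arr_def)
  ultimately obtain B where B: "{u} - {0} \<subseteq> B" "B \<subseteq> Hom D A X" "vs.independent B"
    "Hom D A X \<subseteq> vs.span B"
    using vs.maximal_independent_subset_extend by metis
  have finB: "finite B"
    using vs.independent_span_bound[OF K(1) B(3)] B(2) K(2) by (auto simp: is_basis_def)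
  have arrB: "arr D A X b" if "b \<in> B" for b using that B(2) A X by (auto simp: arr_def)
  define B' where "B' = B - ({u} - {0})"
  have "Hom D A C \<subseteq> vs.span ((\<lambda>b. g \<cdot> b) ` B')"
  proof
    fix w assume "w \<in> Hom D A C"
    then obtain v where v: "arr D A X v" "g \<cdot> v = w" using surj A X by (auto simp: arr_def)
    then have "v \<in> range (\<lambda>k. \<Sum>b\<in>B. scl D (k b) b)"
      using B(4) vs.span_finite[OF finB] by (auto simp: arr_def)
    then obtain k where k: "v = (\<Sum>b\<in>B. scl D (k b) b)" by blast
    have "g \<cdot> (\<Sum>b\<in>B. scl D (k b) b) = (\<Sum>b\<in>B. g \<cdot> scl D (k b) b)"
      by (rule comp_sum_right[OF g A arr_scl[OF arrB]])
    then have "w = (\<Sum>b\<in>B. g \<cdot> scl D (k b) b)" using v k by simp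
    also have "\<dots> = (\<Sum>b\<in>B. scl D (k b) (g \<cdot> b))"
      using comp_scl_right[OF arrB g] by simp
    also have "\<dots> = (\<Sum>b\<in>B'. scl D (k b) (g \<cdot> b))"
      using u(2) by (intro sum.mono_neutral_right) (auto simp: finB B'_def)
    finally have "w = (\<Sum>b\<in>B'. scl D (k b) (g \<cdot> b))" .
    then show "w \<in> vs.span ((\<lambda>b. g \<cdot> b) ` B')"
      by (simp only:) (intro vs.span_sum vs.span_scale vs.span_base imageI)
  qed
  then have "vs.dim (Hom D A C) \<le> card ((\<lambda>b. g \<cdot> b) ` B')"
    using finB by (intro vs.dim_le_card) (auto simp: B'_def)
  also have "\<dots> \<le> card B'" using finB by (intro card_image_le) (auto simp: B'_def)
  also have "card B' + (if u = 0 then 0 else 1) = card B"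
    using B(1) finB card_Suc_Diff1[OF finB, of u] by (auto simp: B'_def)
  also have "card B = vs.dim (Hom D A X)" using B by (intro vs.basis_card_eq_dim) auto
  finally show ?thesis by simp
qed

end

context ext_finite_category
begin

text \<open>The long exact sequence from shifts of E has vanishing connecting maps, so passing to
  the cone is surjective in every degree, and in degree \<open>l0\<close> it kills \<open>u\<close>.
  The total dimension thus drops strictly.\<close>

lemma total_dim_drop:
  assumes E: "exceptional D E" and T: "dist D (sh D l0 E) X C u g h" and u: "u \<noteq> 0"
  defines "N \<equiv> \<lambda>X. (\<Sum>l | Hom D (sh D l E) X \<noteq> {0}. vs.dim (Hom D (sh D l E) X))"
  shows "N C < N X"
proof -
  note A = dist_arr[OF T]
  have E': "E \<in> Ob D" using E by (simp add: exceptional_iff)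
  have El: "sh D l E \<in> Ob D" for l using sh_in_Ob[OF E'] .
  have surj: "\<exists>v. arr D (sh D l E) X v \<and> g \<cdot> v = w" if w: "arr D (sh D l E) C w" for l w
  proof -
    have hw: "arr D (sh D l E) (sh D (1 + l0) E) (h \<cdot> w)"
      using arr_cmp[OF w A(3)] E' by (simp add: sh_sh)
    have uhw: "shm D 1 u \<cdot> (h \<cdot> w) = 0"
      using comp_assoc[OF w A(3) arr_shm[OF A(1)]] dist_comp_zero'(2)[OF T] comp_0_left[OF w] A sh_in_Ob
      by simp
    \<comment> \<open>The target is E[l0+1]. From other degrees there is no nonzero map, and in
      degree l0+1 the composite is a scalar c with c u[1] = 0, so c = 0.\<close>
    have "h \<cdot> w = 0"
    proof (cases "l = 1 + l0")
      case True
      then obtain c where c: "h \<cdot> w = scl D c (Id D (sh D (1 + l0) E))"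
        using exceptional_arr_eq[OF E] hw by metis
      have u1: "arr D (sh D (1 + l0) E) (sh D 1 X) (shm D 1 u)"
        using arr_shm[OF A(1), of 1] E' by (simp add: sh_sh)
      have "scl D c (shm D 1 u) = 0"
        using uhw c comp_scl_right[OF arr_Id[OF El] u1] comp_Id_right[OF u1] by simp
      then show ?thesis using c u shm_eq_0_iff[OF A(1)] by simp
    next
      case False
      then show ?thesis using exceptional_arr_neq[OF E hw] by simp
    qed
    then show ?thesis using lift_second[OF T w] by metis
  qed
  have le: "vs.dim (Hom D (sh D l E) C) \<le> vs.dim (Hom D (sh D l E) X)" for l
    using dim_drop[OF finite_dim_Homs El A(2) surj, of l 0] comp_0_right[OF A(2) El] A(5) El by auto
  have less: "vs.dim (Hom D (sh D l0 E) C) < vs.dim (Hom D (sh D l0 E) X)"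
    using dim_drop[OF finite_dim_Homs El A(2) surj A(1)] dist_comp_zero[OF T] u by simp
  have supp: "Hom D (sh D l E) C = {0}" if "Hom D (sh D l E) X = {0}" for l
  proof -
    have "w = 0" if w: "arr D (sh D l E) C w" for w
    proof -
      obtain v where v: "arr D (sh D l E) X v" "g \<cdot> v = w" using surj[OF w] by blast
      then have "v = 0" using Hom_zeroD[OF \<open>Hom D (sh D l E) X = {0}\<close>] by blast
      then show ?thesis using v comp_0_right[OF A(2) El] by simp
    qed
    then show ?thesis using Hom_zero_iff[OF El A(6)] by blast
  qed
  define S where "S = {l. Hom D (sh D l E) X \<noteq> {0}}"
  have finS: "finite S" using fin_hom[OF E' A(5)] by (simp add: S_def fin_hom_def)
  have "vs.dim {0} = 0" using vs.dim_le_card[of "{0}" "{}"] by simp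
  then have "N C = (\<Sum>l\<in>S. vs.dim (Hom D (sh D l E) C))"
    using supp finS unfolding N_def by (intro sum.mono_neutral_left) (auto simp: S_def)
  also have "\<dots> < (\<Sum>l\<in>S. vs.dim (Hom D (sh D l E) X))"
  proof (rule sum_strict_mono_ex1[OF finS])
    have "l0 \<in> S" using A(1) u by (auto simp: S_def arr_def)
    then show "\<exists>l\<in>S. vs.dim (Hom D (sh D l E) C) < vs.dim (Hom D (sh D l E) X)" using less by blast
  qed (use le in blast)
  finally show ?thesis by (simp add: N_def S_def)
qed

end

section \<open>Exceptional sequences, their opposites, and splitting along a full one\<close>

context pretriangulated_category
begin

lemma exceptional_seq_iff:
  "exceptional_seq D Es \<longleftrightarrow>
     (\<forall>E\<in>set Es. exceptional D E) \<and> sorted_wrt (\<lambda>E F. orth D F E) Es"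
proof -
  have "(\<forall>l. Hom D (Es ! j) (sh D l (Es ! i)) = {0}) \<longleftrightarrow> orth D (Es ! j) (Es ! i)"
    if "\<forall>E\<in>set Es. exceptional D E" "i < j" "j < length Es" for i j
    using orth_iff_target that by (simp add: exceptional_iff)
  then show ?thesis
    unfolding exceptional_seq_def sorted_wrt_iff_nth_less all_set_conv_all_nth by metis
qed

lemma exceptional_seq_Ob: "exceptional_seq D Es \<Longrightarrow> set Es \<subseteq> Ob D"
  by (auto simp: exceptional_seq_iff exceptional_iff)

lemma exceptional_seq_opc: "exceptional_seq D Es \<Longrightarrow> exceptional_seq (opc D) (rev Es)"
proof -
  interpret op: pretriangulated_category "opc D" by (rule pretriangulated_opc)
  assume Es: "exceptional_seq D Es"
  then have "sorted_wrt (\<lambda>E F. orth D F E) Es" by (simp add: exceptional_seq_iff)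
  moreover have "orth (opc D) E F" if "E \<in> set Es" "F \<in> set Es" "orth D F E" for E F
    using exceptional_seq_Ob[OF Es] orth_opc that by blast
  ultimately have "sorted_wrt (\<lambda>E F. orth (opc D) E F) Es" by (metis (mono_tags, lifting) sorted_wrt_mono_rel)
  then show ?thesis using Es by (simp add: op.exceptional_seq_iff exceptional_seq_iff sorted_wrt_rev)
qed

end

locale full_exceptional_category = ext_finite_category +
  fixes Es
  assumes exceptional_seq: "exceptional_seq D Es" and full: "gen D (set Es) = Ob D"
begin

lemma full_exceptional_opc: "full_exceptional_category (opc D) (rev Es)"
proof -
  interpret op: ext_finite_category "opc D" by (rule ext_finite_opc)
  show ?thesis
    by unfold_locales (use exceptional_seq exceptional_seq_opc full in simp_all)
qed

lemma exceptional_nth: "i < length Es \<Longrightarrow> exceptional D (Es ! i)"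
  using exceptional_seq by (simp add: exceptional_seq_iff)

lemma orth_nth: "\<lbrakk>i < j; j < length Es\<rbrakk> \<Longrightarrow> orth D (Es ! j) (Es ! i)"
  using exceptional_seq by (simp add: exceptional_seq_iff sorted_wrt_iff_nth_less)

lemma nth_Ob: "i < length Es \<Longrightarrow> Es ! i \<in> Ob D"
  using exceptional_nth by (simp add: exceptional_iff)

lemma Es_Ob: "set Es \<subseteq> Ob D"
  using exceptional_seq_Ob exceptional_seq .

lemma idempotent_splits: "\<lbrakk>arr D X X e; e \<cdot> e = e\<rbrakk> \<Longrightarrow> splits D X e"
proof -
  have "splits D X e" if "k \<le> length Es" "arr D X X e" "e \<cdot> e = e"
      "\<And>j. \<lbrakk>k \<le> j; j < length Es\<rbrakk> \<Longrightarrow> orth D (Es ! j) X" for k X e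
    using that
  proof (induction k arbitrary: X e)
    case 0
    have X: "X \<in> Ob D" using arr_Ob[OF 0(2)] by blast
    have "orth D W X" if "W \<in> set Es" for W using 0(4) that by (auto simp: in_set_conv_nth)
    then have "zero_object D X" using zero_if_orth_gen[OF Es_Ob] full X by blast
    then have "e = Id D X" using 0(2) zero_object_arr zero_object_iff by metis
    then show ?case
      unfolding splits_def using arr_Id[OF X] comp_Id_left[OF arr_Id[OF X]] by blast
  next
    case (Suc k)
    define E where "E = Es ! k"
    have k: "k < length Es" using Suc.prems(1) by simp
    have E: "exceptional D E" "E \<in> Ob D" using exceptional_nth[OF k] nth_Ob[OF k] by (auto simp: E_def)
    \<comment> \<open>The measure of the inner induction, to which \<open>total_dim_drop\<close>
      applies.\<close>
    define N where "N = (\<lambda>X. (\<Sum>l | Hom D (sh D l E) X \<noteq> {0}. vs.dim (Hom D (sh D l E) X)))"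
    have "splits D X e" if "arr D X X e" "e \<cdot> e = e"
      "\<And>j. \<lbrakk>Suc k \<le> j; j < length Es\<rbrakk> \<Longrightarrow> orth D (Es ! j) X" for X e
      using that
    proof (induction "N X" arbitrary: X e rule: less_induct)
      case less
      have X: "X \<in> Ob D" using arr_Ob[OF less(2)] by blast
      show ?case
      proof (cases "orth D E X")
        case True
        have "orth D (Es ! j) X" if "k \<le> j" "j < length Es" for j
          using less(4)[of j] True that by (cases "j = k") (auto simp: E_def)
        then show ?thesis using Suc.IH[OF _ less(2,3)] k by simp
      next
        case False
        then obtain l x where x: "arr D (sh D l E) X x" "x \<noteq> 0"
          using Hom_zero_iff[OF sh_in_Ob[OF E(2)] X] by (auto simp: orth_def)
        have step: "splits D X e'"
          if e': "arr D X X e'" "e' \<cdot> e' = e'" "e' \<cdot> x \<noteq> 0" for e'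
        proof -
          have u: "arr D (sh D l E) X (e' \<cdot> x)" "e' \<cdot> (e' \<cdot> x) = e' \<cdot> x"
            using arr_cmp[OF x(1) e'(1)] comp_assoc[OF x(1) e'(1,1)] e'(2) by simp_all
          \<comment> \<open>This cone remains right orthogonal to the terms after position k,
            because these are orthogonal to E, while its measure is smaller.\<close>
          obtain C g h where T: "dist D (sh D l E) X C (e' \<cdot> x) g h" using cone[OF u(1)] .
          have "orth D (Es ! j) C" if j: "Suc k \<le> j" "j < length Es" for j
          proof -
            have "orth D (Es ! j) (sh D l E)"
              using orth_sh_right[OF nth_Ob[OF j(2)] E(2)] orth_nth[of k j] j by (simp add: E_def)
            then show ?thesis
              using thick_cone[OF thick_right_orth[of "{Es ! j}"] T] less(4)[OF j] nth_Ob[OF j(2)] X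
                sh_in_Ob[OF E(2)] by simp
          qed
          moreover have "N C < N X" using total_dim_drop[OF E(1) T e'(3)] by (simp add: N_def)
          ultimately have "splits D C f" if "arr D C C f" "f \<cdot> f = f" for f
            using less(1) that by blast
          then show ?thesis using splits_by_cone[OF T e'(1,2) u(2)] by blast
        qed
        \<comment> \<open>One of e and 1 - e does not kill \<open>x\<close>: if e x = 0, then 1 - e
          fixes it, and a splitting of 1 - e gives one of e.\<close>
        show ?thesis
        proof (cases "e \<cdot> x = 0")
          case False
          then show ?thesis using step less by blast
        next
          case True
          have I: "arr D X X (Id D X)" using X by blast
          note e'= arr_diff[OF I less(2)]
          have "(Id D X - e) \<cdot> (Id D X - e) = Id D X - e"
            using comp_diff_left[OF e' I less(2)] comp_Id_left[OF e']
              comp_diff_right[OF I less(2,2)] comp_Id_right[OF less(2)] less(3) by simp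
          moreover have "(Id D X - e) \<cdot> x \<noteq> 0"
            using comp_diff_left[OF x(1) I less(2)] comp_Id_left[OF x(1)] True x(2) by simp
          ultimately have "splits D X (Id D X - e)" using step[OF e'] by blast
          from splits_complement[OF this] show ?thesis by simp
        qed
      qed
    qed
    then show ?case using Suc.prems by blast
  qed
  from this[of "length Es"] show "\<lbrakk>arr D X X e; e \<cdot> e = e\<rbrakk> \<Longrightarrow> splits D X e" by simp
qed

end

section \<open>Approximations and adjoints\<close>

context pretriangulated_category
begin

lemma rap_self: "\<lbrakk>X \<in> B; X \<in> Ob D\<rbrakk> \<Longrightarrow> rap D B X X (Id D X)"
  unfolding rap_def using iso_rbij[OF iso_mor_Id] arr_Id by blast

lemma rap_shift:
  assumes B: "thick_subcategory D B" and r: "rap D B X b u"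
  shows "rap D B (sh D l X) (sh D l b) (shm D l u)"
  unfolding rap_def
proof (intro conjI ballI)
  have u: "arr D b X u" using r by (simp add: rap_def)
  show "sh D l b \<in> B" using thick_sh[OF B] r by (simp add: rap_def)
  show "arr D (sh D l b) (sh D l X) (shm D l u)" using u by (rule arr_shm)
  fix W assume W: "W \<in> B"
  then have "rbij D (sh D (- l) W) b X u" using r thick_sh[OF B] by (simp add: rap_def)
  then show "rbij D W (sh D l b) (sh D l X) (shm D l u)"
    using rbij_shift_iff[OF u thick_Ob[OF B W]] by simp
qed

lemma rap_unique:
  assumes B: "thick_subcategory D B" and r: "rap D B X b u" "rap D B X b' u'"
  shows "isomorphic D b b'"
proof -
  have b: "b \<in> B" "b' \<in> B" "arr D b X u" "arr D b' X u'" using r by (auto simp: rap_def)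
  obtain k where k: "arr D b b' k" "u' \<cdot> k = u" using rbijE[of D b b' X u' u] r b by (metis rap_def)
  have "rbij D W b b' k" if W: "W \<in> B" for W
    unfolding rbij_def
  proof (intro conjI allI impI)
    have uu: "rbij D W b X u" "rbij D W b' X u'" using r W by (auto simp: rap_def)
    { fix f assume f: "arr D W b f" "k \<cdot> f = 0"
      then have "u \<cdot> f = 0"
        using comp_assoc[OF f(1) k(1) b(4)] k(2) comp_0_right[OF b(4)] arr_Ob[OF f(1)] by simp
      then show "f = 0" using rbijD0[OF uu(1) f(1)] by simp }
    fix g assume g: "arr D W b' g"
    obtain f where f: "arr D W b f" "u \<cdot> f = u' \<cdot> g" using rbijE[OF uu(1) arr_cmp[OF g b(4)]] .
    then have "u' \<cdot> (k \<cdot> f) = u' \<cdot> g" using comp_assoc[OF f(1) k(1) b(4)] k(2) by simp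
    then have "k \<cdot> f = g" using rbij_inj[OF uu(2) b(4) arr_cmp[OF f(1) k(1)] g] by simp
    then show "\<exists>f. arr D W b f \<and> k \<cdot> f = g" using f by blast
  qed
  then show ?thesis using iso_if_rbij[OF k(1)] b thick_Ob[OF B] by (auto simp: isomorphic_def)
qed

lemma isomorphic_Hom_zero:
  assumes "isomorphic D Y Y'" "X \<in> Ob D" "Hom D X Y = {0}"
  shows "Hom D X Y' = {0}"
proof -
  obtain u where u: "iso_mor D Y Y' u" "Y \<in> Ob D" "Y' \<in> Ob D" using assms by (auto simp: isomorphic_def)
  then have "arr D Y Y' u" "rbij D X Y Y' u" using iso_rbij iso_mor_iff by auto
  then have "f = 0" if "arr D X Y' f" for f
    using rbijE[OF _ that] Hom_zeroD[OF assms(3)] comp_0_right assms(2) by metis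
  then show ?thesis using Hom_zero_iff assms u by blast
qed

lemma dist_from_third:
  assumes "X \<in> Ob D" "arr D Z (sh D 1 X) h" obtains Y f g where "dist D X Y Z f g h"
proof -
  obtain Q x y where "dist D Q Z (sh D 1 X) x h y" using cocone[OF assms(2)] .
  from rotate_back[OF this] show thesis using that assms(1) by simp
qed

text \<open>Closure under direct summands is the only place where idempotents have to split.\<close>

lemma thick_rap:
  assumes B: "thick_subcategory D B"
    and split: "\<And>X e. \<lbrakk>arr D X X e; e \<cdot> e = e\<rbrakk> \<Longrightarrow> splits D X e"
  shows "thick_subcategory D {X \<in> Ob D. \<exists>b u. rap D B X b u}"
  (is "thick_subcategory D ?T")
proof (rule thickI)
  fix Z assume "zero_object D Z"
  then have "Z \<in> Ob D" "rap D B Z Z (Id D Z)"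
    using rap_self[of Z B] thick_zero[OF B, of Z] zero_object_iff[of Z] by simp_all
  then show "Z \<in> ?T" by blast
next
  fix X l assume "X \<in> ?T"
  then show "sh D l X \<in> ?T"
    using rap_shift[OF B] sh_in_Ob by blast
next
  fix X Y Z f g h
  assume T: "dist D X Y Z f g h" and X: "X \<in> ?T"
    and Z: "Z \<in> ?T"
  note A = dist_arr[OF T]
  obtain a \<alpha> where a: "rap D B X a \<alpha>" using X by blast
  obtain c \<gamma> where c: "rap D B Z c \<gamma>" using Z by blast
  have ac: "a \<in> B" "c \<in> B" "arr D a X \<alpha>" "arr D c Z \<gamma>" using a c by (auto simp: rap_def)
  \<comment> \<open>The connecting map composed with \<open>\<gamma>\<close> lifts along the
    universal map to X[1]. The lift \<open>k\<close> determines a triangle whose middle term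
    approximates Y by the five lemma.\<close>
  have "rbij D c (sh D 1 a) (sh D 1 X) (shm D 1 \<alpha>)"
    using rap_shift[OF B a, of 1] ac by (simp add: rap_def)
  then obtain k where k: "arr D c (sh D 1 a) k" "shm D 1 \<alpha> \<cdot> k = h \<cdot> \<gamma>"
    using rbijE[OF _ arr_cmp[OF ac(4) A(3)]] by blast
  obtain b f' g' where T': "dist D a b c f' g' k"
    using dist_from_third[OF thick_Ob[OF B ac(1)] k(1)] .
  obtain \<beta> where \<beta>: "arr D b Y \<beta>" "\<beta> \<cdot> f' = f \<cdot> \<alpha>" "\<gamma> \<cdot> g' = g \<cdot> \<beta>"
    using TR3_second[OF T' T ac(3,4) k(2)] .
  have "rbij D W b Y \<beta>" if W: "W \<in> B" for W
    by (rule five_lemma[OF T' T ac(3) \<beta>(1) ac(4) \<beta>(2,3) k(2)])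
      (use a c W thick_sh[OF B W] thick_Ob[OF B W] in \<open>auto simp: rap_def\<close>)
  then have "rap D B Y b \<beta>" using thick_extension[OF B T' ac(1,2)] \<beta>(1) by (simp add: rap_def)
  then show "Y \<in> ?T" using A by blast
next
  fix X Y i p
  assume ip: "arr D Y X i" "arr D X Y p" "p \<cdot> i = Id D Y"
    and X: "X \<in> ?T"
  obtain b u where r: "rap D B X b u" using X by blast
  have b: "b \<in> B" "arr D b X u" "rbij D b b X u" using r by (auto simp: rap_def)
  define e where "e = i \<cdot> p"
  have e: "arr D X X e" unfolding e_def using arr_cmp[OF ip(2,1)] .
  have pe: "p \<cdot> e = p" using comp_assoc[OF ip(2,1,2)] ip(3) comp_Id_left[OF ip(2)] by (simp add: e_def)
  have ee: "e \<cdot> e = e" using comp_assoc[OF e ip(2,1)] pe by (simp add: e_def)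
  \<comment> \<open>By universality the idempotent e = i p of X lifts to an idempotent of
    \<open>b\<close>; the approximation of the retract Y is the image of the lift.\<close>
  obtain d where d: "arr D b b d" "u \<cdot> d = e \<cdot> u" using rbijE[OF b(3) arr_cmp[OF b(2) e]] .
  have "u \<cdot> (d \<cdot> d) = u \<cdot> d"
    using comp_assoc[OF d(1) d(1) b(2)] comp_assoc[OF d(1) b(2) e] d(2) comp_assoc[OF b(2) e e] ee by simp
  then have "d \<cdot> d = d" using rbij_inj[OF b(3,2) arr_cmp[OF d(1,1)] d(1)] by simp
  then have "splits D b d" using split d(1) by blast
  then obtain b1 j q where jq: "arr D b1 b j" "arr D b b1 q" "q \<cdot> j = Id D b1" "j \<cdot> q = d"
    by (auto simp: splits_def)
  have b1: "b1 \<in> B" using thick_retract[OF B jq(1-3) b(1)] .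
  have dj: "d \<cdot> j = j"
    using comp_assoc[OF jq(1,2,1)] jq(3,4) comp_Id_right[OF jq(1)] by simp
  define v where "v = p \<cdot> (u \<cdot> j)"
  have uj: "arr D b1 X (u \<cdot> j)" using arr_cmp[OF jq(1) b(2)] .
  have v: "arr D b1 Y v" unfolding v_def using arr_cmp[OF uj ip(2)] .
  have iv: "i \<cdot> v = u \<cdot> j"
    using comp_assoc[OF uj ip(2,1)] comp_assoc[OF jq(1) b(2) e] comp_assoc[OF jq(1) d(1) b(2)] d(2) dj
    by (simp add: v_def e_def)
  have "rbij D W b1 Y v" if W: "W \<in> B" for W
    unfolding rbij_def
  proof (intro conjI allI impI)
    have r: "rbij D W b X u" using r W by (simp add: rap_def)
    { fix w assume w: "arr D W b1 w" "v \<cdot> w = 0"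
      have "u \<cdot> (j \<cdot> w) = i \<cdot> (v \<cdot> w)"
        using comp_assoc[OF w(1) v ip(1)] comp_assoc[OF w(1) jq(1) b(2)] iv by simp
      then have "u \<cdot> (j \<cdot> w) = 0" using w(2) comp_0_right[OF ip(1)] arr_Ob[OF w(1)] by simp
      then have "j \<cdot> w = 0" using rbijD0[OF r arr_cmp[OF w(1) jq(1)]] by simp
      then show "w = 0"
        using comp_assoc[OF w(1) jq(1,2)] jq(3) comp_Id_left[OF w(1)] comp_0_right[OF jq(2)] arr_Ob[OF w(1)]
        by simp }
    fix y assume y: "arr D W Y y"
    obtain w where w: "arr D W b w" "u \<cdot> w = i \<cdot> y" using rbijE[OF r arr_cmp[OF y ip(1)]] .
    have "v \<cdot> (q \<cdot> w) = p \<cdot> (u \<cdot> (d \<cdot> w))"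
      using comp_assoc[OF arr_cmp[OF w(1) jq(2)] uj ip(2)] comp_assoc[OF arr_cmp[OF w(1) jq(2)] jq(1) b(2)]
        comp_assoc[OF w(1) jq(2,1)] jq(4) by (simp add: v_def)
    also have "u \<cdot> (d \<cdot> w) = e \<cdot> (i \<cdot> y)"
      using comp_assoc[OF w(1) d(1) b(2)] d(2) comp_assoc[OF w(1) b(2) e] w(2) by simp
    also have "p \<cdot> \<dots> = y"
      using comp_assoc[OF arr_cmp[OF y ip(1)] e ip(2)] pe comp_assoc[OF y ip(1,2)] ip(3)
        comp_Id_left[OF y] by simp
    finally show "\<exists>w. arr D W b1 w \<and> v \<cdot> w = y" using arr_cmp[OF w(1) jq(2)] by blast
  qed
  then have "rap D B Y b1 v" using b1 v by (simp add: rap_def)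
  then show "Y \<in> ?T" using arr_Ob[OF v] by blast
qed auto

text \<open>Functoriality follows from uniqueness of lifts along \<open>\<epsilon>\<close>. The
  action on morphisms receives neither source nor target as an argument; it is well defined because
  a nonzero morphism determines both, and the lift of 0 is 0 for every choice.\<close>

lemma right_adjoint_functor:
  assumes B: "B \<subseteq> Ob D" and r: "\<And>X. X \<in> Ob D \<Longrightarrow> \<exists>b u. rap D B X b u"
  obtains R\<^sub>o R\<^sub>m \<epsilon> where "linear_functor D R\<^sub>o R\<^sub>m" "\<And>X. X \<in> Ob D \<Longrightarrow> rap D B X (R\<^sub>o X) (\<epsilon> X)"
    "\<And>X Y f. arr D X Y f \<Longrightarrow> \<epsilon> Y \<cdot> R\<^sub>m f = f \<cdot> \<epsilon> X"
proof -
  obtain R \<epsilon> where R: "\<And>X. X \<in> Ob D \<Longrightarrow> rap D B X (R X) (\<epsilon> X)" using r by metis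
  have RO: "R X \<in> Ob D" "R X \<in> B" "arr D (R X) X (\<epsilon> X)" if "X \<in> Ob D" for X
    using R[OF that] B by (auto simp: rap_def)
  have inj: "h = h'" if "arr D (R X) (R Y) h" "arr D (R X) (R Y) h'" "\<epsilon> Y \<cdot> h = \<epsilon> Y \<cdot> h'"
    "X \<in> Ob D" "Y \<in> Ob D" for X Y h h'
  proof -
    have "rbij D (R X) (R Y) Y (\<epsilon> Y)" using R[OF that(5)] RO[OF that(4)] by (simp add: rap_def)
    then show ?thesis using rbij_inj[OF _ RO(3)[OF that(5)] that(1-3)] by simp
  qed
  define P where "P f h \<longleftrightarrow> (\<exists>X Y. arr D X Y f \<and> arr D (R X) (R Y) h \<and> \<epsilon> Y \<cdot> h = f \<cdot> \<epsilon> X)" for f h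
  have uniq: "h = h'" if P: "P f h" "P f h'" for f h h'
  proof -
    obtain X Y where XY: "arr D X Y f" "arr D (R X) (R Y) h" "\<epsilon> Y \<cdot> h = f \<cdot> \<epsilon> X"
      using P(1) by (auto simp: P_def)
    obtain X' Y' where XY': "arr D X' Y' f" "arr D (R X') (R Y') h'" "\<epsilon> Y' \<cdot> h' = f \<cdot> \<epsilon> X'"
      using P(2) by (auto simp: P_def)
    note O = arr_Ob[OF XY(1)] and O' = arr_Ob[OF XY'(1)]
    show ?thesis
    proof (cases "f = 0")
      case True
      have "h = 0"
        by (rule inj[OF XY(2)])
          (use True XY(3) O RO comp_0_left[OF RO(3)[OF O(1)] O(2)] comp_0_right[OF RO(3)[OF O(2)] RO(1)[OF O(1)]] in auto)
      moreover have "h' = 0"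
        by (rule inj[OF XY'(2)])
          (use True XY'(3) O' RO comp_0_left[OF RO(3)[OF O'(1)] O'(2)] comp_0_right[OF RO(3)[OF O'(2)] RO(1)[OF O'(1)]] in auto)
      ultimately show ?thesis by simp
    next
      case False
      then have "X = X'" "Y = Y'" using Hom_disjoint XY(1) XY'(1) unfolding arr_def by blast+
      then show ?thesis using inj[OF XY(2)] XY XY' O by simp
    qed
  qed
  define Rm where "Rm f = (THE h. P f h)" for f
  have Rm_eqI: "Rm f = h" if "arr D X Y f" "arr D (R X) (R Y) h" "\<epsilon> Y \<cdot> h = f \<cdot> \<epsilon> X" for X Y f h
  proof -
    have "P f h" using that by (auto simp: P_def)
    then show ?thesis unfolding Rm_def using uniq by blast
  qed
  have Rm: "arr D (R X) (R Y) (Rm f)" "\<epsilon> Y \<cdot> Rm f = f \<cdot> \<epsilon> X" if f: "arr D X Y f" for X Y f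
  proof -
    note O = arr_Ob[OF f]
    have "rbij D (R X) (R Y) Y (\<epsilon> Y)" using R[OF O(2)] RO[OF O(1)] by (simp add: rap_def)
    then obtain h where h: "arr D (R X) (R Y) h" "\<epsilon> Y \<cdot> h = f \<cdot> \<epsilon> X"
      using rbijE[OF _ arr_cmp[OF RO(3)[OF O(1)] f]] by blast
    then show "arr D (R X) (R Y) (Rm f)" "\<epsilon> Y \<cdot> Rm f = f \<cdot> \<epsilon> X" using Rm_eqI[OF f h] by auto
  qed
  have "linear_functor D R Rm"
    unfolding linear_functor_def
  proof (intro conjI ballI allI)
    fix X assume X: "X \<in> Ob D"
    show "R X \<in> Ob D" using RO X by blast
    show "Rm (Id D X) = Id D (R X)"
      using Rm_eqI[OF arr_Id[OF X] arr_Id[OF RO(1)[OF X]]] comp_Id_left[OF RO(3)[OF X]]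
        comp_Id_right[OF RO(3)[OF X]] by simp
    fix Y assume Y: "Y \<in> Ob D"
    fix f assume "f \<in> Hom D X Y"
    then have f: "arr D X Y f" using X Y by (simp add: arr_def)
    show "Rm f \<in> Hom D (R X) (R Y)" using Rm(1)[OF f] by (simp add: arr_def)
    { fix f' assume "f' \<in> Hom D X Y"
      then have f': "arr D X Y f'" using X Y by (simp add: arr_def)
      show "Rm (f + f') = Rm f + Rm f'"
        by (rule Rm_eqI[OF arr_add[OF f f'] arr_add[OF Rm(1)[OF f] Rm(1)[OF f']]])
          (use comp_add_right[OF Rm(1)[OF f] Rm(1)[OF f'] RO(3)[OF Y]] Rm(2)[OF f] Rm(2)[OF f']
            comp_add_left[OF RO(3)[OF X] f f'] in simp) }
    fix c
    show "Rm (scl D c f) = scl D c (Rm f)"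
      by (rule Rm_eqI[OF arr_scl[OF f] arr_scl[OF Rm(1)[OF f]]])
        (use comp_scl_right[OF Rm(1)[OF f] RO(3)[OF Y]] Rm(2)[OF f] comp_scl_left[OF RO(3)[OF X] f] in simp)
  next
    fix X Y Z f g assume X: "X \<in> Ob D" and Y: "Y \<in> Ob D" and Z: "Z \<in> Ob D"
      and "f \<in> Hom D X Y" "g \<in> Hom D Y Z"
    then have fg: "arr D X Y f" "arr D Y Z g" by (simp_all add: arr_def)
    show "Rm (g \<cdot> f) = Rm g \<cdot> Rm f"
    proof (rule Rm_eqI[OF arr_cmp[OF fg] arr_cmp[OF Rm(1)[OF fg(1)] Rm(1)[OF fg(2)]]])
      have "\<epsilon> Z \<cdot> (Rm g \<cdot> Rm f) = (g \<cdot> \<epsilon> Y) \<cdot> Rm f"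
        using comp_assoc[OF Rm(1)[OF fg(1)] Rm(1)[OF fg(2)] RO(3)[OF Z]] Rm(2)[OF fg(2)] by simp
      also have "\<dots> = (g \<cdot> f) \<cdot> \<epsilon> X"
        using comp_assoc[OF Rm(1)[OF fg(1)] RO(3)[OF Y] fg(2)] Rm(2)[OF fg(1)]
          comp_assoc[OF RO(3)[OF X] fg] by simp
      finally show "\<epsilon> Z \<cdot> (Rm g \<cdot> Rm f) = (g \<cdot> f) \<cdot> \<epsilon> X" .
    qed
  qed
  then show thesis using that R Rm(2) by blast
qed

text \<open>The cone Z of R f maps to Y3 by a morphism of triangles, and the five lemma makes this
  map universal. The resulting comparison \<open>k\<close> from Z to R Y3 has a left inverse and
  carries \<open>p\<close> to R g, so whatever R g kills is killed by \<open>p\<close> and lifts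
  along R f.\<close>

lemma adjoint_hom_exact:
  assumes B: "thick_subcategory D B" and F: "linear_functor D R\<^sub>o R\<^sub>m"
    and r: "\<And>X. X \<in> Ob D \<Longrightarrow> rap D B X (R\<^sub>o X) (\<epsilon> X)"
    and nat: "\<And>X Y f. arr D X Y f \<Longrightarrow> \<epsilon> Y \<cdot> R\<^sub>m f = f \<cdot> \<epsilon> X"
  shows "hom_exact D R\<^sub>o R\<^sub>m X"
  unfolding hom_exact_def
proof (intro allI impI)
  fix Y1 Y2 Y3 f g h s
  assume T: "dist D Y1 Y2 Y3 f g h" and s: "arr D X (R\<^sub>o Y2) s" "R\<^sub>m g \<cdot> s = 0"
  note A = dist_arr[OF T]
  note Rf = functor_arr[OF F A(1)] and Rg = functor_arr[OF F A(2)]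
  have \<epsilon>: "arr D (R\<^sub>o Y) Y (\<epsilon> Y)" "R\<^sub>o Y \<in> B" if "Y \<in> Ob D" for Y using r[OF that] by (auto simp: rap_def)
  obtain Z p q where TZ: "dist D (R\<^sub>o Y1) (R\<^sub>o Y2) Z (R\<^sub>m f) p q" using cone[OF Rf] .
  note AZ = dist_arr[OF TZ]
  obtain z where z: "arr D Z Y3 z" "z \<cdot> p = g \<cdot> \<epsilon> Y2" "shm D 1 (\<epsilon> Y1) \<cdot> q = h \<cdot> z"
    using TR3_third[OF TZ T \<epsilon>(1)[OF A(4)] \<epsilon>(1)[OF A(5)] nat[OF A(1)]] .
  have ZB: "Z \<in> B" using thick_cone[OF B TZ] \<epsilon>(2) A by blast
  have eq: "shm D 1 (\<epsilon> Y2) \<cdot> (- shm D 1 (R\<^sub>m f)) = (- shm D 1 f) \<cdot> shm D 1 (\<epsilon> Y1)"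
    using comp_minus_right[OF arr_shm[OF Rf] arr_shm[OF \<epsilon>(1)[OF A(5)]]]
      comp_minus_left[OF arr_shm[OF \<epsilon>(1)[OF A(4)]] arr_shm[OF A(1)]]
      shm_comp[OF Rf \<epsilon>(1)[OF A(5)]] shm_comp[OF \<epsilon>(1)[OF A(4)] A(1)] nat[OF A(1)] by simp
  have zW: "rbij D W Z Y3 z" if W: "W \<in> B" for W
    by (rule five_lemma[OF rotate[OF TZ] rotate[OF T] \<epsilon>(1)[OF A(5)] z(1) arr_shm[OF \<epsilon>(1)[OF A(4)]]
        z(2,3) eq])
      (use r A rap_shift[OF B r[OF A(4)]] W thick_sh[OF B W] thick_Ob[OF B W] in \<open>auto simp: rap_def\<close>)
  have zr: "rap D B Y3 Z z" using ZB z(1) zW by (simp add: rap_def)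
  obtain k where k: "arr D Z (R\<^sub>o Y3) k" "\<epsilon> Y3 \<cdot> k = z"
    using rbijE[of D Z "R\<^sub>o Y3" Y3 "\<epsilon> Y3" z] r[OF A(6)] ZB z(1) by (metis rap_def)
  obtain k' where k': "arr D (R\<^sub>o Y3) Z k'" "z \<cdot> k' = \<epsilon> Y3"
    using rbijE[OF zW[OF \<epsilon>(2)[OF A(6)]] \<epsilon>(1)[OF A(6)]] .
  have "z \<cdot> (k' \<cdot> k) = z \<cdot> Id D Z"
    using comp_assoc[OF k(1) k'(1) z(1)] k'(2) k(2) comp_Id_right[OF z(1)] by simp
  then have k'k: "k' \<cdot> k = Id D Z"
    using rbij_inj[OF zW[OF ZB] z(1) arr_cmp[OF k(1) k'(1)] arr_Id[OF AZ(6)]] by simp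
  have "\<epsilon> Y3 \<cdot> (k \<cdot> p) = \<epsilon> Y3 \<cdot> R\<^sub>m g"
    using comp_assoc[OF AZ(2) k(1) \<epsilon>(1)[OF A(6)]] k(2) z(2) nat[OF A(2)] by simp
  moreover have "rbij D (R\<^sub>o Y2) (R\<^sub>o Y3) Y3 (\<epsilon> Y3)"
    using r[OF A(6)] \<epsilon>(2)[OF A(5)] by (simp add: rap_def)
  ultimately have kp: "k \<cdot> p = R\<^sub>m g"
    using rbij_inj[OF _ \<epsilon>(1)[OF A(6)] arr_cmp[OF AZ(2) k(1)] Rg] by blast
  note ps = arr_cmp[OF s(1) AZ(2)]
  have "k \<cdot> (p \<cdot> s) = 0" using comp_assoc[OF s(1) AZ(2) k(1)] kp s(2) by simp
  then have "p \<cdot> s = 0"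
    using comp_assoc[OF ps k(1) k'(1)] k'k comp_Id_left[OF ps] comp_0_right[OF k'(1)] arr_Ob[OF s(1)]
    by simp
  then obtain t where "arr D X (R\<^sub>o Y1) t" "R\<^sub>m f \<cdot> t = s" using lift_first[OF TZ s(1)] by blast
  then show "\<exists>t. arr D X (R\<^sub>o Y1) t \<and> R\<^sub>m f \<cdot> t = s" by blast
qed

lemma biproduct:
  assumes "X \<in> Ob D" "Y \<in> Ob D"
  obtains Q i j p q where "arr D X Q i" "arr D Y Q j" "arr D Q X p" "arr D Q Y q"
    "p \<cdot> i = Id D X" "q \<cdot> j = Id D Y" "p \<cdot> j = 0" "q \<cdot> i = 0" "i \<cdot> p + j \<cdot> q = Id D Q"
proof -
  obtain Q \<iota> \<pi> where Q: "direct_sum D UNIV (\<lambda>b. if b then X else Y) Q \<iota> \<pi>"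
    using direct_sum_exists[OF finite[of UNIV], of "\<lambda>b. if b then X else Y"] assms by metis
  have "arr D X Q (\<iota> True)" "arr D Y Q (\<iota> False)" "arr D Q X (\<pi> True)" "arr D Q Y (\<pi> False)"
    using direct_sum_arr[OF Q, of True] direct_sum_arr[OF Q, of False] by simp_all
  moreover have "\<pi> True \<cdot> \<iota> True = Id D X" "\<pi> False \<cdot> \<iota> False = Id D Y" "\<pi> True \<cdot> \<iota> False = 0"
    "\<pi> False \<cdot> \<iota> True = 0"
    using direct_sum_eq[OF Q, of True True] direct_sum_eq[OF Q, of False False]
      direct_sum_eq[OF Q, of True False] direct_sum_eq[OF Q, of False True] by simp_all
  moreover have "\<iota> True \<cdot> \<pi> True + \<iota> False \<cdot> \<pi> False = Id D Q"
    using Q by (simp add: direct_sum_def UNIV_bool add.commute)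
  ultimately show thesis by (rule that)
qed

text \<open>
  Enlarging the range of \<open>Y\<close> for which \<open>W\<close> represents $Hom(X,FY)$ by $\langle E \rangle$: the new
  object is the pullback of $W \to b_1 \leftarrow b_0$, where \<open>b\<^sub>1\<close> approximates \<open>W\<close> and \<open>b\<^sub>0\<close> represents
  the functor on $\langle E \rangle$.
\<close>

lemma corepresentation_step:
  assumes F: "linear_functor D F\<^sub>o F\<^sub>m" and ex: "hom_exact D F\<^sub>o F\<^sub>m X" and \<xi>: "arr D X (F\<^sub>o W) \<xi>"
    and B: "thick_subcategory D B" and W: "W \<in> Ob D"
    and v: "lap D B W b1 v" and b0: "b0 \<in> B" and \<eta>: "arr D X (F\<^sub>o b0) \<eta>"
    and c0: "\<And>Y. Y \<in> B \<Longrightarrow> crep D F\<^sub>o F\<^sub>m X b0 \<eta> Y"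
  obtains W' \<xi>' where "W' \<in> Ob D" "arr D X (F\<^sub>o W') \<xi>'"
    "\<And>Y. Y \<in> B \<Longrightarrow> crep D F\<^sub>o F\<^sub>m X W' \<xi>' Y"
    "\<And>Y. \<lbrakk>Y \<in> Ob D; \<And>b. b \<in> B \<Longrightarrow> Hom D b Y = {0}; crep D F\<^sub>o F\<^sub>m X W \<xi> Y\<rbrakk>
      \<Longrightarrow> crep D F\<^sub>o F\<^sub>m X W' \<xi>' Y"
proof -
  have v': "b1 \<in> B" "arr D W b1 v" using v by (auto simp: rap_def)
  have O: "b0 \<in> Ob D" "b1 \<in> Ob D" using thick_Ob[OF B] b0 v' by auto
  \<comment> \<open>The image of \<open>\<xi>\<close> under \<open>v\<close> is an element of
    Hom(X,F b1); since \<open>b0\<close> represents the functor on B, it comes from a unique map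
    from b0 to b1.\<close>
  obtain \<theta> where \<theta>: "arr D b0 b1 \<theta>" "F\<^sub>m \<theta> \<cdot> \<eta> = F\<^sub>m v \<cdot> \<xi>"
    using crepE[OF c0[OF v'(1)] arr_cmp[OF \<xi> functor_arr[OF F v'(2)]]] .
  obtain Q i j p q where Q: "arr D W Q i" "arr D b0 Q j" "arr D Q W p" "arr D Q b0 q"
    "p \<cdot> i = Id D W" "q \<cdot> j = Id D b0" "p \<cdot> j = 0" "q \<cdot> i = 0" "i \<cdot> p + j \<cdot> q = Id D Q"
    using biproduct[OF W O(1)] .
  define d where "d = v \<cdot> p - \<theta> \<cdot> q"
  note vp = arr_cmp[OF Q(3) v'(2)] and \<theta>q = arr_cmp[OF Q(4) \<theta>(1)]
  have d: "arr D Q b1 d" unfolding d_def using arr_diff[OF vp \<theta>q] .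
  have di: "d \<cdot> i = v"
    using comp_diff_left[OF Q(1) vp \<theta>q] comp_assoc[OF Q(1,3) v'(2)] comp_assoc[OF Q(1,4) \<theta>(1)] Q(5,8)
      comp_Id_right[OF v'(2)] comp_0_right[OF \<theta>(1) W] by (simp add: d_def)
  have dj: "d \<cdot> j = - \<theta>"
    using comp_diff_left[OF Q(2) vp \<theta>q] comp_assoc[OF Q(2,3) v'(2)] comp_assoc[OF Q(2,4) \<theta>(1)] Q(6,7)
      comp_Id_right[OF \<theta>(1)] comp_0_right[OF v'(2) O(1)] by (simp add: d_def)
  obtain W' r k where T: "dist D W' Q b1 r d k" using cocone[OF d] .
  note A = dist_arr[OF T]
  note FF = functor_arr[OF F]
  note i\<xi> = arr_cmp[OF \<xi> FF[OF Q(1)]] and j\<eta> = arr_cmp[OF \<eta> FF[OF Q(2)]]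
  \<comment> \<open>The pair of \<open>\<xi>\<close> and \<open>\<eta>\<close> as an element of
    Hom(X,FQ). The choice of \<open>\<theta>\<close> makes \<open>d\<close> kill it, so it lifts to
    W'.\<close>
  define \<zeta> where "\<zeta> = F\<^sub>m i \<cdot> \<xi> + F\<^sub>m j \<cdot> \<eta>"
  have \<zeta>: "arr D X (F\<^sub>o Q) \<zeta>" unfolding \<zeta>_def using arr_add[OF i\<xi> j\<eta>] .
  have act: "F\<^sub>m g \<cdot> \<zeta> = F\<^sub>m (g \<cdot> i) \<cdot> \<xi> + F\<^sub>m (g \<cdot> j) \<cdot> \<eta>" if g: "arr D Q Y g" for g Y
    using comp_add_right[OF i\<xi> j\<eta> FF[OF g]] comp_assoc[OF \<xi> FF[OF Q(1)] FF[OF g]]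
      comp_assoc[OF \<eta> FF[OF Q(2)] FF[OF g]] functor_comp[OF F Q(1) g] functor_comp[OF F Q(2) g]
    by (simp add: \<zeta>_def)
  have X: "X \<in> Ob D" using arr_Ob[OF \<xi>] by simp
  have "F\<^sub>m (- \<theta>) = - F\<^sub>m \<theta>" using functor_scl[OF F \<theta>(1), of "- 1"] by simp
  then have "F\<^sub>m d \<cdot> \<zeta> = 0"
    using act[OF d] di dj \<theta>(2) comp_minus_left[OF \<eta> FF[OF \<theta>(1)]] by simp
  then obtain \<xi>' where \<xi>': "arr D X (F\<^sub>o W') \<xi>'" "F\<^sub>m r \<cdot> \<xi>' = \<zeta>" using hom_exactE[OF ex T \<zeta>] by blast
  have eval: "F\<^sub>m (g \<cdot> r) \<cdot> \<xi>' = F\<^sub>m (g \<cdot> i) \<cdot> \<xi> + F\<^sub>m (g \<cdot> j) \<cdot> \<eta>" if g: "arr D Q Y g" for g Y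
    using functor_comp[OF F A(1) g] comp_assoc[OF \<xi>'(1) FF[OF A(1)] FF[OF g]] \<xi>'(2) act[OF g] by simp
  have split_Q: "g = (g \<cdot> i) \<cdot> p + (g \<cdot> j) \<cdot> q" if g: "arr D Q Y g" for g Y
    using comp_add_right[OF arr_cmp[OF Q(3,1)] arr_cmp[OF Q(4,2)] g] comp_assoc[OF Q(3,1) g]
      comp_assoc[OF Q(4,2) g] Q(9) comp_Id_right[OF g] by simp
  have k: "arr D (sh D (- 1) b1) W' (- shm D (- 1) k)" using dist_arr(1)[OF rotate_back[OF T]] .
  show thesis
  proof (rule that[of W' \<xi>'])
    show "W' \<in> Ob D" "arr D X (F\<^sub>o W') \<xi>'" using A \<xi>' by auto
    fix Y assume Y: "Y \<in> Ob D"
    { assume B0: "\<And>b. b \<in> B \<Longrightarrow> Hom D b Y = {0}" and cr: "crep D F\<^sub>o F\<^sub>m X W \<xi> Y"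
      have eval1: "F\<^sub>m (g \<cdot> (p \<cdot> r)) \<cdot> \<xi>' = F\<^sub>m g \<cdot> \<xi>" if g: "arr D W Y g" for g
      proof -
        have "(g \<cdot> p) \<cdot> i = g" "(g \<cdot> p) \<cdot> j = 0"
          using comp_assoc[OF Q(1,3) g] comp_assoc[OF Q(2,3) g] Q(5,7) comp_Id_right[OF g]
            comp_0_right[OF g O(1)] by simp_all
        then show ?thesis
          using eval[OF arr_cmp[OF Q(3) g]] comp_assoc[OF A(1) Q(3) g] functor_0[OF F X]
            comp_0_left[OF \<eta> functor_Ob[OF F Y]] by simp
      qed
      \<comment> \<open>Neither b0 nor b1[-1] maps nontrivially to such a Y, so every map from W' to
        Y comes from W.\<close>
      have factor: "\<exists>g. arr D W Y g \<and> g \<cdot> (p \<cdot> r) = f" if f: "arr D W' Y f" for f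
      proof -
        have "f \<cdot> (- shm D (- 1) k) = 0"
          using Hom_zeroD[OF B0[OF thick_sh[OF B v'(1)]] arr_cmp[OF k f]] .
        then obtain f' where f': "arr D Q Y f'" "f' \<cdot> r = f" using extend_first[OF T f] by blast
        have "f' \<cdot> j = 0" using Hom_zeroD[OF B0[OF b0] arr_cmp[OF Q(2) f'(1)]] .
        then have "f' = (f' \<cdot> i) \<cdot> p"
          using split_Q[OF f'(1)] comp_0_left[OF Q(4) Y] by simp
        then have "(f' \<cdot> i) \<cdot> (p \<cdot> r) = f"
          using comp_assoc[OF A(1) Q(3) arr_cmp[OF Q(1) f'(1)]] f'(2) by simp
        then show ?thesis using arr_cmp[OF Q(1) f'(1)] by blast
      qed
      show "crep D F\<^sub>o F\<^sub>m X W' \<xi>' Y"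
        unfolding crep_def
      proof (intro conjI allI impI)
        fix f assume f: "arr D W' Y f" "F\<^sub>m f \<cdot> \<xi>' = 0"
        obtain g where g: "arr D W Y g" "g \<cdot> (p \<cdot> r) = f" using factor[OF f(1)] by blast
        then have "g = 0" using crepD0[OF cr g(1)] eval1[OF g(1)] f(2) by simp
        then show "f = 0" using g(2) comp_0_left[OF arr_cmp[OF A(1) Q(3)] Y] by simp
      next
        fix s assume "arr D X (F\<^sub>o Y) s"
        then obtain g where g: "arr D W Y g" "F\<^sub>m g \<cdot> \<xi> = s" using crepE[OF cr] by blast
        then show "\<exists>f. arr D W' Y f \<and> F\<^sub>m f \<cdot> \<xi>' = s"
          using eval1[OF g(1)] arr_cmp[OF arr_cmp[OF A(1) Q(3)] g(1)] by auto
      qed }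
  next
    fix Y assume YB: "Y \<in> B"
    have Y: "Y \<in> Ob D" using thick_Ob[OF B YB] .
    have eval2: "F\<^sub>m (g \<cdot> (q \<cdot> r)) \<cdot> \<xi>' = F\<^sub>m g \<cdot> \<eta>" if g: "arr D b0 Y g" for g
    proof -
      have "(g \<cdot> q) \<cdot> j = g" "(g \<cdot> q) \<cdot> i = 0"
        using comp_assoc[OF Q(1,4) g] comp_assoc[OF Q(2,4) g] Q(6,8) comp_Id_right[OF g]
          comp_0_right[OF g W] by simp_all
      then show ?thesis
        using eval[OF arr_cmp[OF Q(4) g]] comp_assoc[OF A(1) Q(4) g] functor_0[OF F X]
          comp_0_left[OF \<xi> functor_Ob[OF F Y]] by simp
    qed
    have factor: "\<exists>g. arr D b0 Y g \<and> g \<cdot> (q \<cdot> r) = f" if f: "arr D W' Y f" for f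
    proof -
      \<comment> \<open>The obstruction to extending \<open>f\<close> along \<open>r\<close>. Its
        shift, a map from b1 to Y[1], vanishes after composition with \<open>d\<close>, hence with
        \<open>v\<close>, and universality of \<open>v\<close> makes it zero.\<close>
      define x where "x = f \<cdot> (- shm D (- 1) k)"
      have x: "arr D (sh D (- 1) b1) Y x" unfolding x_def using arr_cmp[OF k f] .
      have d': "arr D (sh D (- 1) Q) (sh D (- 1) b1) (shm D (- 1) d)" using arr_shm[OF d] .
      have "(- shm D (- 1) k) \<cdot> (- shm D (- 1) d) = 0"
        using dist_comp_zero[OF rotate_back[OF rotate_back[OF T]]] by simp
      then have "(- shm D (- 1) k) \<cdot> shm D (- 1) d = 0" using comp_minus_right[OF d' k] by simp
      then have xd: "x \<cdot> shm D (- 1) d = 0"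
        using comp_assoc[OF d' k f] comp_0_right[OF f] arr_Ob[OF d'] by (simp add: x_def)
      have x1: "arr D b1 (sh D 1 Y) (shm D 1 x)" using arr_shm[OF x, of 1] O by simp
      have "shm D 1 x \<cdot> d = 0"
        using arg_cong[OF xd, of "shm D 1"] shm_comp[OF d' x, of 1] shm_inverse(1)[OF d, of 1] by simp
      then have "shm D 1 x \<cdot> v = 0"
        using comp_assoc[OF Q(1) d x1] di comp_0_left[OF Q(1) sh_in_Ob[OF Y]] by simp
      moreover have "lbij D (sh D 1 Y) W b1 v" using v thick_sh[OF B YB] by (simp add: rap_def)
      ultimately have "shm D 1 x = 0" using lbijD0[OF _ x1] by blast
      then have "x = 0" using shm_eq_0_iff[OF x] by simp
      then obtain f' where f': "arr D Q Y f'" "f' \<cdot> r = f"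
        using extend_first[OF T f] by (auto simp: x_def)
      have "lbij D Y W b1 v" using v YB by (simp add: rap_def)
      then obtain y where y: "arr D b1 Y y" "y \<cdot> v = f' \<cdot> i"
        using lbijE[OF _ arr_cmp[OF Q(1) f'(1)]] by blast
      \<comment> \<open>Subtracting y d, which vanishes on W', removes the component of f' on W;
        what is left of f' is z q.\<close>
      define z where "z = f' \<cdot> j + y \<cdot> \<theta>"
      have z: "arr D b0 Y z" unfolding z_def using arr_add[OF arr_cmp[OF Q(2) f'(1)] arr_cmp[OF \<theta>(1) y(1)]] .
      have yd: "y \<cdot> d = (f' \<cdot> i) \<cdot> p - (y \<cdot> \<theta>) \<cdot> q"
        using comp_diff_right[OF vp \<theta>q y(1)] comp_assoc[OF Q(3) v'(2) y(1)] y(2)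
          comp_assoc[OF Q(4) \<theta>(1) y(1)] by (simp add: d_def)
      have zq: "z \<cdot> q = (f' \<cdot> j) \<cdot> q + (y \<cdot> \<theta>) \<cdot> q"
        using comp_add_left[OF Q(4) arr_cmp[OF Q(2) f'(1)] arr_cmp[OF \<theta>(1) y(1)]] by (simp add: z_def)
      have "f' = (f' \<cdot> i) \<cdot> p + (f' \<cdot> j) \<cdot> q" using split_Q[OF f'(1)] .
      also have "\<dots> = y \<cdot> d + z \<cdot> q" unfolding yd zq by simp
      finally have "f = (y \<cdot> d) \<cdot> r + (z \<cdot> q) \<cdot> r"
        using f'(2) comp_add_left[OF A(1) arr_cmp[OF d y(1)] arr_cmp[OF Q(4) z]] by simp
      also have "(y \<cdot> d) \<cdot> r = 0"
        using comp_assoc[OF A(1) d y(1)] dist_comp_zero[OF T] comp_0_right[OF y(1)] A by simp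
      finally have "z \<cdot> (q \<cdot> r) = f" using comp_assoc[OF A(1) Q(4) z] by simp
      then show ?thesis using z by blast
    qed
    show "crep D F\<^sub>o F\<^sub>m X W' \<xi>' Y"
      unfolding crep_def
    proof (intro conjI allI impI)
      fix f assume f: "arr D W' Y f" "F\<^sub>m f \<cdot> \<xi>' = 0"
      obtain g where g: "arr D b0 Y g" "g \<cdot> (q \<cdot> r) = f" using factor[OF f(1)] by blast
      then have "g = 0" using crepD0[OF c0[OF YB] g(1)] eval2[OF g(1)] f(2) by simp
      then show "f = 0" using g(2) comp_0_left[OF arr_cmp[OF A(1) Q(4)] Y] by simp
    next
      fix s assume "arr D X (F\<^sub>o Y) s"
      then obtain g where g: "arr D b0 Y g" "F\<^sub>m g \<cdot> \<eta> = s" using crepE[OF c0[OF YB]] by blast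
      then show "\<exists>f. arr D W' Y f \<and> F\<^sub>m f \<cdot> \<xi>' = s"
        using eval2[OF g(1)] arr_cmp[OF arr_cmp[OF A(1) Q(4)] g(1)] by auto
    qed
  qed
qed

end

lemma linear_functor_opc [simp]: "linear_functor (opc D) F\<^sub>o F\<^sub>m \<longleftrightarrow> linear_functor D F\<^sub>o F\<^sub>m"
  by (auto simp: linear_functor_def)

section \<open>From universal maps to admissibility\<close>

context pretriangulated_category
begin

lemma rap_zero:
  assumes B: "thick_subcategory D B" and X: "X \<in> Ob D" "\<And>W. W \<in> B \<Longrightarrow> Hom D W X = {0}"
  shows "\<exists>b u. rap D B X b u"
proof -
  obtain Z where Z: "zero_object D Z" using obtain_zero_object .
  then have ZO: "Z \<in> Ob D" by (simp add: zero_object_iff)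
  have "rbij D W Z X 0" if W: "W \<in> B" for W
  proof -
    have WO: "W \<in> Ob D" using thick_Ob[OF B W] .
    have "arr D W Z 0" "0 \<cdot> 0 = (0 :: 'b)" using WO ZO X(1) comp_0_right[of Z X 0 W] by auto
    then show ?thesis
      unfolding rbij_def using zero_object_arr(1)[OF Z] Hom_zeroD[OF X(2)[OF W]] by metis
  qed
  then have "rap D B X Z 0" using thick_zero[OF B Z] ZO X(1) by (auto simp: rap_def)
  then show ?thesis by blast
qed

lemma rap_trans:
  assumes "rap D A X a \<alpha>" "rap D B a b \<beta>" "B \<subseteq> A"
  shows "rap D B X b (\<alpha> \<cdot> \<beta>)"
  using assms rbij_comp arr_cmp unfolding rap_def by (metis subsetD)

lemma right_admissibleI:
  assumes B: "thick_subcategory D B" and r: "\<And>X. X \<in> Ob D \<Longrightarrow> \<exists>b u. rap D B X b u"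
  shows "right_admissible D B"
proof (rule right_adjoint_functor[OF _ r])
  show "B \<subseteq> Ob D" using thick_Ob[OF B] by blast
  fix R\<^sub>o R\<^sub>m \<epsilon>
  assume F: "linear_functor D R\<^sub>o R\<^sub>m" and r: "\<And>X. X \<in> Ob D \<Longrightarrow> rap D B X (R\<^sub>o X) (\<epsilon> X)"
    and nat: "\<And>X Y f. arr D X Y f \<Longrightarrow> \<epsilon> Y \<cdot> R\<^sub>m f = f \<cdot> \<epsilon> X"
  have RX: "R\<^sub>o X \<in> B" "R\<^sub>o X \<in> Ob D" "arr D (R\<^sub>o X) X (\<epsilon> X)" if "X \<in> Ob D" for X
    using r[OF that] by (auto simp: rap_def arr_def)
  have b: "bij_betw (\<lambda>f. \<epsilon> X \<cdot> f) (Hom D b (R\<^sub>o X)) (Hom D b X)"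
    if b: "b \<in> B" and X: "X \<in> Ob D" for b X
  proof -
    have bO: "b \<in> Ob D" using thick_Ob[OF B b] .
    have rb: "rbij D b (R\<^sub>o X) X (\<epsilon> X)" using r[OF X] b by (simp add: rap_def)
    note \<epsilon> = RX(3)[OF X]
    have "inj_on (\<lambda>f. \<epsilon> X \<cdot> f) (Hom D b (R\<^sub>o X))"
      using rbij_inj[OF rb \<epsilon>] bO RX(2)[OF X] by (auto simp: inj_on_def arr_def)
    moreover have "\<epsilon> X \<cdot> f \<in> Hom D b X" if "f \<in> Hom D b (R\<^sub>o X)" for f
      using arr_cmp[OF arrI[OF bO RX(2)[OF X] that] \<epsilon>] by (simp add: arr_def)
    moreover have "g \<in> (\<lambda>f. \<epsilon> X \<cdot> f) ` Hom D b (R\<^sub>o X)" if "g \<in> Hom D b X" for g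
      using rbijE[OF rb arrI[OF bO X that]] by (auto simp: arr_def)
    ultimately show ?thesis by (auto simp: bij_betw_def)
  qed
  \<comment> \<open>Composition with the counit is the bijection at hand, whereas
    \<open>right_admissible\<close> asks for the one in the opposite direction.\<close>
  define \<phi> where "\<phi> b X = inv_into (Hom D b (R\<^sub>o X)) (\<lambda>f. \<epsilon> X \<cdot> f)" for b X
  show "right_admissible D B"
    unfolding right_admissible_def
  proof (intro conjI exI[of _ R\<^sub>o] exI[of _ R\<^sub>m] exI[of _ \<phi>] ballI F)
    show "triangulated_subcategory D B" using B by (simp add: thick_subcategory_def)
  next
    fix X assume "X \<in> Ob D" then show "R\<^sub>o X \<in> B" using RX by blast
  next
    fix b' X assume "b' \<in> B" "X \<in> Ob D"
    then show "bij_betw (\<phi> b' X) (Hom D b' X) (Hom D b' (R\<^sub>o X))"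
      unfolding \<phi>_def using bij_betw_inv_into[OF b] by blast
  next
    fix c c' X X' h f g
    assume B': "c \<in> B" "c' \<in> B" and X: "X \<in> Ob D" "X' \<in> Ob D"
      and "h \<in> Hom D c' c" "f \<in> Hom D c X" "g \<in> Hom D X X'"
    then have h: "arr D c' c h" and f: "arr D c X f" and g: "arr D X X' g"
      using thick_Ob[OF B] by (auto simp: arr_def)
    define y where "y = \<phi> c X f"
    have "f \<in> (\<lambda>f. \<epsilon> X \<cdot> f) ` Hom D c (R\<^sub>o X)"
      using b[OF B'(1) X(1)] f by (auto simp: bij_betw_def arr_def)
    then have "y \<in> Hom D c (R\<^sub>o X)" "\<epsilon> X \<cdot> y = f"
      unfolding y_def \<phi>_def by (rule inv_into_into, rule f_inv_into_f)
    then have y: "arr D c (R\<^sub>o X) y" "\<epsilon> X \<cdot> y = f" using thick_Ob[OF B B'(1)] RX(2)[OF X(1)] by (auto simp: arr_def)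
    note Rg = functor_arr[OF F g]
    have Rgy: "arr D c (R\<^sub>o X') (R\<^sub>m g \<cdot> y)" using arr_cmp[OF y(1) Rg] .
    have "\<epsilon> X' \<cdot> (R\<^sub>m g \<cdot> y) = g \<cdot> f"
      using comp_assoc[OF y(1) Rg RX(3)[OF X(2)]] nat[OF g] comp_assoc[OF y(1) RX(3)[OF X(1)] g] y(2)
      by simp
    then have "\<epsilon> X' \<cdot> (R\<^sub>m g \<cdot> y \<cdot> h) = g \<cdot> f \<cdot> h"
      using comp_assoc[OF h Rgy RX(3)[OF X(2)]] by simp
    moreover have "R\<^sub>m g \<cdot> y \<cdot> h \<in> Hom D c' (R\<^sub>o X')" using arr_cmp[OF h Rgy] by (simp add: arr_def)
    ultimately show "\<phi> c' X' (g \<cdot> f \<cdot> h) = R\<^sub>m g \<cdot> \<phi> c X f \<cdot> h"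
      unfolding \<phi>_def y_def[unfolded \<phi>_def, symmetric]
      using inv_into_f_f[OF bij_betw_imp_inj_on[OF b[OF B'(2) X(2)]]] by metis
  qed
qed

lemma left_admissibleI:
  assumes B: "thick_subcategory D B" and r: "\<And>X. X \<in> Ob D \<Longrightarrow> \<exists>b u. lap D B X b u"
  shows "left_admissible D B"
proof -
  interpret op: pretriangulated_category "opc D" by (rule pretriangulated_opc)
  show ?thesis
  proof (rule op.right_adjoint_functor)
    show "B \<subseteq> Ob (opc D)" using thick_Ob[OF B] by auto
    show "\<exists>b u. rap (opc D) B X b u" if "X \<in> Ob (opc D)" for X using r that by simp
    fix L\<^sub>o L\<^sub>m \<eta>
    assume "linear_functor (opc D) L\<^sub>o L\<^sub>m"
      and "\<And>X. X \<in> Ob (opc D) \<Longrightarrow> rap (opc D) B X (L\<^sub>o X) (\<eta> X)"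
      and "\<And>X Y f. arr (opc D) X Y f \<Longrightarrow> \<eta> Y \<cdot>\<^bsub>opc D\<^esub> L\<^sub>m f = f \<cdot>\<^bsub>opc D\<^esub> \<eta> X"
    then have F: "linear_functor D L\<^sub>o L\<^sub>m" and r: "\<And>X. X \<in> Ob D \<Longrightarrow> lap D B X (L\<^sub>o X) (\<eta> X)"
      and nat: "\<And>X Y f. arr D Y X f \<Longrightarrow> L\<^sub>m f \<cdot> \<eta> Y = \<eta> X \<cdot> f" by simp_all
    have LX: "L\<^sub>o X \<in> B" "L\<^sub>o X \<in> Ob D" "arr D X (L\<^sub>o X) (\<eta> X)" if "X \<in> Ob D" for X
      using r[OF that] by (auto simp: rap_def arr_def)
    show "left_admissible D B"
      unfolding left_admissible_def
    proof (intro conjI exI[of _ L\<^sub>o] exI[of _ L\<^sub>m] exI[of _ "\<lambda>X b f. f \<cdot> \<eta> X"] ballI F)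
      show "triangulated_subcategory D B" using B by (simp add: thick_subcategory_def)
    next
      fix X assume "X \<in> Ob D" then show "L\<^sub>o X \<in> B" using LX by blast
    next
      fix X b assume X: "X \<in> Ob D" and b: "b \<in> B"
      have bO: "b \<in> Ob D" using thick_Ob[OF B b] .
      have lb: "lbij D b X (L\<^sub>o X) (\<eta> X)" using r[OF X] b by (simp add: rap_def)
      note \<eta> = LX(3)[OF X]
      have "inj_on (\<lambda>f. f \<cdot> \<eta> X) (Hom D (L\<^sub>o X) b)"
        using lbij_inj[OF lb \<eta>] bO LX(2)[OF X] by (auto simp: inj_on_def arr_def)
      moreover have "f \<cdot> \<eta> X \<in> Hom D X b" if "f \<in> Hom D (L\<^sub>o X) b" for f
        using arr_cmp[OF \<eta> arrI[OF LX(2)[OF X] bO that]] by (simp add: arr_def)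
      moreover have "g \<in> (\<lambda>f. f \<cdot> \<eta> X) ` Hom D (L\<^sub>o X) b" if "g \<in> Hom D X b" for g
        using lbijE[OF lb arrI[OF X bO that]] by (auto simp: arr_def)
      ultimately show "bij_betw (\<lambda>f. f \<cdot> \<eta> X) (Hom D (L\<^sub>o X) b) (Hom D X b)"
        by (auto simp: bij_betw_def)
    next
      fix X X' b b' h f g
      assume X: "X \<in> Ob D" "X' \<in> Ob D" and b: "b \<in> B" "b' \<in> B"
        and "h \<in> Hom D X' X" "f \<in> Hom D (L\<^sub>o X) b" "g \<in> Hom D b b'"
      then have h: "arr D X' X h" and f: "arr D (L\<^sub>o X) b f" and g: "arr D b b' g"
        using thick_Ob[OF B] LX(2) by (auto simp: arr_def)
      note gf = arr_cmp[OF f g] and Lh = functor_arr[OF F h]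
      have "g \<cdot> f \<cdot> L\<^sub>m h \<cdot> \<eta> X' = (g \<cdot> f) \<cdot> (\<eta> X \<cdot> h)"
        using comp_assoc[OF LX(3)[OF X(2)] Lh gf] nat[OF h] by simp
      also have "\<dots> = g \<cdot> (f \<cdot> \<eta> X) \<cdot> h"
        using comp_assoc[OF h LX(3)[OF X(1)] gf] comp_assoc[OF LX(3)[OF X(1)] f g] by simp
      finally show "g \<cdot> f \<cdot> L\<^sub>m h \<cdot> \<eta> X' = g \<cdot> (f \<cdot> \<eta> X) \<cdot> h" .
    qed
  qed
qed

text \<open>Feeds D itself into the hypothesis on admissible subcategories, which then provides a
  full exceptional sequence.\<close>

lemma admissible_Ob: "admissible D (Ob D)"
proof -
  interpret op: pretriangulated_category "opc D" by (rule pretriangulated_opc)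
  have "rap D (Ob D) X X (Id D X)" "lap D (Ob D) X X (Id D X)" if "X \<in> Ob D" for X
    using rap_self op.rap_self[of X "Ob D"] that by simp_all
  then show ?thesis
    unfolding admissible_def using right_admissibleI left_admissibleI thick_Ob_D by blast
qed

end

section \<open>Finiteness from the Serre functor\<close>

context klinear_category
begin

text \<open>The dual of the zero space has a single element, functionals being extensional, so the
  injective duality map forces Hom(X,Y) to vanish.\<close>

lemma serre_vanishing:
  assumes "has_serre_functor D"
  obtains S where "\<And>X. X \<in> Ob D \<Longrightarrow> S X \<in> Ob D"
    "\<And>X Y. \<lbrakk>X \<in> Ob D; Y \<in> Ob D; Hom D Y (S X) = {0}\<rbrakk> \<Longrightarrow> Hom D X Y = {0}"
proof -
  obtain S\<^sub>o S\<^sub>m where S: "serre_functor D S\<^sub>o S\<^sub>m" using assms by (auto simp: has_serre_functor_def)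
  then have SO: "S\<^sub>o X \<in> Ob D" if "X \<in> Ob D" for X
    using that by (simp add: serre_functor_def autoequivalence_def linear_functor_def)
  obtain \<eta> where \<eta>: "\<And>X Y. \<lbrakk>X \<in> Ob D; Y \<in> Ob D\<rbrakk> \<Longrightarrow>
      bij_betw (\<eta> X Y) (Hom D X Y) (dual D (Hom D Y (S\<^sub>o X)))"
    using S unfolding serre_functor_def by metis
  have "Hom D X Y = {0}" if XY: "X \<in> Ob D" "Y \<in> Ob D" and 0: "Hom D Y (S\<^sub>o X) = {0}" for X Y
  proof -
    have dual: "\<phi> = \<psi>" if "\<phi> \<in> dual D {0}" "\<psi> \<in> dual D {0}" for \<phi> \<psi>
    proof -
      have "\<phi> (0 + 0) = \<phi> 0 + \<phi> 0" "\<psi> (0 + 0) = \<psi> 0 + \<psi> 0" using that by (auto simp: dual_def)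
      then have "\<phi> 0 = \<psi> 0" by (metis add_0 add_cancel_right_right)
      then show ?thesis using that by (auto simp: dual_def intro: extensionalityI[of _ "{0}"])
    qed
    have bij: "bij_betw (\<eta> X Y) (Hom D X Y) (dual D {0})" using \<eta>[OF XY] 0 by simp
    have "f = 0" if "f \<in> Hom D X Y" for f
    proof -
      have "0 \<in> Hom D X Y" using arr_0[OF XY] by (simp add: arr_def)
      moreover from this have "\<eta> X Y f = \<eta> X Y 0"
        using dual bij_betwE[OF bij] that by blast
      ultimately show "f = 0" using bij_betw_imp_inj_on[OF bij] that by (auto dest: inj_onD)
    qed
    then show ?thesis using Hom_zero_iff[OF XY] by (simp add: arr_def)
  qed
  then show thesis using that SO by blast
qed

end

lemma (in pretriangulated_category) fin_hom_of_serre: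
  assumes Es: "exceptional_seq D Es" and full: "gen D (set Es) = Ob D"
    and SO: "\<And>X. X \<in> Ob D \<Longrightarrow> S X \<in> Ob D"
    and S: "\<And>X Y. \<lbrakk>X \<in> Ob D; Y \<in> Ob D; Hom D Y (S X) = {0}\<rbrakk> \<Longrightarrow> Hom D X Y = {0}"
    and X: "X \<in> Ob D" and Y: "Y \<in> Ob D"
  shows "fin_hom D X Y"
proof -
  have all: "fin_hom D W Y" if W: "W \<in> Ob D" and E: "\<And>E. E \<in> set Es \<Longrightarrow> fin_hom D W E"
    and Y: "Y \<in> Ob D" for W Y
  proof -
    have "gen D (set Es) \<subseteq> {Y \<in> Ob D. fin_hom D W Y}"
      using exceptional_seq_Ob[OF Es] E by (intro gen_least[OF _ thick_fin_right[OF W]]) auto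
    then show ?thesis using full Y by auto
  qed
  \<comment> \<open>The claim is made for all sources at once, so that for i > j the induction
    hypothesis applies with source \<open>Es ! j\<close>.\<close>
  have "fin_hom D X (Es ! j)" if "j < length Es" "X \<in> Ob D" for j X
    using that
  proof (induction "length Es - j" arbitrary: j X rule: less_induct)
    case less
    have E: "exceptional D (Es ! j)" using Es less(2) by (simp add: exceptional_seq_iff)
    then have E: "exceptional D (Es ! j)" "Es ! j \<in> Ob D" by (simp_all add: exceptional_iff)
    have "fin_hom D (Es ! j) (Es ! i)" if i: "i < length Es" for i
    proof -
      consider "i < j" | "i = j" | "j < i" by linarith
      then show ?thesis
      proof cases
        case 1
        then have "orth D (Es ! j) (Es ! i)"
          using Es less(2) by (simp add: exceptional_seq_iff sorted_wrt_iff_nth_less)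
        then show ?thesis by (simp add: fin_hom_def orth_def)
      next
        case 2
        have "Hom D (sh D l (Es ! j)) (Es ! j) = {0}" if "l \<noteq> 0" for l
          using exceptional_arr_neq[OF E(1), of l 0] that E(2) Hom_zero_iff[OF sh_in_Ob[OF E(2)] E(2)]
          by (simp add: sh_0)
        then have "{l. Hom D (sh D l (Es ! j)) (Es ! j) \<noteq> {0}} \<subseteq> {0}" by auto
        then show ?thesis unfolding fin_hom_def 2 by (rule finite_subset) simp
      next
        case 3
        then show ?thesis using less(1)[of i] i less(2) E(2) by simp
      qed
    qed
    then have fE: "fin_hom D (Es ! j) (S X)"
      using all[OF E(2) _ SO[OF less(3)]] by (metis in_set_conv_nth)
    \<comment> \<open>Duality reverses the direction: finiteness from \<open>Es ! j\<close> to
      \<open>S X\<close> bounds the degrees of maps from X to \<open>Es ! j\<close>.\<close>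
    have "{l. Hom D X (sh D l (Es ! j)) \<noteq> {0}} \<subseteq> {l. Hom D (sh D l (Es ! j)) (S X) \<noteq> {0}}"
      using S[OF less(3) sh_in_Ob[OF E(2)]] by auto
    then show ?case
      using fE fin_hom_iff_target[OF less(3) E(2)] by (auto simp: fin_hom_def intro: finite_subset)
  qed
  then show ?thesis using all[OF X _ Y] X by (metis in_set_conv_nth)
qed

section \<open>Admissibility of the components of a semi-orthogonal decomposition\<close>

context full_exceptional_category
begin

text \<open>Terms are added in the order of the sequence. The step for \<open>Es ! n\<close> keeps
  representability on the earlier terms because they are right orthogonal to \<open>Es ! n\<close>;
  once all terms are covered, it holds on everything they generate.\<close>

lemma corepresentable:
  assumes F: "linear_functor D F\<^sub>o F\<^sub>m" and ex: "hom_exact D F\<^sub>o F\<^sub>m X" and X: "X \<in> Ob D"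
    and fin: "\<And>E. E \<in> Ob D \<Longrightarrow> finite {l. Hom D X (F\<^sub>o (sh D l E)) \<noteq> {0}}"
  obtains W \<xi> where "W \<in> Ob D" "arr D X (F\<^sub>o W) \<xi>" "\<And>Y. Y \<in> Ob D \<Longrightarrow> crep D F\<^sub>o F\<^sub>m X W \<xi> Y"
proof -
  have "\<exists>W \<xi>. W \<in> Ob D \<and> arr D X (F\<^sub>o W) \<xi> \<and> (\<forall>i<n. \<forall>l. crep D F\<^sub>o F\<^sub>m X W \<xi> (sh D l (Es ! i)))"
    if "n \<le> length Es" for n
    using that
  proof (induction n)
    case 0
    \<comment> \<open>For n = 0 nothing is demanded, so any object with the zero element can start
      the construction.\<close>
    have "arr D X (F\<^sub>o X) 0" using X functor_Ob[OF F X] by blast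
    then show ?case using X by blast
  next
    case (Suc n)
    then obtain W \<xi> where W: "W \<in> Ob D" "arr D X (F\<^sub>o W) \<xi>"
      and c: "\<And>i l. i < n \<Longrightarrow> crep D F\<^sub>o F\<^sub>m X W \<xi> (sh D l (Es ! i))" by auto
    define E where "E = Es ! n"
    have n: "n < length Es" using Suc.prems by simp
    have E: "exceptional D E" "E \<in> Ob D" using exceptional_nth[OF n] nth_Ob[OF n] by (auto simp: E_def)
    have t: "thick_subcategory D (gen D {E})" using thick_gen E(2) by simp
    show ?case
    proof (rule corepresentation_exists[OF finite_dim_Homs F E(1) ex X fin[OF E(2)]],
        rule lap_exists[OF finite_dim_Homs E(1) W(1) fin_hom[OF W(1) E(2)]])
      fix b0 \<eta> b1 v
      assume b0: "b0 \<in> gen D {E}" "arr D X (F\<^sub>o b0) \<eta>" "\<And>Y. Y \<in> gen D {E} \<Longrightarrow> crep D F\<^sub>o F\<^sub>m X b0 \<eta> Y"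
        and v: "lap D (gen D {E}) W b1 v"
      show ?case
      proof (rule corepresentation_step[OF F ex W(2) t W(1) v b0])
        fix W' \<xi>'
        assume W': "W' \<in> Ob D" "arr D X (F\<^sub>o W') \<xi>'"
          and c1: "\<And>Y. Y \<in> gen D {E} \<Longrightarrow> crep D F\<^sub>o F\<^sub>m X W' \<xi>' Y"
          and c2: "\<And>Y. \<lbrakk>Y \<in> Ob D; \<And>b. b \<in> gen D {E} \<Longrightarrow> Hom D b Y = {0}; crep D F\<^sub>o F\<^sub>m X W \<xi> Y\<rbrakk>
            \<Longrightarrow> crep D F\<^sub>o F\<^sub>m X W' \<xi>' Y"
        have "crep D F\<^sub>o F\<^sub>m X W' \<xi>' (sh D l (Es ! i))" if i: "i < Suc n" for i l
        proof (cases "i = n")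
          case True
          have "sh D l E \<in> gen D {E}" using thick_sh[OF t] gen_superset[of "{E}"] by simp
          then show ?thesis using c1 True by (simp add: E_def)
        next
          case False
          then have i: "i < n" using i by simp
          then have iO: "Es ! i \<in> Ob D" using nth_Ob n by simp
          have "orth D E (Es ! i)" using orth_nth[OF i n] by (simp add: E_def)
          then have "orth D b (sh D l (Es ! i))" if "b \<in> gen D {E}" for b
            using gen_orth[of "{E}" "{sh D l (Es ! i)}" b "sh D l (Es ! i)"] that E(2) iO
              orth_sh_right[OF E(2) iO] sh_in_Ob[OF iO] gen_superset[of "{sh D l (Es ! i)}"] by simp
          then have "Hom D b (sh D l (Es ! i)) = {0}" if "b \<in> gen D {E}" for b
            using orth_Hom thick_Ob[OF t] that by blast
          then show ?thesis using c2[OF sh_in_Ob[OF iO]] c[OF i] by blast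
        qed
        then show ?case using W' by blast
      qed
    qed
  qed
  from this[of "length Es"] obtain W \<xi> where W: "W \<in> Ob D" "arr D X (F\<^sub>o W) \<xi>"
    and c: "\<And>i l. i < length Es \<Longrightarrow> crep D F\<^sub>o F\<^sub>m X W \<xi> (sh D l (Es ! i))" by auto
  have "crep D F\<^sub>o F\<^sub>m X W \<xi> Y" if "Y \<in> Ob D" for Y
    by (rule crep_gen[OF F ex W(2,1) Es_Ob]) (use c that full in \<open>auto simp: in_set_conv_nth\<close>)
  then show thesis using that W by blast
qed

text \<open>
  If \<open>R\<close> is right adjoint to the inclusion of \<open>B\<close>, an object representing $Hom(X, R-)$ lies in
  \<open>B\<close> because $R$ vanishes on $B^\perp$, and is then the left approximation of \<open>X\<close>.
\<close>

lemma lap_if_rap: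
  assumes B: "thick_subcategory D B" and r: "\<And>X. X \<in> Ob D \<Longrightarrow> \<exists>b u. rap D B X b u"
    and X: "X \<in> Ob D"
  shows "\<exists>b u. lap D B X b u"
proof (rule right_adjoint_functor[OF _ r])
  show "B \<subseteq> Ob D" using thick_Ob[OF B] by blast
  fix R\<^sub>o R\<^sub>m \<epsilon>
  assume F: "linear_functor D R\<^sub>o R\<^sub>m" and r: "\<And>X. X \<in> Ob D \<Longrightarrow> rap D B X (R\<^sub>o X) (\<epsilon> X)"
    and nat: "\<And>X Y f. arr D X Y f \<Longrightarrow> \<epsilon> Y \<cdot> R\<^sub>m f = f \<cdot> \<epsilon> X"
  have RX: "R\<^sub>o X \<in> B" "R\<^sub>o X \<in> Ob D" "arr D (R\<^sub>o X) X (\<epsilon> X)" if "X \<in> Ob D" for X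
    using r[OF that] by (auto simp: rap_def arr_def)
  have fin: "finite {l. Hom D X (R\<^sub>o (sh D l E)) \<noteq> {0}}" if E: "E \<in> Ob D" for E
  proof -
    \<comment> \<open>By uniqueness of universal maps R commutes with shifts up to isomorphism,
      which is enough to transfer finiteness.\<close>
    have "isomorphic D (sh D l (R\<^sub>o E)) (R\<^sub>o (sh D l E))" for l
      using rap_unique[OF B rap_shift[OF B r[OF E]] r[OF sh_in_Ob[OF E]]] .
    then have "{l. Hom D X (R\<^sub>o (sh D l E)) \<noteq> {0}} \<subseteq> {l. Hom D X (sh D l (R\<^sub>o E)) \<noteq> {0}}"
      using isomorphic_Hom_zero[OF _ X] by auto
    then show ?thesis
      using fin_hom[OF X RX(2)[OF E]] fin_hom_iff_target[OF X RX(2)[OF E]] finite_subset by blast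
  qed
  show ?thesis
  proof (rule corepresentable[OF F adjoint_hom_exact[OF B F r nat] X fin])
    fix W \<xi> assume W: "W \<in> Ob D" and \<xi>: "arr D X (R\<^sub>o W) \<xi>"
      and c: "\<And>Y. Y \<in> Ob D \<Longrightarrow> crep D R\<^sub>o R\<^sub>m X W \<xi> Y"
    obtain C g h where T: "dist D (R\<^sub>o W) W C (\<epsilon> W) g h" using cone[OF RX(3)[OF W]] .
    note A = dist_arr[OF T]
    have C: "orth D V C" if "V \<in> B" for V using r[OF W] rap_cone[OF T B] that by blast
    have "zero_object D (R\<^sub>o C)"
    proof -
      note RC = RX[OF A(6)]
      have "\<epsilon> C = 0" using orth_arr[OF C[OF RC(1)] RC(3)] .
      moreover have "rbij D (R\<^sub>o C) (R\<^sub>o C) C (\<epsilon> C)" using r[OF A(6)] RC(1) by (simp add: rap_def)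
      ultimately have "Id D (R\<^sub>o C) = 0"
        using rbijD0[OF _ arr_Id[OF RC(2)]] comp_Id_right[OF RC(3)] by simp
      then show ?thesis using RC(2) zero_object_iff by blast
    qed
    \<comment> \<open>Since R C = 0, the map \<open>g\<close> corresponds to 0 under
      representability and vanishes. Then \<open>\<epsilon> W\<close> is a split epimorphism and W
      is a retract of an object of B.\<close>
    then have "R\<^sub>m g \<cdot> \<xi> = 0"
      using zero_object_arr(1) arr_cmp[OF \<xi> functor_arr[OF F A(2)]] by blast
    then have "g = 0" using crepD0[OF c[OF A(6)] A(2)] by blast
    then have "g \<cdot> Id D W = 0" using comp_Id_right[OF A(2)] by simp
    then obtain s where s: "arr D W (R\<^sub>o W) s" "\<epsilon> W \<cdot> s = Id D W"
      using lift_first[OF T arr_Id[OF W]] by blast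
    have WB: "W \<in> B" using thick_retract[OF B s(1) RX(3)[OF W] s(2) RX(1)[OF W]] .
    have u: "arr D X W (\<epsilon> W \<cdot> \<xi>)" using arr_cmp[OF \<xi> RX(3)[OF W]] .
    have "lbij D Y X W (\<epsilon> W \<cdot> \<xi>)" if Y: "Y \<in> B" for Y
    proof -
      have YO: "Y \<in> Ob D" using thick_Ob[OF B Y] .
      have iso: "rbij D X (R\<^sub>o Y) Y (\<epsilon> Y)"
        using iso_rbij[OF rap_iso[OF r[OF YO] Y] RX(2)[OF YO] YO] .
      have eq: "f \<cdot> (\<epsilon> W \<cdot> \<xi>) = \<epsilon> Y \<cdot> (R\<^sub>m f \<cdot> \<xi>)" if f: "arr D W Y f" for f
        using comp_assoc[OF \<xi> RX(3)[OF W] f] nat[OF f] comp_assoc[OF \<xi> functor_arr[OF F f] RX(3)[OF YO]]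
        by simp
      show ?thesis
        unfolding lbij_def
      proof (intro conjI allI impI)
        fix f assume f: "arr D W Y f" "f \<cdot> (\<epsilon> W \<cdot> \<xi>) = 0"
        then have "R\<^sub>m f \<cdot> \<xi> = 0"
          using rbijD0[OF iso arr_cmp[OF \<xi> functor_arr[OF F f(1)]]] eq[OF f(1)] by simp
        then show "f = 0" using crepD0[OF c[OF YO] f(1)] by blast
      next
        fix g assume "arr D X Y g"
        then obtain t where t: "arr D X (R\<^sub>o Y) t" "\<epsilon> Y \<cdot> t = g" using rbijE[OF iso] by blast
        obtain f where "arr D W Y f" "R\<^sub>m f \<cdot> \<xi> = t" using crepE[OF c[OF YO] t(1)] .
        then show "\<exists>f. arr D W Y f \<and> f \<cdot> (\<epsilon> W \<cdot> \<xi>) = g" using eq t(2) by auto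
      qed
    qed
    then have "lap D B X W (\<epsilon> W \<cdot> \<xi>)" using WB u by (simp add: rap_def)
    then show ?thesis by blast
  qed
qed

lemma rap_if_lap:
  assumes "thick_subcategory D B" "\<And>X. X \<in> Ob D \<Longrightarrow> \<exists>b u. lap D B X b u" "X \<in> Ob D"
  shows "\<exists>b u. rap D B X b u"
proof -
  interpret op: full_exceptional_category "opc D" "rev Es" by (rule full_exceptional_opc)
  show ?thesis using op.lap_if_rap[of B X] assms by simp
qed

text \<open>Let A be generated by the components up to position i. Every component has universal
  maps to A: identities up to i, zero maps beyond, where Hom to A vanishes. Thickness extends this
  to D, and \<open>rap_if_lap\<close> gives universal maps from A. Inside A, universal maps from the
  last component exist likewise, by identity or zero; composing the two approximations proves the
  claim.\<close>

lemma SOD_component_admissible: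
  assumes SOD: "SOD D Ps" and i: "i < length Ps"
  shows "admissible D (Ps ! i)"
proof -
  interpret op: full_exceptional_category "opc D" "rev Es" by (rule full_exceptional_opc)
  have thick: "thick_subcategory D (Ps ! j)" if "j < length Ps" for j using SOD that by (simp add: SOD_def)
  have Hom0: "Hom D X Y = {0}" if "k < j" "j < length Ps" "X \<in> Ps ! j" "Y \<in> Ps ! k" for j k X Y
    using SOD that unfolding SOD_def by blast
  have PO: "Ps ! j \<subseteq> Ob D" if "j < length Ps" for j using thick_Ob[OF thick[OF that]] by blast
  have all: "Ob D \<subseteq> B" if B: "thick_subcategory D B" and sub: "\<And>j. j < length Ps \<Longrightarrow> Ps ! j \<subseteq> B" for B
  proof -
    have "\<Union>(set Ps) \<subseteq> B" using sub by (metis Sup_least in_set_conv_nth)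
    from gen_least[OF this B] show ?thesis using SOD by (simp add: SOD_def)
  qed
  define U where "U = (\<Union>j\<in>{..i}. Ps ! j)"
  define A where "A = gen D U"
  have U: "U \<subseteq> Ob D" unfolding U_def
    by (rule UN_least, rule PO) (use i in simp)
  have A: "thick_subcategory D A" unfolding A_def by (rule thick_gen[OF U])
  have UA: "Ps ! j \<subseteq> A" if "j \<le> i" for j using gen_superset[of U] that by (auto simp: A_def U_def)
  have "Ob D \<subseteq> {X \<in> Ob D. \<exists>b u. lap D A X b u}"
  proof (rule all)
    show "thick_subcategory D {X \<in> Ob D. \<exists>b u. lap D A X b u}"
      using op.thick_rap[of A] op.idempotent_splits A by simp
    fix j assume j: "j < length Ps"
    show "Ps ! j \<subseteq> {X \<in> Ob D. \<exists>b u. lap D A X b u}"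
    proof (cases "j \<le> i")
      case True
      have "lap D A X X (Id D X)" if "X \<in> Ps ! j" for X
        using op.rap_self[of X A] UA[OF True] PO[OF j] that by auto
      then show ?thesis using PO[OF j] by blast
    next
      case False
      have "Hom D X W = {0}" if X: "X \<in> Ps ! j" and W: "W \<in> A" for X W
      proof -
        have "orth D X' Y" if X': "X' \<in> Ps ! j" and Y: "Y \<in> U" for X' Y
        proof (rule orthI)
          fix l
          obtain k where "k \<le> i" "Y \<in> Ps ! k" using Y by (auto simp: U_def)
          then show "Hom D (sh D l X') Y = {0}"
            using Hom0[of k j "sh D l X'" Y] thick_sh[OF thick[OF j] X'] False j by simp
        qed
        then have "orth D X W"
          using gen_orth[of "Ps ! j" U X W] PO[OF j] U X W gen_superset[of "Ps ! j"] by (auto simp: A_def)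
        then show ?thesis using orth_Hom PO[OF j] X by blast
      qed
      then show ?thesis using op.rap_zero[of A] A PO[OF j] by auto
    qed
  qed
  then have rA: "\<exists>a \<alpha>. rap D A X a \<alpha>" if "X \<in> Ob D" for X using rap_if_lap[OF A _ that] by blast
  have Pi: "thick_subcategory D (Ps ! i)" using thick[OF i] .
  have tP: "thick_subcategory D {X \<in> Ob D. \<exists>b u. rap D (Ps ! i) X b u}"
    using thick_rap[OF Pi] idempotent_splits by blast
  have "Ps ! j \<subseteq> {X \<in> Ob D. \<exists>b u. rap D (Ps ! i) X b u}" if j: "j \<le> i" for j
  proof (cases "j = i")
    case True
    have "rap D (Ps ! i) X X (Id D X)" if "X \<in> Ps ! i" for X using rap_self PO[OF i] that by blast
    then show ?thesis using PO[OF i] True by blast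
  next
    case False
    then show ?thesis using rap_zero[OF Pi] Hom0[of j i] j i PO[of j] by auto
  qed
  then have AP: "A \<subseteq> {X \<in> Ob D. \<exists>b u. rap D (Ps ! i) X b u}"
    unfolding A_def by (intro gen_least[OF _ tP]) (auto simp: U_def)
  have r: "\<exists>b u. rap D (Ps ! i) X b u" if X: "X \<in> Ob D" for X
  proof -
    obtain a \<alpha> where a: "rap D A X a \<alpha>" using rA[OF X] by blast
    then have "a \<in> A" by (simp add: rap_def)
    then obtain b \<beta> where "rap D (Ps ! i) a b \<beta>" using AP by blast
    then show ?thesis using rap_trans[OF a _ UA] by blast
  qed
  then show ?thesis
    unfolding admissible_def using right_admissibleI[OF Pi] left_admissibleI[OF Pi] lap_if_rap[OF Pi]
    by blast
qed

end

section \<open>Finest decompositions and full exceptional sequences\<close>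

lemma sorted_wrt_concat_upt:
  assumes "\<And>i. i < n \<Longrightarrow> sorted_wrt P (f i)"
    and "\<And>i j x y. \<lbrakk>i < j; j < n; x \<in> set (f i); y \<in> set (f j)\<rbrakk> \<Longrightarrow> P x y"
  shows "sorted_wrt P (concat (map f [0..<n]))"
  using assms
proof (induction n)
  case (Suc n)
  have "sorted_wrt P (concat (map f [0..<n]))"
    by (rule Suc.IH) (use Suc.prems in \<open>auto intro: less_SucI\<close>)
  moreover have "P x y" if "x \<in> set (concat (map f [0..<n]))" "y \<in> set (f n)" for x y
    using that Suc.prems(2)[of _ n x y] by auto
  ultimately show ?case using Suc.prems(1)[of n] by (simp add: sorted_wrt_append)
qed simp

text \<open>The values of \<open>r\<close> in order form a sorted list without repetition, and such
  a list is determined by its set.\<close>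

lemma mono_onto_lessThan:
  fixes r :: "nat \<Rightarrow> nat"
  assumes im: "r ` {..<m} = {..<n}" and mono: "mono_on {..<m} r" and inj: "inj_on r {..<m}"
  shows "m = n" "i < m \<Longrightarrow> r i = i"
proof -
  show mn: "m = n" using card_image[OF inj] im by simp
  have "map r [0..<m] = [0..<n]"
  proof (rule sorted_distinct_set_unique)
    show "sorted (map r [0..<m])"
      using mono by (auto simp: sorted_wrt_map sorted_wrt_iff_nth_less mono_on_def)
    show "distinct (map r [0..<m])" using inj by (simp add: distinct_map atLeast0LessThan)
    show "set (map r [0..<m]) = set [0..<n]" using im by (simp add: atLeast0LessThan)
  qed auto
  then show "r i = i" if "i < m"
    using that mn by (metis add_0 length_upt minus_nat.diff_0 nth_map nth_upt)
qed

context ext_finite_category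
begin

abbreviation gens where "gens \<equiv> map (\<lambda>E. gen D {E})"

lemma full_exceptional_seqs_iff:
  "Es \<in> full_exceptional_seqs D \<longleftrightarrow> exceptional_seq D Es \<and> gen D (set Es) = Ob D"
  by (simp add: full_exceptional_seqs_def)

lemma SOD_of_exceptional_seq:
  assumes Es: "Es \<in> full_exceptional_seqs D"
  shows "SOD D (gens Es)"
proof -
  have seq: "exceptional_seq D Es" and full: "gen D (set Es) = Ob D"
    using Es by (auto simp: full_exceptional_seqs_iff)
  note O = exceptional_seq_Ob[OF seq]
  have "\<exists>X\<in>gen D {E}. \<not> zero_object D X" if "E \<in> set Es" for E
    using seq that gen_superset[of "{E}"]
    by (intro bexI[of _ E]) (auto simp: exceptional_seq_iff exceptional_iff zero_object_iff)
  moreover have "thick_subcategory D (gen D {E})" if "E \<in> set Es" for E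
    using thick_gen O that by auto
  moreover have "Hom D X Y = {0}"
    if ij: "i < j" "j < length Es" and XY: "X \<in> gen D {Es ! j}" "Y \<in> gen D {Es ! i}" for i j X Y
  proof -
    have mem: "Es ! i \<in> Ob D" "Es ! j \<in> Ob D" using O ij by (auto simp: subset_iff)
    have "orth D (Es ! j) (Es ! i)"
      using seq ij by (simp add: exceptional_seq_iff sorted_wrt_iff_nth_less)
    then have "orth D X Y" using gen_orth[of "{Es ! j}" "{Es ! i}" X Y] XY mem by simp
    then show ?thesis using orth_Hom gen_Ob[of "{Es ! j}" X] XY mem by simp
  qed
  moreover have "gen D (\<Union>E\<in>set Es. gen D {E}) = Ob D"
    using gen_UN_gen[of "set Es" "\<lambda>E. {E}"] O full by auto
  ultimately show ?thesis by (simp add: SOD_def)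
qed

text \<open>In a finer decomposition each component is a nonzero thick part of some <E> and hence
  contains E. Two components inside the same <E> would force Hom(E,E) = 0, so the refinement map is
  injective, and being monotone and onto it is the identity.\<close>

lemma finest_SOD_of_exceptional_seq:
  assumes Es: "Es \<in> full_exceptional_seqs D"
  shows "gens Es \<in> finest_SODs D"
proof -
  have seq: "exceptional_seq D Es" using Es by (simp add: full_exceptional_seqs_iff)
  have "Qs = gens Es"
    if Qs: "SOD D Qs" and finer: "finer D Qs (gens Es)" for Qs
  proof -
    obtain r where im: "r ` {..<length Qs} = {..<length Es}" and mono: "mono_on {..<length Qs} r"
      and P: "\<And>j. j < length Es \<Longrightarrow> gen D {Es ! j} = gen D (\<Union>i\<in>{i. i < length Qs \<and> r i = j}. Qs ! i)"
      using finer by (auto simp: finer_def)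
    have thick: "thick_subcategory D (Qs ! i)" if "i < length Qs" for i using Qs that by (simp add: SOD_def)
    have rless: "r i < length Es" if "i < length Qs" for i using im that by auto
    have exc: "exceptional D (Es ! r i)" if "i < length Qs" for i
      using seq rless[OF that] by (simp add: exceptional_seq_iff)
    have mem: "Es ! r i \<in> Qs ! i" if i: "i < length Qs" for i
    proof -
      obtain X where X: "X \<in> Qs ! i" "\<not> zero_object D X" using Qs i by (auto simp: SOD_def)
      have "X \<in> gen D {Es ! r i}"
        using X(1) i gen_superset[of "\<Union>k\<in>{k. k < length Qs \<and> r k = r i}. Qs ! k"]
        by (subst P[OF rless[OF i]]) auto
      then show ?thesis using exceptional_in_thick[OF exc[OF i] thick[OF i]] X by blast
    qed
    have "r i \<noteq> r k" if "i < k" "k < length Qs" for i k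
    proof
      assume *: "r i = r k"
      have "Es ! r k \<in> Qs ! k" "Es ! r k \<in> Qs ! i" using mem[of i] mem[of k] that * by auto
      then have "Hom D (Es ! r k) (Es ! r k) = {0}" using Qs that unfolding SOD_def by blast
      then have "zero_object D (Es ! r k)" using zero_objectI exc[OF that(2)] exceptional_iff by blast
      then show False using exc[OF that(2)] by (simp add: exceptional_iff zero_object_iff)
    qed
    then have inj: "inj_on r {..<length Qs}"
      by (intro inj_onI) (metis lessThan_iff nat_neq_iff)
    note len = mono_onto_lessThan(1)[OF im mono inj] and id = mono_onto_lessThan(2)[OF im mono inj]
    show ?thesis
    proof (rule nth_equalityI)
      fix j assume j: "j < length Qs"
      have "{i. i < length Qs \<and> r i = j} = {j}" using j id by auto
      then have "gen D {Es ! j} = gen D (Qs ! j)" using P[of j] j len by simp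
      then show "Qs ! j = gens Es ! j" using gen_thick[OF thick[OF j]] j len by simp
    qed (simp add: len)
  qed
  then show ?thesis using SOD_of_exceptional_seq[OF Es] by (auto simp: finest_SODs_def)
qed

text \<open>Orthogonality to the other terms and generation depend on the pair only through <E,F>,
  so another exceptional pair generating the same subcategory can take its place.\<close>

lemma full_exceptional_exchange:
  assumes Es: "xs @ E # F # ys \<in> full_exceptional_seqs D"
    and new: "exceptional D E'" "exceptional D F'" "orth D F' E'"
    and mem: "E' \<in> gen D {E, F}" "F' \<in> gen D {E, F}" "E \<in> gen D {E', F'}" "F \<in> gen D {E', F'}"
  shows "xs @ E' # F' # ys \<in> full_exceptional_seqs D"
proof -
  have seq: "exceptional_seq D (xs @ E # F # ys)" and full: "gen D (set (xs @ E # F # ys)) = Ob D"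
    using Es by (auto simp: full_exceptional_seqs_iff)
  note O = exceptional_seq_Ob[OF seq]
  have O': "E' \<in> Ob D" "F' \<in> Ob D" using new by (auto simp: exceptional_iff)
  have left: "orth D G A" if A: "A \<in> set xs" and G: "G \<in> gen D {E, F}" for A G
  proof -
    have EFA: "orth D E A" "orth D F A" using seq A by (auto simp: exceptional_seq_iff sorted_wrt_append)
    show ?thesis
      by (rule gen_orth[of "{E, F}" "{A}"]) (use EFA O A G gen_superset[of "{A}"] in auto)
  qed
  have right: "orth D A G" if A: "A \<in> set ys" and G: "G \<in> gen D {E, F}" for A G
  proof -
    have AEF: "orth D A E" "orth D A F" using seq A by (auto simp: exceptional_seq_iff sorted_wrt_append)
    show ?thesis
      by (rule gen_orth[of "{A}" "{E, F}"]) (use AEF O A G gen_superset[of "{A}"] in auto)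
  qed
  have "exceptional_seq D (xs @ E' # F' # ys)"
    using seq new left right mem by (auto simp: exceptional_seq_iff sorted_wrt_append)
  moreover have "gen D (set (xs @ E' # F' # ys)) = Ob D"
  proof -
    have sub: "set (xs @ E' # F' # ys) \<subseteq> Ob D" using O O' by auto
    have "gen D {E', F'} \<subseteq> gen D (set (xs @ E' # F' # ys))" by (rule gen_mono) auto
    then have "set (xs @ E # F # ys) \<subseteq> gen D (set (xs @ E' # F' # ys))"
      using mem gen_superset[of "set (xs @ E' # F' # ys)"] by auto
    then have "Ob D \<subseteq> gen D (set (xs @ E' # F' # ys))"
      using gen_least[OF _ thick_gen[OF sub]] full by blast
    then show ?thesis using gen_Ob[OF sub] by blast
  qed
  ultimately show ?thesis by (simp add: full_exceptional_seqs_iff)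
qed

lemma list_split_adjacent:
  assumes "Suc i < length Es"
  obtains xs ys where "Es = xs @ Es ! i # Es ! Suc i # ys" "length xs = i"
proof
  show "Es = take i Es @ Es ! i # Es ! Suc i # drop (Suc (Suc i)) Es"
    using assms by (metis Cons_nth_drop_Suc Suc_lessD append_take_drop_id)
  show "length (take i Es) = i" using assms by simp
qed

lemma exceptional_seq_adjacent:
  assumes "exceptional_seq D Es" "Suc i < length Es"
  shows "exceptional D (Es ! i)" "exceptional D (Es ! Suc i)" "orth D (Es ! Suc i) (Es ! i)"
  using assms by (auto simp: exceptional_seq_iff sorted_wrt_iff_nth_less)

text \<open>The left mutation of F through E generates the right orthogonal of <E> in <E,F>, the
  first term of the right mutation of decompositions; hence the change of side.\<close>

lemma left_mutation_seq:
  assumes Es: "Es \<in> full_exceptional_seqs D" and i: "Suc i < length Es" and m: "left_mutation D i Es Fs"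
  shows "Fs \<in> full_exceptional_seqs D"
    "gens Fs = SOD_right_mutation D i (gens Es)"
proof -
  have seq: "exceptional_seq D Es" using Es by (simp add: full_exceptional_seqs_iff)
  note adj = exceptional_seq_adjacent[OF seq i]
  obtain L where L: "left_mutation_object D (Es ! i) (Es ! Suc i) L"
    and Fs: "Fs = Es[i := L, Suc i := Es ! i]" using m by (auto simp: left_mutation_def)
  note mut = left_mutation_object[OF adj L]
  obtain xs ys where xy: "Es = xs @ Es ! i # Es ! Suc i # ys" "length xs = i"
    using list_split_adjacent[OF i] .
  have "Fs = xs @ L # Es ! i # ys"
    unfolding Fs by (subst (1) xy(1)) (simp add: list_update_append xy(2))
  moreover have "xs @ L # Es ! i # ys \<in> full_exceptional_seqs D"
    by (rule full_exceptional_exchange[where E = "Es ! i" and F = "Es ! Suc i"])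
      (use Es xy(1) mut adj in \<open>auto simp: insert_commute intro: subsetD[OF gen_superset]\<close>)
  ultimately show "Fs \<in> full_exceptional_seqs D" by simp
  show "gens Fs = SOD_right_mutation D i (gens Es)"
    using mut(5) i by (simp add: Fs SOD_right_mutation_def map_update)
qed

lemma right_mutation_seq:
  assumes Es: "Es \<in> full_exceptional_seqs D" and i: "Suc i < length Es" and m: "right_mutation D i Es Fs"
  shows "Fs \<in> full_exceptional_seqs D"
    "gens Fs = SOD_left_mutation D i (gens Es)"
proof -
  have seq: "exceptional_seq D Es" using Es by (simp add: full_exceptional_seqs_iff)
  note adj = exceptional_seq_adjacent[OF seq i]
  obtain R where R: "right_mutation_object D (Es ! i) (Es ! Suc i) R"
    and Fs: "Fs = Es[i := Es ! Suc i, Suc i := R]" using m by (auto simp: right_mutation_def)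
  note mut = right_mutation_object[OF adj R]
  obtain xs ys where xy: "Es = xs @ Es ! i # Es ! Suc i # ys" "length xs = i"
    using list_split_adjacent[OF i] .
  have "Fs = xs @ Es ! Suc i # R # ys"
    unfolding Fs by (subst (1) xy(1)) (simp add: list_update_append xy(2))
  moreover have "xs @ Es ! Suc i # R # ys \<in> full_exceptional_seqs D"
    by (rule full_exceptional_exchange[where E = "Es ! i" and F = "Es ! Suc i"])
      (use Es xy(1) mut adj in \<open>auto simp: insert_commute intro: subsetD[OF gen_superset]\<close>)
  ultimately show "Fs \<in> full_exceptional_seqs D" by simp
  show "gens Fs = SOD_left_mutation D i (gens Es)"
    using mut(5) i by (simp add: Fs SOD_left_mutation_def map_update)
qed

lemma mutations_exist:
  assumes Es: "Es \<in> full_exceptional_seqs D" and i: "Suc i < length Es"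
  shows "\<exists>Fs. left_mutation D i Es Fs" "\<exists>Fs. right_mutation D i Es Fs"
proof -
  have "exceptional_seq D Es" using Es by (simp add: full_exceptional_seqs_iff)
  note adj = exceptional_seq_adjacent[OF this i]
  then have "Es ! i \<in> Ob D" "Es ! Suc i \<in> Ob D" by (auto simp: exceptional_iff)
  then show "\<exists>Fs. left_mutation D i Es Fs" "\<exists>Fs. right_mutation D i Es Fs"
    using left_mutation_object_exists[OF adj(1)] right_mutation_object_exists[OF adj(2)]
    unfolding left_mutation_def right_mutation_def by blast+
qed

lemma exceptional_seq_of_finest_SOD:
  assumes Ps: "Ps \<in> finest_SODs D"
    and gen: "\<And>i. i < length Ps \<Longrightarrow> \<exists>Es. exceptional_seq D Es \<and> Ps ! i = gen D (set Es)"
  shows "\<exists>Es \<in> full_exceptional_seqs D. gens Es = Ps"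
proof -
  define n where "n = length Ps"
  have SOD: "SOD D Ps" and finest: "\<And>Qs. \<lbrakk>SOD D Qs; finer D Qs Ps\<rbrakk> \<Longrightarrow> Qs = Ps"
    using Ps by (auto simp: finest_SODs_def)
  obtain F where F: "\<And>i. i < n \<Longrightarrow> exceptional_seq D (F i)" "\<And>i. i < n \<Longrightarrow> Ps ! i = gen D (set (F i))"
    using gen unfolding n_def by metis
  \<comment> \<open>Each object is paired with the index of its component, so that the refinement
    map can be read off as a first projection.\<close>
  define ys where "ys = concat (map (\<lambda>i. map (Pair i) (F i)) [0..<n])"
  define G where "G = map snd ys"
  have set_ys: "set ys = {(i, E). i < n \<and> E \<in> set (F i)}" by (auto simp: ys_def)
  have FO: "set (F i) \<subseteq> Ob D" if "i < n" for i using exceptional_seq_Ob[OF F(1)[OF that]] .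
  have thick: "thick_subcategory D (Ps ! i)" if "i < n" for i using SOD that by (simp add: SOD_def n_def)
  have sorted: "sorted_wrt (\<lambda>x y. fst x \<le> fst y \<and> orth D (snd y) (snd x)) ys"
    unfolding ys_def
  proof (rule sorted_wrt_concat_upt)
    fix i assume "i < n"
    then show "sorted_wrt (\<lambda>x y. fst x \<le> fst y \<and> orth D (snd y) (snd x)) (map (Pair i) (F i))"
      using F(1) by (simp add: sorted_wrt_map exceptional_seq_iff)
  next
    fix i j x y assume ij: "i < j" "j < n" and "x \<in> set (map (Pair i) (F i))" "y \<in> set (map (Pair j) (F j))"
    then obtain E E' where E: "x = (i, E)" "y = (j, E')" "E \<in> Ps ! i" "E' \<in> Ps ! j"
      using F(2) gen_superset by (fastforce simp: subset_iff)
    have "Hom D (sh D l E') E = {0}" for l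
      using SOD ij E(3) thick_sh[OF thick[OF ij(2)] E(4)] unfolding SOD_def n_def by blast
    then show "fst x \<le> fst y \<and> orth D (snd y) (snd x)" using E ij by (simp add: orth_def)
  qed
  have "\<And>E. E \<in> set G \<Longrightarrow> exceptional D E"
    using F(1) by (auto simp: G_def set_ys exceptional_seq_iff)
  moreover have "sorted_wrt (\<lambda>E E'. orth D E' E) G"
    unfolding G_def sorted_wrt_map by (rule sorted_wrt_mono_rel[OF _ sorted]) simp
  ultimately have seqG: "exceptional_seq D G" by (simp add: exceptional_seq_iff)
  have "set G = (\<Union>i\<in>{..<n}. set (F i))" by (force simp: G_def set_ys)
  then have "gen D (set G) = gen D (\<Union>i\<in>{..<n}. Ps ! i)"
    using gen_UN_gen[of "{..<n}" "\<lambda>i. set (F i)"] FO F(2) by simp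
  also have "(\<Union>i\<in>{..<n}. Ps ! i) = \<Union>(set Ps)" by (force simp: set_conv_nth n_def)
  finally have G: "G \<in> full_exceptional_seqs D"
    using seqG SOD by (simp add: full_exceptional_seqs_iff SOD_def)
  define r where "r k = fst (ys ! k)" for k
  have "finer D (gens G) Ps"
    unfolding finer_def
  proof (intro exI[of _ r] conjI allI impI)
    \<comment> \<open>Components are nonzero, so no block is empty and the refinement map is
      onto.\<close>
    have "F i \<noteq> []" if i: "i < n" for i
    proof
      assume "F i = []"
      then have "zero_object D X" if "X \<in> Ps ! i" for X
        using zero_if_orth_gen[of "{}" X] F(2)[OF i] that by simp
      then show False using SOD i by (auto simp: SOD_def n_def)
    qed
    then have "i \<in> fst ` set ys" if "i < n" for i
      using that hd_in_set[of "F i"] by (intro image_eqI[of _ _ "(i, hd (F i))"]) (auto simp: set_ys)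
    then have "fst ` set ys = {..<n}" by (auto simp: set_ys)
    moreover have "set ys = (\<lambda>k. ys ! k) ` {..<length ys}" by (force simp: set_conv_nth)
    then have "fst ` set ys = r ` {..<length ys}" by (simp add: r_def image_image)
    ultimately show "r ` {..<length (gens G)} = {..<length Ps}"
      by (simp add: G_def n_def)
    show "mono_on {..<length (gens G)} r"
      using sorted by (auto simp: mono_on_def r_def G_def sorted_wrt_iff_nth_less le_less)
    fix j assume "j < length Ps"
    then have j: "j < n" by (simp add: n_def)
    define I where "I = {k. k < length ys \<and> fst (ys ! k) = j}"
    have mem: "snd (ys ! k) \<in> Ob D" if "k \<in> I" for k
      using exceptional_seq_Ob[OF seqG] that by (auto simp: I_def G_def)
    have "E \<in> set (F j) \<longleftrightarrow> (\<exists>k<length ys. ys ! k = (j, E))" for E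
      using j set_ys by (simp add: in_set_conv_nth[symmetric])
    then have "set (F j) = (\<Union>k\<in>I. {snd (ys ! k)})" by (force simp: I_def)
    then have "Ps ! j = gen D (\<Union>k\<in>I. gen D {snd (ys ! k)})"
      using F(2)[OF j] gen_UN_gen[of I "\<lambda>k. {snd (ys ! k)}"] mem by simp
    moreover have "(\<Union>k\<in>I. gen D {snd (ys ! k)}) =
        (\<Union>k\<in>{k. k < length (gens G) \<and> r k = j}. gens G ! k)"
      by (auto simp: I_def G_def r_def)
    ultimately show "Ps ! j =
        gen D (\<Union>k\<in>{k. k < length (gens G) \<and> r k = j}. gens G ! k)"
      by simp
  qed
  then have "gens G = Ps" using finest SOD_of_exceptional_seq[OF G] by blast
  then show ?thesis using G by blast
qed

end

lemma equiv_exceptional_equiv: "equiv (full_exceptional_seqs D) (exceptional_equiv D)"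
  by (rule equivI) (auto simp: exceptional_equiv_def refl_on_def sym_def trans_def)

lemma exceptional_equiv_iff:
  "(Es, Fs) \<in> exceptional_equiv D \<longleftrightarrow> Es \<in> full_exceptional_seqs D \<and> Fs \<in> full_exceptional_seqs D \<and>
     map (\<lambda>E. gen D {E}) Es = map (\<lambda>E. gen D {E}) Fs"
  by (auto simp: exceptional_equiv_def list_eq_iff_nth_eq)

theorem theorem5p6:
  fixes D :: "('o, 'm::ab_group_add, 'k::alg_closed_field) tri_cat"
  assumes "klinear_triangulated_category D"
    and "has_serre_functor D"
    and "\<And>B. admissible D B \<Longrightarrow> \<exists>Es. exceptional_seq D Es \<and> B = gen D (set Es)"
  shows "\<exists>\<chi>.
    bij_betw \<chi> (full_exceptional_seqs D // exceptional_equiv D) (finest_SODs D) \<and>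
    (\<forall>Es \<in> full_exceptional_seqs D.
       \<chi> (exceptional_equiv D `` {Es}) = map (\<lambda>E. gen D {E}) Es \<and>
       (\<forall>i. Suc i < length Es \<longrightarrow>
          (\<exists>Fs. left_mutation D i Es Fs) \<and>
          (\<exists>Fs. right_mutation D i Es Fs) \<and>
          (\<forall>Fs. left_mutation D i Es Fs \<longrightarrow>
             Fs \<in> full_exceptional_seqs D \<and>
             \<chi> (exceptional_equiv D `` {Fs}) =
               SOD_right_mutation D i (\<chi> (exceptional_equiv D `` {Es}))) \<and>
          (\<forall>Fs. right_mutation D i Es Fs \<longrightarrow>
             Fs \<in> full_exceptional_seqs D \<and>
             \<chi> (exceptional_equiv D `` {Fs}) =
               SOD_left_mutation D i (\<chi> (exceptional_equiv D `` {Es})))))"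
proof -
  interpret pretriangulated_category D
    by (rule klinear_triangulated_category.pretriangulated[OF assms(1)])
  \<comment> \<open>The hypothesis on admissible subcategories, applied to D itself.\<close>
  obtain E0 where E0: "exceptional_seq D E0" "gen D (set E0) = Ob D"
    using assms(3)[OF admissible_Ob] by metis
  obtain S where SO: "\<And>X. X \<in> Ob D \<Longrightarrow> S X \<in> Ob D"
    and S: "\<And>X Y. \<lbrakk>X \<in> Ob D; Y \<in> Ob D; Hom D Y (S X) = {0}\<rbrakk> \<Longrightarrow> Hom D X Y = {0}"
    using serre_vanishing[OF assms(2)] by blast
  interpret full_exceptional_category D E0
  proof
    show "finite_dim_Homs D" using assms(2) by (simp add: has_serre_functor_def)
    show "fin_hom D X Y" if "X \<in> Ob D" "Y \<in> Ob D" for X Y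
      using fin_hom_of_serre[OF E0 SO S that] .
  qed (fact E0)+
  let ?F = "full_exceptional_seqs D" and ?R = "exceptional_equiv D"
  let ?g = "map (\<lambda>E. gen D {E})"
  note eq = equiv_exceptional_equiv[of D]
  \<comment> \<open>Any representative gives the same list, because on full exceptional sequences
    the equivalence is equality of the lists of generated subcategories
    (\<open>exceptional_equiv_iff\<close>).\<close>
  define \<chi> where "\<chi> c = ?g (SOME Es. Es \<in> c)" for c
  have \<chi>: "\<chi> (?R `` {Es}) = ?g Es" if "Es \<in> ?F" for Es
  proof -
    have "Es \<in> ?R `` {Es}" using equiv_class_self[OF eq that] .
    then have "(SOME Fs. Fs \<in> ?R `` {Es}) \<in> ?R `` {Es}" by (rule someI)
    then show ?thesis by (auto simp: \<chi>_def exceptional_equiv_iff)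
  qed
  have "bij_betw \<chi> (?F // ?R) (finest_SODs D)"
  proof (rule bij_betw_imageI)
    show "inj_on \<chi> (?F // ?R)"
    proof (rule inj_onI)
      fix c c' assume "c \<in> ?F // ?R" "c' \<in> ?F // ?R" and e: "\<chi> c = \<chi> c'"
      then obtain Es Fs where c: "c = ?R `` {Es}" "Es \<in> ?F" "c' = ?R `` {Fs}" "Fs \<in> ?F"
        by (auto elim!: quotientE)
      then have "(Es, Fs) \<in> ?R" using e \<chi> by (simp add: exceptional_equiv_iff)
      then show "c = c'" using equiv_class_eq[OF eq] c by blast
    qed
    show "\<chi> ` (?F // ?R) = finest_SODs D"
    proof
      show "\<chi> ` (?F // ?R) \<subseteq> finest_SODs D"
        using \<chi> finest_SOD_of_exceptional_seq by (auto elim!: quotientE)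
      show "finest_SODs D \<subseteq> \<chi> ` (?F // ?R)"
      proof
        fix Ps assume Ps: "Ps \<in> finest_SODs D"
        then have "SOD D Ps" by (simp add: finest_SODs_def)
        then obtain Es where "Es \<in> ?F" "?g Es = Ps"
          using exceptional_seq_of_finest_SOD[OF Ps] assms(3) SOD_component_admissible by metis
        then show "Ps \<in> \<chi> ` (?F // ?R)" using \<chi> by (metis image_eqI quotientI)
      qed
    qed
  qed
  then show ?thesis
  proof (intro exI[of _ \<chi>] conjI ballI allI impI)
    fix Es assume Es: "Es \<in> ?F"
    show "\<chi> (?R `` {Es}) = ?g Es" using \<chi>[OF Es] .
    fix i assume i: "Suc i < length Es"
    show "\<exists>Fs. left_mutation D i Es Fs" "\<exists>Fs. right_mutation D i Es Fs"
      using mutations_exist[OF Es i] .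
    fix Fs
    { assume m: "left_mutation D i Es Fs"
      show Fs: "Fs \<in> ?F" using left_mutation_seq(1)[OF Es i m] .
      show "\<chi> (?R `` {Fs}) = SOD_right_mutation D i (\<chi> (?R `` {Es}))"
        unfolding \<chi>[OF Es] \<chi>[OF Fs] using left_mutation_seq(2)[OF Es i m] . }
    { assume m: "right_mutation D i Es Fs"
      show Fs: "Fs \<in> ?F" using right_mutation_seq(1)[OF Es i m] .
      show "\<chi> (?R `` {Fs}) = SOD_left_mutation D i (\<chi> (?R `` {Es}))"
        unfolding \<chi>[OF Es] \<chi>[OF Fs] using right_mutation_seq(2)[OF Es i m] . }
  qed
qed

end
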